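(* Let $B_n$ be the braid group endowed with the dual Garside structure. Let $n=rd+1$ for integers $r\geqslant 2$ and $d\geqslant 1$, and let $\varepsilon=\delta a_{21}$. Let $\alpha$ be a 1-pure braid in the super summit set of $\varepsilon^d$ in $B_n$. If $d=1$, then $\alpha=\varepsilon$. If $d\geqslant 2$, then $\alpha=\delta^d a$ for a simple element $a$ of the form $a=a_{d+1,1}b_0 b_1 \cdots b_{r-1}$, where (1) each $b_k$ is a simple element supported on $kd+\{2,3,\ldots,d+1\}=\{kd+2,\ldots,kd+d+1\}$ for $0\leqslant k\leqslant r-1$, and (2) $b_0\, \tau^{-d}(b_1)\,\tau^{-2d}(b_2)\cdots\tau^{-(r-1)d}(b_{r-1})=[d+1,\ldots,3,2]$. In this case, $c^{-1}\alpha c=\varepsilon^d$ for the simple element $$c=\tau^{-d}(b_1b_2\cdots b_{r-1})\,\tau^{-2d}(b_2b_3\cdots b_{r-1})\cdots\tau^{-(r-1)d}(b_{r-1}).$$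
   Context: $B_n$ has the Birman–Ko–Lee presentation with band generators $a_{ij}$, $1\leqslant j<i\leqslant n$, where $a_{ij}=\sigma_{i-1}\cdots\sigma_{j+1}\sigma_j\sigma_{j+1}^{-1}\cdots\sigma_{i-1}^{-1}$ in terms of Artin generators, and $a_{ji}:=a_{ij}$. The dual Garside structure is $(B_n,B_n^+,\delta)$ where $B_n^+$ is the monoid of elements represented by positive words in the band generators and $\delta=a_{n,n-1}a_{n-1,n-2}\cdots a_{21}=\sigma_{n-1}\cdots\sigma_1$. The partial order: $\alpha\preccurlyeq\beta$ iff $\alpha^{-1}\beta\in B_n^+$. Simple elements are the $\alpha$ with $1\preccurlyeq\alpha\preccurlyeq\delta$. For $\alpha\in B_n$, $\inf(\alpha)=\max\{r:\delta^r\preccurlyeq\alpha\}$, $\sup(\alpha)=\min\{s:\alpha\preccurlyeq\delta^s\}$, $\operatorname{len}(\alpha)=\sup(\alpha)-\inf(\alpha)$; the super summit set $[\alpha]^S$ is the set of conjugates $\beta$ of $\alpha$ with $\operatorname{len}(\beta)$ minimal among all conjugates. $\tau(\alpha)=\delta^{-1}\alpha\delta$; one has $\tau(a_{ij})=a_{i+1,j+1}$ with indices mod $n$. For $1\leqslant i_1<\cdots<i_k\leqslant n$, $[i_k,\ldots,i_1]$ denotes $a_{i_ki_{k-1}}\cdots a_{i_3i_2}a_{i_2i_1}$ (a subsimple with support $\{i_1,\ldots,i_k\}$ when $k\ge2$; the identity when $k=1$). Every simple element is uniquely (up to order of commuting factors) a product $b_{T_1}\cdots b_{T_m}$ of subsimples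 over the blocks of a noncrossing partition $\{T_1,\dots,T_m\}$ of $\{1,\ldots,n\}$; a simple element is supported on $S$ if every nonidentity subsimple factor has support contained in $S$. A braid $\alpha$ is 1-pure if its induced permutation fixes $1$. *)

theory Defs
  imports Main
begin

text \<open>A braid word on n strands is a list of nonzero integers k with |k| < n;
  k > 0 stands for sigma_k and k < 0 for sigma_{|k|}^{-1}.  Elements of B_n are
  words modulo the congruence beq n generated by free cancellation and the
  Artin braid relations.  Equality in B_n is beq n.\<close>

definition braid_word :: "nat \<Rightarrow> int list \<Rightarrow> bool" where
  "braid_word n w \<longleftrightarrow> (\<forall>x\<in>set w. x \<noteq> 0 \<and> \<bar>x\<bar> < int n)"

inductive beq :: "nat \<Rightarrow> int list \<Rightarrow> int list \<Rightarrow> bool" for n :: nat where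
  refl: "braid_word n w \<Longrightarrow> beq n w w"
| sym: "beq n u v \<Longrightarrow> beq n v u"
| trans: "beq n u v \<Longrightarrow> beq n v w \<Longrightarrow> beq n u w"
| cong: "beq n u u' \<Longrightarrow> beq n v v' \<Longrightarrow> beq n (u @ v) (u' @ v')"
| cancel1: "1 \<le> k \<Longrightarrow> k < int n \<Longrightarrow> beq n [k, -k] []"
| cancel2: "1 \<le> k \<Longrightarrow> k < int n \<Longrightarrow> beq n [-k, k] []"
| commute: "1 \<le> i \<Longrightarrow> 1 \<le> j \<Longrightarrow> i < int n \<Longrightarrow> j < int n \<Longrightarrow> \<bar>i - j\<bar> \<ge> 2
             \<Longrightarrow> beq n [i, j] [j, i]"
| braid: "1 \<le> i \<Longrightarrow> i + 1 < int n \<Longrightarrow> beq n [i, i + 1, i] [i + 1, i, i + 1]"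

definition winv :: "int list \<Rightarrow> int list" where
  "winv w = rev (map uminus w)"

definition band0 :: "nat \<Rightarrow> nat \<Rightarrow> int list" where
  "band0 i j = map int (rev [Suc j..<i]) @ [int j] @ map (\<lambda>k. - int k) [Suc j..<i]"

definition band :: "nat \<Rightarrow> nat \<Rightarrow> int list" where
  "band i j = (if j < i then band0 i j else band0 j i)"

definition delta :: "nat \<Rightarrow> int list" where
  "delta n = map int (rev [1..<n])"

definition wpow :: "int list \<Rightarrow> int \<Rightarrow> int list" where
  "wpow w m = (if 0 \<le> m then concat (replicate (nat m) w) else concat (replicate (nat (-m)) (winv w)))"

definition dpow :: "nat \<Rightarrow> int \<Rightarrow> int list" where
  "dpow n m = wpow (delta n) m"

definition positive :: "nat \<Rightarrow> int list \<Rightarrow> bool" where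
  "positive n w \<longleftrightarrow> (\<exists>ps. (\<forall>(i, j)\<in>set ps. 1 \<le> j \<and> j < i \<and> i \<le> n)
       \<and> beq n w (concat (map (\<lambda>(i, j). band i j) ps)))"

definition preceq :: "nat \<Rightarrow> int list \<Rightarrow> int list \<Rightarrow> bool" where
  "preceq n x y \<longleftrightarrow> braid_word n x \<and> positive n (winv x @ y)"

definition simple :: "nat \<Rightarrow> int list \<Rightarrow> bool" where
  "simple n w \<longleftrightarrow> preceq n [] w \<and> preceq n w (delta n)"

definition binf :: "nat \<Rightarrow> int list \<Rightarrow> int" where
  "binf n w = (GREATEST r. preceq n (dpow n r) w)"

definition bsup :: "nat \<Rightarrow> int list \<Rightarrow> int" where
  "bsup n w = (LEAST s. preceq n w (dpow n s))"

definition blen :: "nat \<Rightarrow> int list \<Rightarrow> int" where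
  "blen n w = bsup n w - binf n w"

definition conjugate :: "nat \<Rightarrow> int list \<Rightarrow> int list \<Rightarrow> bool" where
  "conjugate n x y \<longleftrightarrow> (\<exists>c. braid_word n c \<and> beq n y (winv c @ x @ c))"

definition super_summit_set :: "nat \<Rightarrow> int list \<Rightarrow> int list set" where
  "super_summit_set n x = {y. conjugate n x y \<and> (\<forall>z. conjugate n x z \<longrightarrow> blen n y \<le> blen n z)}"

definition tau_pow :: "nat \<Rightarrow> int \<Rightarrow> int list \<Rightarrow> int list" where
  "tau_pow n m w = dpow n (-m) @ w @ dpow n m"

text \<open>Subsimple [i_k,...,i_1] = a_{i_k i_{k-1}} ... a_{i_2 i_1} for i_1 < ... < i_k.\<close>
fun subsimple_list :: "nat list \<Rightarrow> int list" where
  "subsimple_list [] = []"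
| "subsimple_list [x] = []"
| "subsimple_list (x # y # rest) = subsimple_list (y # rest) @ band y x"

definition subsimple :: "nat set \<Rightarrow> int list" where
  "subsimple T = subsimple_list (sorted_list_of_set T)"

definition noncrossing_partition :: "nat \<Rightarrow> nat set list \<Rightarrow> bool" where
  "noncrossing_partition n P \<longleftrightarrow>
     distinct P \<and> (\<forall>T\<in>set P. T \<noteq> {}) \<and> \<Union>(set P) = {1..n}
     \<and> (\<forall>T\<in>set P. \<forall>U\<in>set P. T \<noteq> U \<longrightarrow> T \<inter> U = {})
     \<and> (\<forall>T\<in>set P. \<forall>U\<in>set P. T \<noteq> U \<longrightarrow>
          \<not> (\<exists>a b c e. a < b \<and> b < c \<and> c < e \<and> a \<in> T \<and> c \<in> T \<and> b \<in> U \<and> e \<in> U))"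

text \<open>A simple element is supported on S if, in its decomposition as a product of
  subsimples over the blocks of a noncrossing partition, every nonidentity factor
  (block of size at least 2) has support contained in S.\<close>
definition supported_on :: "nat \<Rightarrow> nat set \<Rightarrow> int list \<Rightarrow> bool" where
  "supported_on n S w \<longleftrightarrow> (\<exists>P. noncrossing_partition n P
      \<and> beq n w (concat (map subsimple P))
      \<and> (\<forall>T\<in>set P. 2 \<le> card T \<longrightarrow> T \<subseteq> S))"

definition transp_at :: "nat \<Rightarrow> nat \<Rightarrow> nat" where
  "transp_at k x = (if x = k then k + 1 else if x = k + 1 then k else x)"

definition braid_perm :: "int list \<Rightarrow> nat \<Rightarrow> nat" where
  "braid_perm w = foldr (\<lambda>x p. p \<circ> transp_at (nat \<bar>x\<bar>)) w id"

definition one_pure :: "int list \<Rightarrow> bool" where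
  "one_pure w \<longleftrightarrow> braid_perm w 1 = 1"

end

theory Submission
  imports Defs "HOL-Combinatorics.Transposition"
begin

text \<open>Exponent sums force \<open>\<alpha> = \<delta>^d a\<close> with \<open>a\<close> simple of length \<open>d\<close>, because \<open>\<epsilon>^d = \<delta>^d [d+1, \<dots>, 1]\<close>.
  Since \<open>\<epsilon>^(n-1) = \<delta>^n\<close> is central, \<open>\<alpha>^r = \<delta>^n\<close>, and so \<open>\<tau>^((r-1)d)(a) \<cdots> \<tau>^d(a) a = \<delta>\<close> is a
  factorization of \<open>\<delta>\<close> into \<open>n - 1\<close> bands.  Such factorizations are controlled by permutations: a band
  to the right of \<open>a_ji\<close>, where \<open>i < j\<close>, joins two points of \<open>{i+1, \<dots>, j}\<close> or two points of its complement.
  As \<open>\<alpha>\<close> is 1-pure, \<open>a = a_(d+1,1) b\<close>; applying this to the bands \<open>\<tau>^(kd)(a_(d+1,1))\<close> shows that every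
  band of \<open>b\<close> lies in one of the intervals \<open>{kd+2, \<dots>, kd+d+1}\<close>, which yields the \<open>b_k\<close>.
  The identity \<open>\<alpha> c = c \<beta>\<close> with \<open>\<beta> = \<delta>^d a_(d+1,1) b_0 \<tau>^(-d)(b_1) \<cdots> \<tau>^(-(r-1)d)(b_(r-1))\<close> needs only
  these supports.  Comparing permutations in \<open>\<beta>^r = \<delta>^n\<close> then gives (2), and hence \<open>\<beta> = \<epsilon>^d\<close>.\<close>

section \<open>Groups and products of bands\<close>

text \<open>Braids are told apart by two invariants, the permutation and the exponent sum. Below
  \<open>\<Delta>\<close> these determine the element: a factor of \<open>\<Delta>\<close>, written
  in bands, is a graph whose numbers of edges and of components add up to exactly \<open>n\<close>,
  so nothing is left open once the permutation is known. The condition \<open>n = r * d + 1\<close>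
  makes the \<open>r\<close> translates of \<open>{1..d+1}\<close> by multiples of \<open>d\<close>
  a chain covering \<open>{1..n}\<close> in which neighbours share one point. Without their least
  points they are disjoint, and these are the intervals that support the \<open>b_k\<close>.
  Simplicity of \<open>c\<close> and of the \<open>b_k\<close> rests on (2), while (2) rests on the
  conjugation by \<open>c\<close>. The conjugation is therefore proved for an arbitrary family
  supported in the intervals, and simplicity comes last, by exhibiting these elements as factors of
  \<open>\<Delta>\<close>.\<close>

class mult_group = monoid_mult + inverse +
  assumes group_left_inverse [simp]: "inverse a * a = 1"
    and group_divide: "a / b = a * inverse b"
begin

lemma group_left_cancel: "a * b = a * c \<longleftrightarrow> b = c"
  by (metis group_left_inverse mult_assoc mult_1_left)

lemma group_right_inverse [simp]: "a * inverse a = 1"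
  by (metis group_left_cancel group_left_inverse mult_assoc mult_1_left mult_1_right)

lemma group_right_cancel: "b * a = c * a \<longleftrightarrow> b = c"
  by (metis group_right_inverse mult_assoc mult_1_right)

lemma group_cancel_simps [simp]:
  "inverse a * (a * b) = b" "a * (inverse a * b) = b"
  by (simp_all flip: mult_assoc)

lemma group_inverse_unique: "a * b = 1 \<Longrightarrow> inverse a = b"
  by (metis group_left_cancel group_right_inverse)

lemma group_inverse_inverse [simp]: "inverse (inverse a) = a"
  by (rule group_inverse_unique) simp

lemma group_inverse_mult: "inverse (a * b) = inverse b * inverse a"
  by (rule group_inverse_unique) (simp add: mult_assoc)

lemma group_inverse_one [simp]: "inverse 1 = 1"
  by (rule group_inverse_unique) simp

lemma group_commute_inverse: "a * b = b * a \<Longrightarrow> a * inverse b = inverse b * a"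
  by (metis group_left_cancel group_right_inverse mult_assoc mult_1_right group_left_inverse mult_1_left)

end

lemma group_powi_add:
  fixes x :: "'a::mult_group"
  shows "x powi (a + b) = x powi a * x powi b"
proof -
  have step: "x powi (m + 1) = x powi m * x" for m
  proof (cases "m \<ge> 0")
    case True
    then show ?thesis by (simp add: power_int_def nat_add_distrib flip: power_Suc2)
  next
    case False
    then obtain k where k: "m = - int (Suc k)"
      by (metis int_ops(4) not_le_imp_less negD of_nat_Suc)
    have "x powi m = inverse x ^ k * inverse x"
      by (simp add: k power_int_def power_Suc2 nat_add_distrib del: power_Suc)
    moreover have "x powi (m + 1) = inverse x ^ k"
      by (auto simp: k power_int_def)
    ultimately show ?thesis by (simp add: mult.assoc)
  qed
  show ?thesis
  proof (induction b rule: int_induct [where k = 0])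
    case (step1 i)
    then show ?case using step [of "a + i"] step [of i] by (simp add: add.assoc mult.assoc)
  next
    case (step2 i)
    have "x powi (a + (i - 1)) * x = x powi a * x powi (i - 1) * x"
      using step2 step [of "a + i - 1"] step [of "i - 1"] by (simp add: algebra_simps mult.assoc)
    then show ?case by (simp add: group_right_cancel)
  qed simp
qed

lemma group_powi_minus:
  fixes x :: "'a::mult_group"
  shows "x powi (- m) = inverse (x powi m)"
  by (rule group_inverse_unique [symmetric]) (simp flip: group_powi_add)

section \<open>Words in bands as lists of edges, and noncrossing sets\<close>

type_synonym edge = "nat \<times> nat"

fun path_edges :: "nat list \<Rightarrow> edge list" where
  "path_edges [] = []"
| "path_edges [x] = []"
| "path_edges (x # y # r) = path_edges (y # r) @ [(y, x)]"

definition edges_in :: "nat set \<Rightarrow> edge list \<Rightarrow> bool" where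
  "edges_in S es \<longleftrightarrow> (\<forall>(i, j) \<in> set es. i \<in> S \<and> j \<in> S \<and> i \<noteq> j)"

lemma edges_in_simps [simp]:
  "edges_in S []"
  "edges_in S (e # es) \<longleftrightarrow> fst e \<in> S \<and> snd e \<in> S \<and> fst e \<noteq> snd e \<and> edges_in S es"
  "edges_in S (es @ fs) \<longleftrightarrow> edges_in S es \<and> edges_in S fs"
  by (auto simp: edges_in_def)

lemma edges_in_concat: "edges_in S (concat ess) \<longleftrightarrow> (\<forall>es\<in>set ess. edges_in S es)"
  by (auto simp: edges_in_def)

lemma edges_in_mono: "edges_in S es \<Longrightarrow> S \<subseteq> T \<Longrightarrow> edges_in T es"
  by (auto simp: edges_in_def)

lemma path_edges_append: "path_edges (L @ x # M) = path_edges (x # M) @ path_edges (L @ [x])"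
  by (induction L rule: path_edges.induct) simp_all

lemma path_edges_snoc: "path_edges (L @ [x, y]) = (y, x) # path_edges (L @ [x])"
  using path_edges_append [of L x "[y]"] by simp

lemma length_path_edges: "length (path_edges L) = length L - 1"
  by (induction L rule: path_edges.induct) auto

lemma edges_in_path_edges: "distinct L \<Longrightarrow> set L \<subseteq> S \<Longrightarrow> edges_in S (path_edges L)"
  by (induction L rule: path_edges.induct) auto

text \<open>The pattern is excluded in both orders, so that the relation is symmetric;
  \<open>noncrossing_partition\<close> gets the same effect by ranging over ordered pairs of
  blocks.\<close>

definition noncrossing :: "nat set \<Rightarrow> nat set \<Rightarrow> bool" where
  "noncrossing T U \<longleftrightarrow> T \<inter> U = {} \<and>
    \<not> (\<exists>a b c e. a < b \<and> b < c \<and> c < e \<and> (a \<in> T \<and> c \<in> T \<and> b \<in> U \<and> e \<in> U \<or> a \<in> U \<and> c \<in> U \<and> b \<in> T \<and> e \<in> T))"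

lemma noncrossing_sym: "noncrossing T U \<Longrightarrow> noncrossing U T"
  unfolding noncrossing_def by blast

lemma noncrossing_mono: "noncrossing T U \<Longrightarrow> T' \<subseteq> T \<Longrightarrow> U' \<subseteq> U \<Longrightarrow> noncrossing T' U'"
  unfolding noncrossing_def by blast

lemma noncrossing_less: "(\<And>x y. x \<in> T \<Longrightarrow> y \<in> U \<Longrightarrow> x < y) \<Longrightarrow> noncrossing T U"
  unfolding noncrossing_def by (meson disjoint_iff order.asym less_trans)

text \<open>Every crossing contains three increasing points lying in \<open>U\<close>,
  \<open>T\<close>, \<open>U\<close>; the middle one would be in the interval that \<open>T\<close>
  avoids.\<close>

lemma noncrossing_outside:
  assumes "\<And>x. x \<in> T \<Longrightarrow> x < a \<or> b \<le> x" "\<And>y. y \<in> U \<Longrightarrow> a \<le> y \<and> y < b"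
  shows "noncrossing T U"
  unfolding noncrossing_def
proof (intro conjI notI)
  show "T \<inter> U = {}" using assms by fastforce
next
  assume "\<exists>p q s t. p < q \<and> q < s \<and> s < t \<and>
    (p \<in> T \<and> s \<in> T \<and> q \<in> U \<and> t \<in> U \<or> p \<in> U \<and> s \<in> U \<and> q \<in> T \<and> t \<in> T)"
  then obtain q s t where "q < s" "s < t" "q \<in> U \<and> s \<in> T \<and> t \<in> U" by metis
  then show False using assms(1) [of s] assms(2) [of q] assms(2) [of t] by linarith
qed

definition block_edges :: "nat set \<Rightarrow> edge list" where
  "block_edges T = path_edges (sorted_list_of_set T)"

definition blocks_edges :: "nat set list \<Rightarrow> edge list" where
  "blocks_edges P = concat (map block_edges P)"

lemma edges_in_block_edges: "finite T \<Longrightarrow> edges_in T (block_edges T)"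
  unfolding block_edges_def by (rule edges_in_path_edges) auto

text \<open>The Birman-Ko-Lee relations as axioms: bands on noncrossing pairs commute, and the three
  bands of a triangle have equal cyclic products. Arguing from these alone keeps the Artin words out
  of the combinatorics.\<close>

locale band_generators =
  fixes n :: nat and A :: "nat \<Rightarrow> nat \<Rightarrow> 'a::mult_group"
  assumes A_sym: "A i j = A j i"
    and A_disjoint: "1 \<le> j \<Longrightarrow> j < i \<Longrightarrow> i < l \<Longrightarrow> l < k \<Longrightarrow> k \<le> n \<Longrightarrow> A i j * A k l = A k l * A i j"
    and A_nested: "1 \<le> j \<Longrightarrow> j < l \<Longrightarrow> l < k \<Longrightarrow> k < i \<Longrightarrow> i \<le> n \<Longrightarrow> A i j * A k l = A k l * A i j"
    and A_triangle1: "1 \<le> k \<Longrightarrow> k < j \<Longrightarrow> j < i \<Longrightarrow> i \<le> n \<Longrightarrow> A i j * A j k = A j k * A i k"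
    and A_triangle2: "1 \<le> k \<Longrightarrow> k < j \<Longrightarrow> j < i \<Longrightarrow> i \<le> n \<Longrightarrow> A j k * A i k = A i k * A i j"
begin

definition bw :: "edge list \<Rightarrow> 'a" where
  "bw es = prod_list (map (\<lambda>(i, j). A i j) es)"

lemma bw_simps [simp]:
  "bw [] = 1" "bw (e # es) = A (fst e) (snd e) * bw es" "bw (es @ fs) = bw es * bw fs"
  by (auto simp: bw_def split: prod.split)

lemma A_commute_noncrossing:
  assumes "noncrossing T U" "i \<in> T" "j \<in> T" "k \<in> U" "l \<in> U" "i \<noteq> j" "k \<noteq> l"
    "T \<subseteq> {1..n}" "U \<subseteq> {1..n}"
  shows "A i j * A k l = A k l * A i j"
proof -
  have *: "A i j * A k l = A k l * A i j"
    if "noncrossing T U" "i \<in> T" "j \<in> T" "k \<in> U" "l \<in> U" "j < i" "l < k"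
      "T \<subseteq> {1..n}" "U \<subseteq> {1..n}" for i j k l T U
  proof -
    have le: "1 \<le> j" "1 \<le> l" "i \<le> n" "k \<le> n" using that by (auto simp: subset_iff)
    have ne: "i \<noteq> k" "i \<noteq> l" "j \<noteq> k" "j \<noteq> l" using that unfolding noncrossing_def by auto
    have "\<not> (j < l \<and> l < i \<and> i < k)" "\<not> (l < j \<and> j < k \<and> k < i)"
      using that unfolding noncrossing_def by blast+
    then consider "i < l" | "k < j" | "j < l" "k < i" | "l < j" "i < k"
      using ne \<open>j < i\<close> \<open>l < k\<close> by linarith
    then show ?thesis
      using le \<open>j < i\<close> \<open>l < k\<close>
      by cases (simp_all add: A_disjoint A_nested A_disjoint [symmetric] A_nested [symmetric])
  qed
  have **: "A i j * A k l = A k l * A i j" if "l < k" "k \<in> U" "l \<in> U" for k l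
  proof (cases "j < i")
    case True
    with * that assms show ?thesis by blast
  next
    case False
    with assms have "i < j" by simp
    then have "A j i * A k l = A k l * A j i" using * that assms by blast
    then show ?thesis by (simp only: A_sym [of j i])
  qed
  show ?thesis
  proof (cases "l < k")
    case True
    with ** assms show ?thesis by blast
  next
    case False
    with assms have "k < l" by simp
    then have "A i j * A l k = A l k * A i j" using ** assms by blast
    then show ?thesis by (simp only: A_sym [of l k])
  qed
qed

lemma commute_bw:
  assumes "\<And>i j. (i, j) \<in> set es \<Longrightarrow> g * A i j = A i j * g"
  shows "g * bw es = bw es * g"
  using assms
proof (induction es)
  case (Cons e es)
  then have "g * bw es = bw es * g" "g * A (fst e) (snd e) = A (fst e) (snd e) * g"
    by (metis list.set_intros(2)) (metis Cons.prems list.set_intros(1) prod.collapse)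
  then show ?case by (metis bw_simps(2) mult.assoc)
qed simp

lemma bw_commute_noncrossing:
  assumes "noncrossing T U" "edges_in T es" "edges_in U fs" "T \<subseteq> {1..n}" "U \<subseteq> {1..n}"
  shows "bw es * bw fs = bw fs * bw es"
proof (rule commute_bw)
  fix i j assume ij: "(i, j) \<in> set fs"
  have "A i j * bw es = bw es * A i j"
  proof (rule commute_bw)
    fix k l assume "(k, l) \<in> set es"
    then show "A i j * A k l = A k l * A i j"
      using ij assms A_commute_noncrossing [of U T i j k l] noncrossing_sym [of T U]
      by (force simp: edges_in_def)
  qed
  then show "bw es * A i j = A i j * bw es" by simp
qed

lemma A_commute_bw_noncrossing:
  assumes "noncrossing T U" "i \<in> T" "j \<in> T" "i \<noteq> j" "edges_in U fs" "T \<subseteq> {1..n}" "U \<subseteq> {1..n}"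
  shows "A i j * bw fs = bw fs * A i j"
  using bw_commute_noncrossing [of T U "[(i, j)]" fs] assms by simp

section \<open>Splitting one band off a subsimple element\<close>

abbreviation sub :: "nat list \<Rightarrow> 'a" where
  "sub L \<equiv> bw (path_edges L)"

text \<open>The triangle relation moves the lower end of the band at \<open>j\<close> down the
  chain, one point of \<open>M\<close> at a time, until it reaches \<open>i\<close>.\<close>

lemma sub_snoc_top:
  assumes "sorted_wrt (<) (i # M @ [j])" "set (i # M @ [j]) \<subseteq> {1..n}"
  shows "sub (i # M @ [j]) = sub (i # M) * A j i"
  using assms
proof (induction M arbitrary: i)
  case (Cons m M)
  have "sub (i # (m # M) @ [j]) = sub (m # M) * (A j m * A m i)"
    using Cons by (simp add: mult.assoc)
  also have "A j m * A m i = A m i * A j i"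
    using Cons by (intro A_triangle1) auto
  finally show ?case by (simp add: mult.assoc)
qed simp

lemma sub_cons_top:
  assumes "sorted_wrt (<) (i # M @ [j])" "set (i # M @ [j]) \<subseteq> {1..n}"
  shows "sub (i # M @ [j]) = A j i * sub (M @ [j])"
  using assms
proof (induction M arbitrary: i)
  case (Cons m M)
  have IH: "sub (m # M @ [j]) = A j m * sub (M @ [j])"
    using Cons by simp
  have tri: "A j m * A m i = A j i * A j m"
    using Cons.prems A_triangle1 [of i m j] A_triangle2 [of i m j] by auto
  have "noncrossing {i, m} (set (M @ [j]))"
    using Cons.prems by (intro noncrossing_less) auto
  then have comm: "A m i * sub (M @ [j]) = sub (M @ [j]) * A m i"
    using Cons.prems
    by (intro A_commute_bw_noncrossing [of "{i, m}" "set (M @ [j])"] edges_in_path_edges)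
      (auto simp: strict_sorted_iff)
  have "sub (i # (m # M) @ [j]) = A j m * (sub (M @ [j]) * A m i)"
    using IH by (simp add: mult.assoc)
  also have "\<dots> = A j i * (A j m * sub (M @ [j]))"
    by (simp add: comm [symmetric] tri flip: mult.assoc)
  finally show ?case by (simp add: IH)
qed simp

text \<open>Conjugation by the band on the two top points replaces \<open>i\<close> by
  \<open>j\<close> as the upper end of the chain. Only the band next to that end takes part; the
  others do not cross \<open>{i, j}\<close>.\<close>

lemma sub_snoc_shift:
  assumes "sorted_wrt (<) (P @ [i, j])" "set (P @ [i, j]) \<subseteq> {1..n}"
  shows "A j i * sub (P @ [i]) = sub (P @ [j]) * A j i"
proof (cases P rule: rev_cases)
  case (snoc P' p)
  have tri: "A j i * A i p = A j p * A j i"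
    using assms snoc A_triangle1 [of p i j] A_triangle2 [of p i j] by (auto simp: sorted_wrt_append)
  have "noncrossing {i, j} (set P)"
    using assms by (intro noncrossing_sym [of "set P"] noncrossing_less) (auto simp: sorted_wrt_append)
  then have comm: "A j i * sub P = sub P * A j i"
    using assms
    by (intro A_commute_bw_noncrossing [of "{i, j}" "set P"] edges_in_path_edges)
      (auto simp: strict_sorted_iff)
  have "A j i * sub (P @ [i]) = A j i * A i p * sub P"
    by (simp add: snoc path_edges_snoc mult.assoc)
  also have "\<dots> = A j p * (A j i * sub P)" by (simp add: tri mult.assoc)
  also have "\<dots> = A j p * sub P * A j i" by (simp add: comm mult.assoc)
  finally show ?thesis by (simp add: snoc path_edges_snoc)
qed simp

lemma sub_cons_shift:
  assumes "sorted_wrt (<) (i # j # Q)" "set (i # j # Q) \<subseteq> {1..n}"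
  shows "sub (j # Q) * A j i = A j i * sub (i # Q)"
proof (cases Q)
  case (Cons q Q')
  have tri: "A q j * A j i = A j i * A q i"
    using assms Cons A_triangle1 [of i j q] by auto
  have "noncrossing {i, j} (set Q)"
    using assms by (intro noncrossing_less) auto
  then have comm: "A j i * sub Q = sub Q * A j i"
    using assms
    by (intro A_commute_bw_noncrossing [of "{i, j}" "set Q"] edges_in_path_edges)
      (auto simp: strict_sorted_iff)
  have "sub (j # Q) * A j i = sub Q * A j i * A q i"
    using tri by (simp add: Cons mult.assoc)
  also have "\<dots> = A j i * (sub Q * A q i)" by (simp add: comm flip: mult.assoc)
  finally show ?thesis by (simp add: Cons)
qed simp

lemma sub_append: "sub (L @ x # M) = sub (x # M) * sub (L @ [x])"
  by (subst path_edges_append) simp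

text \<open>On permutations, the transposition of \<open>i\<close> and \<open>j\<close> cuts a cycle
  into two. When the cut is made on the right, the points between stay with \<open>i\<close>; when
  it is made on the left, in \<open>sub_split_left\<close>, they stay with \<open>j\<close>.\<close>

lemma sub_split_right:
  assumes "sorted_wrt (<) (P @ i # M @ j # Q)" "set (P @ i # M @ j # Q) \<subseteq> {1..n}"
  shows "sub (P @ i # M @ j # Q) = sub (P @ j # Q) * sub (i # M) * A j i"
proof -
  have "noncrossing (set (P @ [j])) (set (i # M))"
    using assms by (intro noncrossing_outside [where a = i and b = j]) (auto simp: sorted_wrt_append less_imp_le)
  then have comm: "sub (P @ [j]) * sub (i # M) = sub (i # M) * sub (P @ [j])"
    using assms
    by (intro bw_commute_noncrossing edges_in_path_edges)
      (auto simp: strict_sorted_iff sorted_wrt_append)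
  have "sub (P @ i # M @ j # Q) = sub (j # Q) * sub (i # M @ [j]) * sub (P @ [i])"
    using sub_append [of P i "M @ j # Q"] sub_append [of "i # M" j Q] by simp
  also have "sub (i # M @ [j]) = sub (i # M) * A j i"
    using assms by (intro sub_snoc_top) (auto simp: sorted_wrt_append)
  also have "sub (j # Q) * (sub (i # M) * A j i) * sub (P @ [i])
      = sub (j # Q) * (sub (i # M) * (A j i * sub (P @ [i])))" by (simp add: mult.assoc)
  also have "A j i * sub (P @ [i]) = sub (P @ [j]) * A j i"
    using assms by (intro sub_snoc_shift) (auto simp: sorted_wrt_append)
  also have "sub (i # M) * (sub (P @ [j]) * A j i) = sub (P @ [j]) * (sub (i # M) * A j i)"
    using comm by (simp flip: mult.assoc)
  finally show ?thesis
    by (simp add: sub_append [of P j Q] mult.assoc)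
qed

lemma sub_split_left:
  assumes "sorted_wrt (<) (P @ i # M @ j # Q)" "set (P @ i # M @ j # Q) \<subseteq> {1..n}"
  shows "sub (P @ i # M @ j # Q) = A j i * sub (P @ i # Q) * sub (M @ [j])"
proof -
  have "noncrossing (set (P @ [i])) (set (M @ [j]))"
    using assms by (intro noncrossing_less) (auto simp: sorted_wrt_append)
  then have comm: "sub (P @ [i]) * sub (M @ [j]) = sub (M @ [j]) * sub (P @ [i])"
    using assms
    by (intro bw_commute_noncrossing edges_in_path_edges)
      (auto simp: strict_sorted_iff sorted_wrt_append)
  have "sub (P @ i # M @ j # Q) = sub (j # Q) * sub (i # M @ [j]) * sub (P @ [i])"
    using sub_append [of P i "M @ j # Q"] sub_append [of "i # M" j Q] by simp
  also have "sub (i # M @ [j]) = A j i * sub (M @ [j])"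
    using assms by (intro sub_cons_top) (auto simp: sorted_wrt_append)
  also have "sub (j # Q) * (A j i * sub (M @ [j])) * sub (P @ [i])
      = sub (j # Q) * A j i * (sub (M @ [j]) * sub (P @ [i]))" by (simp add: mult.assoc)
  also have "sub (j # Q) * A j i = A j i * sub (i # Q)"
    using assms by (intro sub_cons_shift) (auto simp: sorted_wrt_append)
  finally show ?thesis
    by (simp add: sub_append [of P i Q] mult.assoc comm)
qed

lemma sorted_list_split:
  assumes "finite T" "i \<in> T" "j \<in> T" "(i::nat) < j"
  defines "P \<equiv> sorted_list_of_set {x\<in>T. x < i}" and "M \<equiv> sorted_list_of_set {x\<in>T. i < x \<and> x < j}"
    and "Q \<equiv> sorted_list_of_set {x\<in>T. j < x}"
  shows "sorted_list_of_set T = P @ i # M @ j # Q"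
    "sorted_list_of_set {x\<in>T. i \<le> x \<and> x < j} = i # M"
    "sorted_list_of_set {x\<in>T. \<not> (i \<le> x \<and> x < j)} = P @ j # Q"
    "sorted_list_of_set {x\<in>T. i < x \<and> x \<le> j} = M @ [j]"
    "sorted_list_of_set {x\<in>T. \<not> (i < x \<and> x \<le> j)} = P @ i # Q"
proof -
  have fin: "finite {x\<in>T. R x}" for R using assms(1) by simp
  have set: "set P = {x\<in>T. x < i}" "set M = {x\<in>T. i < x \<and> x < j}" "set Q = {x\<in>T. j < x}"
    unfolding P_def M_def Q_def by (simp_all only: set_sorted_list_of_set fin)
  have sorted: "sorted_wrt (<) P" "sorted_wrt (<) M" "sorted_wrt (<) Q"
    unfolding P_def M_def Q_def by simp_all
  have eq: "sorted_list_of_set S = L" if "sorted_wrt (<) L" "set L = S" for S and L :: "nat list"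
    using that by (intro strict_sorted_equal) auto
  show "sorted_list_of_set T = P @ i # M @ j # Q"
    by (rule eq) (use assms(2-4) in \<open>auto simp: sorted_wrt_append sorted set\<close>)
  show "sorted_list_of_set {x\<in>T. i \<le> x \<and> x < j} = i # M"
    by (rule eq) (use assms(2-4) in \<open>auto simp: sorted set\<close>)
  show "sorted_list_of_set {x\<in>T. \<not> (i \<le> x \<and> x < j)} = P @ j # Q"
    by (rule eq) (use assms(2-4) in \<open>auto simp: sorted_wrt_append sorted set\<close>)
  show "sorted_list_of_set {x\<in>T. i < x \<and> x \<le> j} = M @ [j]"
    by (rule eq) (use assms(2-4) in \<open>auto simp: sorted_wrt_append sorted set\<close>)
  show "sorted_list_of_set {x\<in>T. \<not> (i < x \<and> x \<le> j)} = P @ i # Q"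
    by (rule eq) (use assms(2-4) in \<open>auto simp: sorted_wrt_append sorted set\<close>)
qed

lemma block_split_right:
  assumes "T \<subseteq> {1..n}" "i \<in> T" "j \<in> T" "i < j"
  shows "bw (block_edges T) = bw (block_edges {x\<in>T. \<not> (i \<le> x \<and> x < j)})
    * bw (block_edges {x\<in>T. i \<le> x \<and> x < j}) * A j i"
proof -
  have fin: "finite T" using assms finite_subset by blast
  note s = sorted_list_split [OF fin assms(2-4)]
  have "sorted_wrt (<) (sorted_list_of_set T)" "set (sorted_list_of_set T) \<subseteq> {1..n}"
    using assms fin by auto
  then show ?thesis
    unfolding block_edges_def s by (rule sub_split_right)
qed

lemma block_split_left:
  assumes "T \<subseteq> {1..n}" "i \<in> T" "j \<in> T" "i < j"
  shows "bw (block_edges T) = A j i * bw (block_edges {x\<in>T. \<not> (i < x \<and> x \<le> j)})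
    * bw (block_edges {x\<in>T. i < x \<and> x \<le> j})"
proof -
  have fin: "finite T" using assms finite_subset by blast
  note s = sorted_list_split [OF fin assms(2-4)]
  have "sorted_wrt (<) (sorted_list_of_set T)" "set (sorted_list_of_set T) \<subseteq> {1..n}"
    using assms fin by auto
  then show ?thesis
    unfolding block_edges_def s by (rule sub_split_left)
qed

abbreviation \<Delta> :: 'a where "\<Delta> \<equiv> bw (block_edges {1..n})"

definition rot :: "nat \<Rightarrow> nat" where "rot x = (if x = n then 1 else Suc x)"

text \<open>Removing the band from \<open>i\<close> to \<open>j\<close> on the left of \<open>\<Delta>\<close> leaves the same two blocks as removing
  the rotated band on the right.\<close>

lemma A_rot:
  assumes "i \<in> {1..n}" "j \<in> {1..n}" "i \<noteq> j"
  shows "A i j * \<Delta> = \<Delta> * A (rot i) (rot j)"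
proof -
  have *: "A j i * \<Delta> = \<Delta> * A (rot j) (rot i)" if "1 \<le> i" "i < j" "j \<le> n" for i j
  proof (cases "j = n")
    \<comment> \<open>Here \<open>rot j\<close> is \<open>1\<close>, so the rotated band joins
      \<open>1\<close> and \<open>Suc i\<close>. Its interval \<open>{1..i}\<close> is the
      complement of the former one, and the two blocks appear in the opposite order.\<close>
    case True
    have "{x \<in> {1..n}. \<not> (i < x \<and> x \<le> j)} = {1..i}" "{x \<in> {1..n}. i < x \<and> x \<le> j} = {i<..n}"
      using that True by auto
    then have "\<Delta> = A j i * bw (block_edges {1..i}) * bw (block_edges {i<..n})"
      using block_split_left [of "{1..n}" i j] that by simp
    moreover have "{x \<in> {1..n}. \<not> (1 \<le> x \<and> x < Suc i)} = {i<..n}" "{x \<in> {1..n}. 1 \<le> x \<and> x < Suc i} = {1..i}"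
      using that True by auto
    then have "\<Delta> = bw (block_edges {i<..n}) * bw (block_edges {1..i}) * A (rot j) (rot i)"
      using block_split_right [of "{1..n}" 1 "Suc i"] that True by (simp add: rot_def A_sym [of "Suc 0" "Suc i"])
    moreover have "bw (block_edges {i<..n}) * bw (block_edges {1..i}) = bw (block_edges {1..i}) * bw (block_edges {i<..n})"
      using that by (intro bw_commute_noncrossing [of "{i<..n}" "{1..i}"] edges_in_block_edges)
        (auto simp: noncrossing_def)
    ultimately show ?thesis by (metis mult.assoc)
  next
    case False
    define U V where "U = {x \<in> {1..n}. \<not> (i < x \<and> x \<le> j)}" and "V = {x \<in> {1..n}. i < x \<and> x \<le> j}"
    have "\<Delta> = A j i * bw (block_edges U) * bw (block_edges V)"
      using that unfolding U_def V_def by (intro block_split_left) auto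
    moreover have "\<Delta> = bw (block_edges U) * bw (block_edges V) * A (rot j) (rot i)"
      using that False by (subst block_split_right [of _ "Suc i" "Suc j"])
        (auto simp: rot_def U_def V_def Suc_le_eq less_Suc_eq_le)
    ultimately show ?thesis by (metis mult.assoc)
  qed
  show ?thesis
    using assms *[of i j] *[of j i] by (cases i j rule: linorder_cases) (simp_all add: A_sym)
qed

end

section \<open>Permutations of band words and noncrossing partitions\<close>

primrec pm :: "edge list \<Rightarrow> nat \<Rightarrow> nat" where
  "pm [] = id"
| "pm (e # es) = pm es \<circ> transpose (fst e) (snd e)"

lemma pm_append: "pm (es @ fs) = pm fs \<circ> pm es"
  by (induction es) (simp_all add: comp_assoc)

lemma bij_pm: "bij (pm es)"
proof (induction es)
  case (Cons e es)
  show ?case unfolding pm.simps by (intro bij_comp bij_transpose Cons)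
qed (simp add: bij_def)

lemma pm_outside: "edges_in S es \<Longrightarrow> x \<notin> S \<Longrightarrow> pm es x = x"
  by (induction es) (auto simp: transpose_def)

lemma pm_inside: "edges_in S es \<Longrightarrow> x \<in> S \<Longrightarrow> pm es x \<in> S"
  by (induction es arbitrary: x) (auto simp: transpose_def)

lemma comp_pm_invariant:
  assumes "\<And>i j. (i, j) \<in> set es \<Longrightarrow> f i = f j"
  shows "f \<circ> pm es = f"
proof
  fix x
  show "(f \<circ> pm es) x = f x"
    using assms
  proof (induction es arbitrary: x)
    case (Cons e es)
    have "f (fst e) = f (snd e)" using Cons.prems by (cases e) auto
    then have "f (transpose (fst e) (snd e) x) = f x" by (auto simp: transpose_def)
    then show ?case using Cons.IH [of "transpose (fst e) (snd e) x"] Cons.prems by simp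
  qed simp
qed

text \<open>\<open>f\<close> names connected components: a new edge renames one label to another, so
  each edge costs at most one component.\<close>

lemma merge_labels:
  assumes "finite S" "edges_in S es"
  shows "\<exists>f :: nat \<Rightarrow> nat. (\<forall>(i, j) \<in> set es. f i = f j) \<and> card S \<le> card (f ` S) + length es"
  using assms(2)
proof (induction es)
  case Nil
  show ?case by (rule exI [of _ id]) simp
next
  case (Cons e es)
  then obtain f :: "nat \<Rightarrow> nat" where f: "\<forall>(i, j) \<in> set es. f i = f j" "card S \<le> card (f ` S) + length es"
    by auto
  define g where "g x = (if f x = f (fst e) then f (snd e) else f x)" for x
  have "f ` S - {f (fst e)} \<subseteq> g ` S" by (auto simp: g_def)
  then have "card (f ` S - {f (fst e)}) \<le> card (g ` S)"
    using assms(1) by (intro card_mono) auto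
  moreover have "card (f ` S - {f (fst e)}) \<ge> card (f ` S) - 1"
    by (simp add: card_Diff_singleton_if)
  ultimately have "card S \<le> card (g ` S) + length (e # es)"
    using f(2) by simp
  moreover have "\<forall>(i, j) \<in> set (e # es). g i = g j"
    using f(1) by (cases e) (auto simp: g_def)
  ultimately show ?case by blast
qed

text \<open>The head \<open>x\<close> is fixed by the rest of the chain and moved only by the last
  transposition, which gives \<open>f x = f y\<close>. Hence that transposition preserves
  \<open>f\<close> and can be removed.\<close>

lemma path_edges_transitive:
  assumes "f \<circ> pm (path_edges L) = f" "distinct L" "x \<in> set L" "y \<in> set L"
  shows "f x = f y"
proof -
  have "\<forall>x\<in>set L. f x = f (hd L)"
    using assms(1,2)
  proof (induction L rule: path_edges.induct)
    case (3 x y r)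
    have xy: "x \<notin> set (y # r)" "distinct (y # r)" using 3(3) by auto
    then have "pm (path_edges (y # r)) x = x"
      by (intro pm_outside [OF edges_in_path_edges, of _ "set (y # r)"]) auto
    moreover have f: "f (transpose y x (pm (path_edges (y # r)) z)) = f z" for z
      using fun_cong [OF 3(2), of z] by (simp add: pm_append)
    ultimately have fxy: "f y = f x" using f [of x] by simp
    then have "f (transpose y x z) = f z" for z by (simp add: transpose_def)
    with f have "f (pm (path_edges (y # r)) z) = f z" for z by simp
    then have "f \<circ> pm (path_edges (y # r)) = f" by auto
    then have "\<forall>z\<in>set (y # r). f z = f y" using 3(1) xy(2) by (metis list.sel(1))
    with fxy show ?case by (metis list.sel(1) set_ConsD)
  qed auto
  then show ?thesis using assms(3,4) by metis
qed

lemma blocks_edges_simps [simp]: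
  "blocks_edges [] = []" "blocks_edges (T # P) = block_edges T @ blocks_edges P"
  "blocks_edges (P @ Q) = blocks_edges P @ blocks_edges Q"
  by (simp_all add: blocks_edges_def)

lemma edges_in_blocks_edges: "(\<And>T. T \<in> set P \<Longrightarrow> finite T \<and> T \<subseteq> S) \<Longrightarrow> edges_in S (blocks_edges P)"
proof (induction P)
  case (Cons T P)
  then have "edges_in T (block_edges T)" "T \<subseteq> S" by (auto intro: edges_in_block_edges)
  then show ?case using Cons edges_in_mono by auto
qed simp

text \<open>Since the blocks are disjoint, invariance under the product restricts to the cycle of
  the first block; surjectivity of that cycle then passes invariance on to the remaining
  product.\<close>

lemma blocks_edges_transitive:
  assumes "f \<circ> pm (blocks_edges P) = f" "sorted_wrt (\<lambda>T U. T \<inter> U = {}) P" "\<And>T. T \<in> set P \<Longrightarrow> finite T"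
    and "T \<in> set P" "x \<in> T" "y \<in> T"
  shows "f x = f y"
  using assms
proof (induction P)
  case (Cons U P)
  let ?p = "pm (block_edges U)" and ?q = "pm (blocks_edges P)"
  have fU: "f (?q (?p z)) = f z" for z
    using Cons.prems(1) by (simp add: pm_append fun_eq_iff)
  have q: "?q z = z" if "z \<in> U" for z
    using that Cons.prems(2,3)
    by (intro pm_outside [of "\<Union>(set P)"] edges_in_blocks_edges) auto
  have U: "edges_in U (block_edges U)" using Cons.prems by (intro edges_in_block_edges) auto
  have p: "f (?p z) = f z" for z
    using fU [of z] q pm_inside [OF U, of z] pm_outside [OF U, of z] by (cases "z \<in> U") auto
  have "f (?q z) = f z" for z
  proof -
    obtain w where "z = ?p w" using bij_pm [of "block_edges U"] by (metis bij_pointE)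
    then show ?thesis using fU p by simp
  qed
  then have IH: "T \<in> set P \<Longrightarrow> f x = f y"
    using Cons by (auto simp: fun_eq_iff)
  show ?case
  proof (cases "T = U")
    case True
    then show ?thesis
      using path_edges_transitive [of f "sorted_list_of_set U" x y] p Cons.prems(3-6)
      by (simp add: block_edges_def fun_eq_iff)
  qed (use Cons.prems IH in auto)
qed simp

lemma nc_partitionD:
  assumes "noncrossing_partition n P"
  shows "distinct P" "T \<in> set P \<Longrightarrow> T \<noteq> {}" "T \<in> set P \<Longrightarrow> T \<subseteq> {1..n}" "T \<in> set P \<Longrightarrow> finite T"
    "x \<in> {1..n} \<Longrightarrow> \<exists>T\<in>set P. x \<in> T"
    "T \<in> set P \<Longrightarrow> U \<in> set P \<Longrightarrow> T \<noteq> U \<Longrightarrow> noncrossing T U"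
    "sorted_wrt (\<lambda>T U. T \<inter> U = {}) P"
    "edges_in {1..n} (blocks_edges P)"
proof -
  note P = assms [unfolded noncrossing_partition_def]
  note disjoint = P [THEN conjunct2, THEN conjunct2, THEN conjunct2, THEN conjunct1, rule_format]
    and cross = P [THEN conjunct2, THEN conjunct2, THEN conjunct2, THEN conjunct2, rule_format]
  show 1: "distinct P" "T \<in> set P \<Longrightarrow> T \<noteq> {}" "T \<in> set P \<Longrightarrow> T \<subseteq> {1..n}" "x \<in> {1..n} \<Longrightarrow> \<exists>T\<in>set P. x \<in> T"
    for T using P by auto
  show fin: "finite T" if "T \<in> set P" for T using 1(3) [OF that] finite_subset by blast
  show "noncrossing T U" if "T \<in> set P" "U \<in> set P" "T \<noteq> U" for T U
    unfolding noncrossing_def using disjoint [OF that] cross [OF that] cross [OF that(2,1)] that(3) by blast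
  show "sorted_wrt (\<lambda>T U. T \<inter> U = {}) P"
    unfolding sorted_wrt_iff_nth_less
  proof (intro allI impI)
    fix i j assume "i < j" "j < length P"
    then show "P ! i \<inter> P ! j = {}"
      using 1(1) by (intro disjoint) (auto simp: nth_eq_iff_index_eq)
  qed
  show "edges_in {1..n} (blocks_edges P)"
    using 1 fin by (intro edges_in_blocks_edges) auto
qed

lemma noncrossing_partitionI:
  assumes "distinct P" "{} \<notin> set P" "\<Union>(set P) = {1..n}"
    "\<And>T U. T \<in> set P \<Longrightarrow> U \<in> set P \<Longrightarrow> T \<noteq> U \<Longrightarrow> noncrossing T U"
  shows "noncrossing_partition n P"
  unfolding noncrossing_partition_def
proof (intro conjI ballI impI)
  fix T U assume TU: "T \<in> set P" "U \<in> set P" "T \<noteq> U"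
  show "T \<inter> U = {}"
    "\<not> (\<exists>a b c e. a < b \<and> b < c \<and> c < e \<and> a \<in> T \<and> c \<in> T \<and> b \<in> U \<and> e \<in> U)"
    using assms(4) [OF TU] unfolding noncrossing_def by blast+
qed (use assms(1-3) in auto)

text \<open>The connected components of the graph with edges \<open>es\<close> are unions of blocks of \<open>P\<close>, and there are
  at least \<open>n - length es\<close> of them.\<close>

lemma edge_in_block:
  assumes P: "noncrossing_partition n P" and es: "edges_in {1..n} es"
    and len: "length es + length P = n" and pm: "pm es = pm (blocks_edges P)"
    and ij: "(i, j) \<in> set es"
  shows "\<exists>T\<in>set P. i \<in> T \<and> j \<in> T"
proof -
  obtain f :: "nat \<Rightarrow> nat" where f: "\<And>i j. (i, j) \<in> set es \<Longrightarrow> f i = f j"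
    and card: "n \<le> card (f ` {1..n}) + length es"
    using merge_labels [OF _ es] by auto
  note nc = nc_partitionD [OF P]
  have "f \<circ> pm (blocks_edges P) = f" using comp_pm_invariant [of es f] f pm by simp
  then have const: "f x = f y" if "T \<in> set P" "x \<in> T" "y \<in> T" for T x y
    using blocks_edges_transitive [of f P T x y] nc(4,7) that by blast
  define g where "g T = f (SOME x. x \<in> T)" for T
  have g: "f x = g T" if "T \<in> set P" "x \<in> T" for T x
    unfolding g_def by (rule const [OF that]) (use that in \<open>auto intro: someI\<close>)
  have "f ` {1..n} \<subseteq> g ` set P" using nc(5) g by blast
  then have "card (f ` {1..n}) \<le> card (g ` set P)" by (intro card_mono) auto
  moreover have "card (g ` set P) \<le> card (set P)" by (rule card_image_le) simp
  moreover have "card (set P) = length P" using nc(1) by (rule distinct_card)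
  \<comment> \<open>The counts leave no slack: \<open>g\<close> takes as many values as there are
    blocks, so different blocks lie in different components.\<close>
  ultimately have "card (g ` set P) = card (set P)" using card len by linarith
  then have inj: "inj_on g (set P)" by (intro eq_card_imp_inj_on) auto
  from es ij have "i \<in> {1..n}" "j \<in> {1..n}" by (auto simp: edges_in_def)
  then obtain T U where "T \<in> set P" "i \<in> T" "U \<in> set P" "j \<in> U" using nc(5) by meson
  moreover have "g T = g U" using calculation g f [OF ij] by metis
  ultimately show ?thesis using inj by (metis inj_onD)
qed

lemma noncrossing_split:
  "noncrossing {x\<in>T. \<not> (i \<le> x \<and> x < j)} {x\<in>T. i \<le> x \<and> x < j}"
  by (rule noncrossing_outside [where a = i and b = j]) auto

lemma noncrossing_partition_split:
  assumes "noncrossing_partition n (P @ T # Q)" "i \<in> T" "j \<in> T" "i < j"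
  shows "noncrossing_partition n (P @ {x\<in>T. \<not> (i \<le> x \<and> x < j)} # {x\<in>T. i \<le> x \<and> x < j} # Q)"
proof -
  let ?T1 = "{x\<in>T. \<not> (i \<le> x \<and> x < j)}" and ?T2 = "{x\<in>T. i \<le> x \<and> x < j}"
  note nc = nc_partitionD [OF assms(1)]
  have ne: "?T1 \<noteq> {}" "?T2 \<noteq> {}" "?T1 \<noteq> ?T2" using assms by auto
  have disj: "noncrossing T U" if "U \<in> set P \<union> set Q" for U
    using nc(1,6) that by auto
  have new: "\<not> S \<subseteq> T" if "S \<in> set P \<union> set Q" for S
    using disj [OF that] nc(2) [of S] that unfolding noncrossing_def by auto
  show ?thesis
  proof (rule noncrossing_partitionI)
    show "distinct (P @ ?T1 # ?T2 # Q)"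
      using nc(1) ne new [of ?T1] new [of ?T2] by auto
    show "{} \<notin> set (P @ ?T1 # ?T2 # Q)"
      using nc(2) ne by auto
    have "?T1 \<union> ?T2 = T" by auto
    then have "\<Union> (set (P @ ?T1 # ?T2 # Q)) = \<Union> (set (P @ T # Q))" by auto
    also have "\<dots> = {1..n}"
      using assms(1) unfolding noncrossing_partition_def by (elim conjE)
    finally show "\<Union> (set (P @ ?T1 # ?T2 # Q)) = {1..n}" .
    fix U V assume UV: "U \<in> set (P @ ?T1 # ?T2 # Q)" "V \<in> set (P @ ?T1 # ?T2 # Q)" "U \<noteq> V"
    have sub: "noncrossing S U" "noncrossing U S" if "S \<subseteq> T" "U \<in> set P \<union> set Q" for S U
      using noncrossing_mono [OF disj [OF that(2)] that(1), of U] noncrossing_sym by auto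
    have T12: "noncrossing ?T1 ?T2" "noncrossing ?T2 ?T1"
      using noncrossing_split noncrossing_sym by blast+
    consider "U \<in> set P \<union> set Q" "V \<in> set P \<union> set Q" | "U \<in> {?T1, ?T2}" "V \<in> set P \<union> set Q"
      | "V \<in> {?T1, ?T2}" "U \<in> set P \<union> set Q" | "U \<in> {?T1, ?T2}" "V \<in> {?T1, ?T2}"
      using UV(1,2) by auto
    then show "noncrossing U V"
    proof cases
      case 1
      then show ?thesis using nc(6) UV(3) by auto
    next
      case 2
      then have "U \<subseteq> T" by auto
      then show ?thesis using sub 2 by blast
    next
      case 3
      then have "V \<subseteq> T" by auto
      then show ?thesis using sub 3 by blast
    next
      case 4
      then show ?thesis using T12 UV(3) by auto
    qed
  qed
qed

text \<open>The relations alone also hold in a trivial group. The new axiom, that permutation and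
  length of a band word depend only on its value, is how distinctness of elements enters.\<close>

locale braid_bands = band_generators +
  assumes bw_eq_imp: "edges_in {1..n} es \<Longrightarrow> edges_in {1..n} fs \<Longrightarrow> bw es = bw fs \<Longrightarrow>
    pm es = pm fs \<and> length es = length fs"
begin

lemma A_commute_blocks:
  assumes "noncrossing_partition n P" "T \<in> set P" "i \<in> T" "j \<in> T" "i \<noteq> j" "set Q \<subseteq> set P - {T}"
  shows "A i j * bw (blocks_edges Q) = bw (blocks_edges Q) * A i j"
  using assms(6)
proof (induction Q)
  case (Cons U Q)
  note nc = nc_partitionD [OF assms(1)]
  have U: "U \<in> set P" "T \<noteq> U" using Cons.prems by auto
  have "A i j * bw (block_edges U) = bw (block_edges U) * A i j"
    by (rule A_commute_bw_noncrossing [OF nc(6) [OF assms(2) U] assms(3-5) edges_in_block_edges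
          [OF nc(4) [OF U(1)]] nc(3) [OF assms(2)] nc(3) [OF U(1)]])
  with Cons show ?case by simp (metis mult.assoc)
qed simp

lemma refine_right:
  assumes P: "noncrossing_partition n P" and T: "T \<in> set P" "i \<in> T" "j \<in> T" "i \<noteq> j"
  shows "\<exists>P'. noncrossing_partition n P' \<and> length P' = Suc (length P) \<and>
    bw (blocks_edges P) = bw (blocks_edges P') * A i j"
proof -
  have *: "\<exists>P'. noncrossing_partition n P' \<and> length P' = Suc (length P) \<and>
    bw (blocks_edges P) = bw (blocks_edges P') * A j i" if ij: "i \<in> T" "j \<in> T" "i < j" for i j
  proof -
    note nc = nc_partitionD [OF P]
    obtain Q R where QR: "P = Q @ T # R" using T(1) by (meson split_list)
    let ?P = "Q @ {x\<in>T. \<not> (i \<le> x \<and> x < j)} # {x\<in>T. i \<le> x \<and> x < j} # R"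
    have "A j i * bw (blocks_edges R) = bw (blocks_edges R) * A j i"
      using A_commute_blocks [OF P T(1) ij(2,1), of R] ij nc(1) QR by auto
    moreover have "bw (block_edges T) = bw (block_edges {x\<in>T. \<not> (i \<le> x \<and> x < j)})
        * bw (block_edges {x\<in>T. i \<le> x \<and> x < j}) * A j i"
      using block_split_right ij nc(3) T(1) by blast
    ultimately have "bw (blocks_edges P) = bw (blocks_edges ?P) * A j i"
      unfolding QR by (simp add: mult.assoc)
    moreover have "noncrossing_partition n ?P"
      using noncrossing_partition_split P QR ij by blast
    ultimately show ?thesis using QR by (intro exI [of _ ?P]) auto
  qed
  show ?thesis
  proof (cases "i < j")
    case True
    then show ?thesis using *[OF T(2,3)] by (simp only: A_sym [of i j])
  next
    case False
    then show ?thesis using *[OF T(3,2)] T(4) by simp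
  qed
qed

lemma pm_eq_snoc_cancel:
  assumes "pm (es @ [e]) = pm (fs @ [e])"
  shows "pm es = pm fs"
proof
  fix x
  have "transpose (fst e) (snd e) (pm es x) = transpose (fst e) (snd e) (pm fs x)"
    using fun_cong [OF assms, of x] by (simp add: pm_append)
  then show "pm es x = pm fs x" by (rule transpose_eq_imp_eq)
qed

lemma refine_last:
  assumes P: "noncrossing_partition n P" and es: "edges_in {1..n} (es @ [(i, j)])"
    and len: "length (es @ [(i, j)]) + length P = n" and pm: "pm (es @ [(i, j)]) = pm (blocks_edges P)"
  shows "\<exists>P'. noncrossing_partition n P' \<and> length es + length P' = n \<and> pm es = pm (blocks_edges P')
    \<and> bw (blocks_edges P) = bw (blocks_edges P') * A i j"
proof -
  obtain T where "T \<in> set P" "i \<in> T" "j \<in> T"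
    using edge_in_block [OF P es len pm, of i j] by auto
  then obtain P' where P': "noncrossing_partition n P'" "length P' = Suc (length P)"
    "bw (blocks_edges P) = bw (blocks_edges P') * A i j"
    using refine_right [OF P] es by (metis edges_in_simps(2,3) fst_conv snd_conv)
  have "bw (blocks_edges P) = bw (blocks_edges P' @ [(i, j)])" using P'(3) by simp
  then have "pm (blocks_edges P) = pm (blocks_edges P' @ [(i, j)])"
    using bw_eq_imp es nc_partitionD(8) [OF P] nc_partitionD(8) [OF P'(1)]
    by (metis edges_in_simps(2,3))
  then have "pm es = pm (blocks_edges P')" using pm pm_eq_snoc_cancel by metis
  with P' len show ?thesis by auto
qed

text \<open>The last edge joins two points of one block by \<open>edge_in_block\<close>, so the same
  band splits off \<open>P\<close> on the right. What remains has the permutation of the refined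
  partition, with one edge fewer and one block more.\<close>

lemma bw_eq_blocks:
  assumes "noncrossing_partition n P" "edges_in {1..n} es" "length es + length P = n"
    "pm es = pm (blocks_edges P)"
  shows "bw es = bw (blocks_edges P)"
  using assms
proof (induction es arbitrary: P rule: rev_induct)
  case Nil
  note nc = nc_partitionD [OF Nil(1)]
  have sing: "x = y" if "T \<in> set P" "x \<in> T" "y \<in> T" for T x y
  proof -
    have "id \<circ> pm (blocks_edges P) = id" using Nil(4) by (metis comp_id pm.simps(1))
    then have "id x = id y"
      by (rule blocks_edges_transitive [OF _ nc(7) nc(4) that])
    then show ?thesis by simp
  qed
  have "block_edges T = []" if T: "T \<in> set P" for T
  proof -
    obtain x where "x \<in> T" using nc(2) [OF T] by auto
    then have "T = {x}" using sing [OF T] by auto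
    then show ?thesis by (simp add: block_edges_def)
  qed
  then have "blocks_edges P = []" by (simp add: blocks_edges_def)
  then show ?case by simp
next
  case (snoc e es)
  obtain i j where e: "e = (i, j)" by (cases e)
  obtain P' where "noncrossing_partition n P'" "length es + length P' = n" "pm es = pm (blocks_edges P')"
    "bw (blocks_edges P) = bw (blocks_edges P') * A i j"
    using refine_last snoc.prems unfolding e by blast
  then show ?case using snoc.IH [of P'] snoc.prems(2) e by simp
qed

text \<open>Each edge of \<open>fs\<close> removed from the right refines the partition. Started at
  the single block \<open>{1..n}\<close>, this turns every left factor of \<open>\<Delta>\<close>
  into a product over a noncrossing partition.\<close>

lemma prefix_eq_blocks:
  assumes "noncrossing_partition n P" "edges_in {1..n} (es @ fs)" "length (es @ fs) + length P = n"
    "pm (es @ fs) = pm (blocks_edges P)"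
  shows "\<exists>P'. noncrossing_partition n P' \<and> length es + length P' = n \<and> bw es = bw (blocks_edges P')"
  using assms
proof (induction fs arbitrary: P rule: rev_induct)
  case Nil
  then show ?case using bw_eq_blocks [of P es] by auto
next
  case (snoc e fs)
  obtain i j where e: "e = (i, j)" by (cases e)
  obtain P' where "noncrossing_partition n P'" "length (es @ fs) + length P' = n" "pm (es @ fs) = pm (blocks_edges P')"
    using refine_last [of P "es @ fs" i j] snoc.prems unfolding e by auto
  then show ?case using snoc by auto
qed

end

section \<open>Rotation by \<open>\<Delta>\<close>\<close>

text \<open>Addition without reduction modulo \<open>n\<close>, in contrast to the rotation
  \<open>rots\<close> that \<tau> induces. The two agree as long as no endpoint passes
  \<open>n\<close>, and \<open>shift\<close> keeps intervals visible.\<close>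

definition shift :: "nat \<Rightarrow> edge list \<Rightarrow> edge list" where
  "shift m es = map (\<lambda>(i, j). (i + m, j + m)) es"

lemma shift_simps [simp]:
  "shift m [] = []" "shift m ((i, j) # es) = (i + m, j + m) # shift m es"
  "shift m (es @ fs) = shift m es @ shift m fs"
  by (simp_all add: shift_def)

lemma shift_0 [simp]: "shift 0 es = es"
  by (simp add: shift_def)

lemma shift_shift: "shift k (shift m es) = shift (m + k) es"
  by (simp add: shift_def case_prod_beta add.assoc)

lemma edges_in_shift: "edges_in {a..b} es \<Longrightarrow> edges_in {a + m..b + m} (shift m es)"
  by (auto simp: edges_in_def shift_def)

lemma shift_path_edges: "shift m (path_edges L) = path_edges (map (\<lambda>x. x + m) L)"
  by (induction L rule: path_edges.induct) simp_all

lemma sorted_list_of_set_Icc: "sorted_list_of_set {a..b} = [a..<Suc b]"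
  by (metis atLeastLessThanSuc_atLeastAtMost sorted_list_of_set_range)

lemma shift_block_edges: "shift m (block_edges {a..b}) = block_edges {a + m..b + m}"
proof -
  have "map (\<lambda>x. x + m) [a..<Suc b] = [a + m..<Suc b + m]"
    by (rule nth_equalityI) (simp_all del: upt_Suc)
  then show ?thesis
    by (simp only: block_edges_def sorted_list_of_set_Icc shift_path_edges add_Suc)
qed

lemma pm_path_upt: "a \<le> x \<Longrightarrow> x < b \<Longrightarrow> pm (path_edges [a..<Suc b]) x = Suc x"
proof (induction "b - a" arbitrary: a)
  case (Suc k)
  then have ab: "a < b" "k = b - Suc a" by auto
  then have "[a..<Suc b] = a # Suc a # [Suc (Suc a)..<Suc b]"
    by (simp add: upt_conv_Cons del: upt_Suc)
  moreover have "[Suc a..<Suc b] = Suc a # [Suc (Suc a)..<Suc b]"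
    using ab by (simp add: upt_conv_Cons del: upt_Suc)
  ultimately have eq: "path_edges [a..<Suc b] = path_edges [Suc a..<Suc b] @ [(Suc a, a)]" by simp
  have edges: "edges_in {Suc a..b} (path_edges [Suc a..<Suc b])"
    by (rule edges_in_path_edges) auto
  show ?case
  proof (cases "x = a")
    case True
    then have "pm (path_edges [Suc a..<Suc b]) x = x" using edges by (intro pm_outside) auto
    then show ?thesis using True by (simp add: eq pm_append del: upt_Suc)
  next
    case False
    then have "pm (path_edges [Suc a..<Suc b]) x = Suc x" using Suc ab by (intro Suc(1)) auto
    then show ?thesis using False Suc by (simp add: eq pm_append transpose_def del: upt_Suc)
  qed
qed auto

lemma pm_block_edges_Icc: "a \<le> x \<Longrightarrow> x < b \<Longrightarrow> pm (block_edges {a..b}) x = Suc x"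
  by (simp only: block_edges_def sorted_list_of_set_Icc pm_path_upt)

lemma transpose_inj: "inj f \<Longrightarrow> transpose (f a) (f b) (f c) = f (transpose a b c)"
  unfolding transpose_def by (simp add: inj_eq)

context braid_bands
begin

lemma rot_in: "x \<in> {1..n} \<Longrightarrow> rot x \<in> {1..n}"
  by (auto simp: rot_def)

lemma rot_inj: "x \<in> {1..n} \<Longrightarrow> y \<in> {1..n} \<Longrightarrow> rot x = rot y \<Longrightarrow> x = y"
  unfolding rot_def by (cases "x = n"; cases "y = n") simp_all

lemma rot_pow_in: "x \<in> {1..n} \<Longrightarrow> (rot ^^ m) x \<in> {1..n}"
  by (induction m) (use rot_in in auto)

lemma rot_pow_small: "1 \<le> x \<Longrightarrow> x + m \<le> n \<Longrightarrow> (rot ^^ m) x = x + m"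
  by (induction m) (auto simp: rot_def)

lemma rot_pow_inj: "x \<in> {1..n} \<Longrightarrow> y \<in> {1..n} \<Longrightarrow> (rot ^^ m) x = (rot ^^ m) y \<Longrightarrow> x = y"
proof (induction m)
  case (Suc m)
  then show ?case using rot_inj [of "(rot ^^ m) x" "(rot ^^ m) y"] rot_pow_in by simp
qed simp

lemma rot_pow_n:
  assumes "x \<in> {1..n}"
  shows "(rot ^^ n) x = x"
proof -
  have "(rot ^^ (n - x)) x = n" using assms rot_pow_small [of x "n - x"] by auto
  then have "(rot ^^ Suc (n - x)) x = 1" by (simp add: rot_def)
  then have "(rot ^^ (x - 1 + Suc (n - x))) x = (rot ^^ (x - 1)) 1"
    by (simp only: funpow_add comp_apply)
  moreover have "x - 1 + Suc (n - x) = n" using assms by auto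
  moreover have "(rot ^^ (x - 1)) 1 = x" using assms rot_pow_small [of 1 "x - 1"] by auto
  ultimately show ?thesis by simp
qed

definition rots :: "nat \<Rightarrow> edge list \<Rightarrow> edge list" where
  "rots m es = map (\<lambda>(i, j). ((rot ^^ m) i, (rot ^^ m) j)) es"

lemma rots_simps [simp]:
  "rots m [] = []" "rots m (e # es) = ((rot ^^ m) (fst e), (rot ^^ m) (snd e)) # rots m es"
  "rots m (es @ fs) = rots m es @ rots m fs" "rots 0 es = es"
  by (auto simp: rots_def case_prod_beta)

lemma rots_rots: "rots k (rots m es) = rots (k + m) es"
  by (simp add: rots_def case_prod_beta funpow_add)

lemma rots_concat: "rots m (concat ess) = concat (map (rots m) ess)"
  by (induction ess) simp_all

lemma edges_in_rots: "edges_in {1..n} es \<Longrightarrow> edges_in {1..n} (rots m es)"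
proof (induction es)
  case (Cons e es)
  then have e: "fst e \<in> {1..n}" "snd e \<in> {1..n}" "fst e \<noteq> snd e" and es: "edges_in {1..n} es"
    by auto
  have "(rot ^^ m) (fst e) \<noteq> (rot ^^ m) (snd e)"
    using rot_pow_inj [OF e(1,2)] e(3) by blast
  then show ?case
    using rot_pow_in [OF e(1)] rot_pow_in [OF e(2)] Cons.IH [OF es]
    by (simp only: rots_simps edges_in_simps fst_conv snd_conv not_False_eq_True simp_thms)
qed simp

lemma rots_eq_shift:
  assumes "edges_in {1..b} es" "b + m \<le> n"
  shows "rots m es = shift m es"
  unfolding rots_def shift_def using assms
  by (intro map_cong) (auto simp: edges_in_def intro!: rot_pow_small)

lemma bw_rots:
  assumes "edges_in {1..n} es"
  shows "bw es * \<Delta> ^ m = \<Delta> ^ m * bw (rots m es)"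
proof (induction m)
  case (Suc m)
  have 1: "bw es * \<Delta> = \<Delta> * bw (rots 1 es)" if "edges_in {1..n} es" for es
    using that
  proof (induction es)
    case (Cons e es)
    have "A (fst e) (snd e) * \<Delta> = \<Delta> * A (rot (fst e)) (rot (snd e))"
      using Cons.prems by (intro A_rot) auto
    moreover have "bw es * \<Delta> = \<Delta> * bw (rots 1 es)"
      using Cons by (simp only: edges_in_simps)
    moreover have "rots 1 (e # es) = (rot (fst e), rot (snd e)) # rots 1 es" by simp
    ultimately show ?case by (metis bw_simps(2) fst_conv mult.assoc snd_conv)
  qed simp
  have "bw es * \<Delta> ^ Suc m = \<Delta> ^ m * (bw (rots m es) * \<Delta>)"
    using Suc by (simp only: power_Suc2 flip: mult.assoc)
  also have "bw (rots m es) * \<Delta> = \<Delta> * bw (rots 1 (rots m es))"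
    using assms by (intro 1 edges_in_rots)
  finally show ?case by (simp only: rots_rots power_Suc2 mult.assoc plus_1_eq_Suc)
qed simp

lemma bw_shift:
  assumes "edges_in {1..b} es" "b + m \<le> n"
  shows "bw es * \<Delta> ^ m = \<Delta> ^ m * bw (shift m es)"
proof -
  have "edges_in {1..n} es" using assms edges_in_mono by force
  then show ?thesis using bw_rots rots_eq_shift [OF assms] by simp
qed

lemma \<Delta>_pow_n_central:
  assumes "edges_in {1..n} es"
  shows "bw es * \<Delta> ^ n = \<Delta> ^ n * bw es"
proof -
  have "rots n es = es"
    unfolding rots_def using assms by (intro map_idI) (auto simp: edges_in_def rot_pow_n)
  then show ?thesis using bw_rots [OF assms, of n] by simp
qed

text \<open>Moving all powers of \<open>\<Delta>\<close> to the left rotates a factor by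
  \<open>d\<close> once for each \<open>\<Delta> ^ d\<close> on its right. The leftmost factor is
  rotated most, so the indices run downwards.\<close>

lemma twisted_power:
  assumes "edges_in {1..n} es"
  shows "(\<Delta> ^ d * bw es) ^ k = \<Delta> ^ (k * d) * bw (concat (map (\<lambda>j. rots (j * d) es) (rev [0..<k])))"
proof (induction k)
  case (Suc k)
  let ?W = "\<lambda>k. concat (map (\<lambda>j. rots (j * d) es) (rev [0..<k]))"
  have W: "?W (Suc k) = rots d (?W k) @ es"
  proof -
    have "[0..<Suc k] = 0 # map Suc [0..<k]"
      by (simp add: map_Suc_upt upt_conv_Cons del: upt_Suc)
    then have "rev [0..<Suc k] = map Suc (rev [0..<k]) @ [0]" by (simp only: rev.simps rev_map)
    then show ?thesis by (simp only: map_append concat_append) (simp add: rots_concat rots_rots comp_def)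
  qed
  have edges: "edges_in {1..n} (?W k)"
    using assms edges_in_rots by (auto simp: edges_in_concat)
  have "(\<Delta> ^ d * bw es) ^ Suc k = \<Delta> ^ (k * d) * (bw (?W k) * \<Delta> ^ d) * bw es"
    using Suc by (simp only: power_Suc2 mult.assoc)
  also have "\<dots> = \<Delta> ^ (k * d) * \<Delta> ^ d * (bw (rots d (?W k)) * bw es)"
    by (simp only: bw_rots [OF edges] mult.assoc)
  also have "\<dots> = \<Delta> ^ (Suc k * d) * bw (?W (Suc k))"
    by (simp only: W bw_simps power_add [symmetric] mult_Suc add.commute)
  finally show ?case .
qed simp

section \<open>Factorizations of \<Delta> into bands\<close>

lemma \<Delta>_partition: "1 \<le> n \<Longrightarrow> noncrossing_partition n [{1..n}]"
  by (rule noncrossing_partitionI) auto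

lemma bw_eq_\<Delta>:
  assumes "bw es = \<Delta>" "edges_in {1..n} es"
  shows "pm es = pm (block_edges {1..n})" "length es = n - 1"
  using bw_eq_imp [OF assms(2) edges_in_block_edges assms(1)]
  by (simp_all add: block_edges_def sorted_list_of_set_Icc length_path_edges)

text \<open>The band has to stand at the very front, so it is moved past the blocks preceding
  \<open>T\<close>, which do not cross it.\<close>

lemma refine_left:
  assumes P: "noncrossing_partition n P" and T: "T \<in> set P" and ij: "i \<in> T" "j \<in> T" "i < j"
  shows "\<exists>es. edges_in {1..n} es \<and> bw (blocks_edges P) = A j i * bw es"
proof -
  note nc = nc_partitionD [OF P]
  obtain Q R where QR: "P = Q @ T # R" using T by (meson split_list)
  have comm: "A j i * bw (blocks_edges Q) = bw (blocks_edges Q) * A j i"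
    using nc(1) QR ij by (intro A_commute_blocks [OF P T ij(2,1)]) auto
  let ?U = "{x\<in>T. \<not> (i < x \<and> x \<le> j)}" and ?V = "{x\<in>T. i < x \<and> x \<le> j}"
  have split: "bw (block_edges T) = A j i * bw (block_edges ?U) * bw (block_edges ?V)"
    by (rule block_split_left [OF nc(3) [OF T] ij])
  have "bw (blocks_edges P) = bw (blocks_edges Q) * bw (block_edges T) * bw (blocks_edges R)"
    by (simp add: QR mult.assoc)
  also have "\<dots> = bw (blocks_edges Q) * A j i * (bw (block_edges ?U) * (bw (block_edges ?V) * bw (blocks_edges R)))"
    by (simp only: split mult.assoc)
  also have "\<dots> = A j i * bw (blocks_edges (Q @ ?U # ?V # R))"
    by (simp only: comm [symmetric] mult.assoc blocks_edges_simps bw_simps)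
  finally have "bw (blocks_edges P) = A j i * bw (blocks_edges (Q @ ?U # ?V # R))" .
  moreover have "edges_in {1..n} (blocks_edges (Q @ ?U # ?V # R))"
  proof (rule edges_in_blocks_edges)
    fix S assume "S \<in> set (Q @ ?U # ?V # R)"
    then have "S \<in> set Q \<or> S \<in> set R \<or> S \<subseteq> T" by auto
    then have "\<exists>S'\<in>set P. S \<subseteq> S'" unfolding QR by auto
    then show "finite S \<and> S \<subseteq> {1..n}"
      using nc(3) finite_subset [OF _ finite_atLeastAtMost] by (meson order.trans)
  qed
  ultimately show ?thesis by blast
qed

text \<open>A Hurwitz move brings the band \<open>(i, j)\<close> to the front without touching the later edges.\<close>

lemma later_edge:
  assumes "edges_in {1..n} (X @ (i, j) # Y)" "i < j" "bw (X @ (i, j) # Y) = \<Delta>" "(x, y) \<in> set Y"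
  shows "x \<in> {i<..j} \<longleftrightarrow> y \<in> {i<..j}"
proof -
  define U V where "U = {x \<in> {1..n}. \<not> (i < x \<and> x \<le> j)}" and "V = {x \<in> {1..n}. i < x \<and> x \<le> j}"
  \<comment> \<open>The prefix is relabelled by the transposition, which preserves the permutation
    of the whole word when \<open>(i, j)\<close> moves to the front; \<open>edge_in_block\<close>
    looks at permutation and length, so this suffices.\<close>
  define X' where "X' = map (\<lambda>(a, b). (transpose i j a, transpose i j b)) X"
  have ij: "i \<in> {1..n}" "j \<in> {1..n}" using assms(1) by auto
  have tr: "transpose i j x \<in> {1..n}" if "x \<in> {1..n}" for x
    using that ij by (auto simp: transpose_def)
  have X': "edges_in {1..n} X'"
    unfolding edges_in_def
  proof clarify
    fix a' b' assume "(a', b') \<in> set X'"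
    then obtain a b where ab: "(a, b) \<in> set X" "a' = transpose i j a" "b' = transpose i j b"
      by (auto simp: X'_def)
    then have "a \<in> {1..n}" "b \<in> {1..n}" "a \<noteq> b" using assms(1) by (auto simp: edges_in_def)
    then show "a' \<in> {1..n} \<and> b' \<in> {1..n} \<and> a' \<noteq> b'"
      using ab tr transpose_eq_imp_eq by metis
  qed
  have nc: "noncrossing U V"
    by (rule noncrossing_outside [where a = "Suc i" and b = "Suc j"]) (auto simp: U_def V_def)
  have part: "noncrossing_partition n [U, V]"
  proof (rule noncrossing_partitionI)
    have "i \<in> U" "j \<in> V" "j \<notin> U" using ij assms(2) by (auto simp: U_def V_def)
    then show "distinct [U, V]" "{} \<notin> set [U, V]" by auto
    show "\<Union> (set [U, V]) = {1..n}" by (auto simp: U_def V_def)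
  qed (use nc noncrossing_sym in auto)
  have "bw (block_edges {1..n}) = A j i * bw (block_edges U) * bw (block_edges V)"
    unfolding U_def V_def using ij assms(2) by (intro block_split_left) auto
  then have "bw (block_edges {1..n}) = bw ((i, j) # blocks_edges [U, V])"
    by (simp add: A_sym [of i j] mult.assoc)
  then have "pm (block_edges {1..n}) = pm ((i, j) # blocks_edges [U, V])"
    using bw_eq_imp ij assms(2) edges_in_block_edges nc_partitionD(8) [OF part]
    by (metis edges_in_simps(2) finite_atLeastAtMost fst_conv less_irrefl snd_conv)
  moreover have "pm (X @ (i, j) # Y) = pm ((i, j) # X' @ Y)"
  proof -
    have "pm X' (transpose i j z) = transpose i j (pm X z)" for z
      unfolding X'_def
    proof (induction X arbitrary: z)
      case (Cons e X)
      show ?case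
        by (simp add: case_prod_beta transpose_inj [OF inj_transpose] Cons [unfolded case_prod_beta])
    qed simp
    then show ?thesis by (simp add: fun_eq_iff pm_append)
  qed
  ultimately have eq: "pm ((i, j) # X' @ Y) = pm ((i, j) # blocks_edges [U, V])"
    using bw_eq_\<Delta>(1) [OF assms(3,1)] by simp
  have pm: "pm (X' @ Y) = pm (blocks_edges [U, V])"
  proof
    fix z
    show "pm (X' @ Y) z = pm (blocks_edges [U, V]) z"
      using fun_cong [OF eq, of "transpose i j z"] by (simp only: pm.simps comp_apply fst_conv snd_conv transpose_involutory)
  qed
  have "length (X' @ Y) + length [U, V] = n"
    using bw_eq_\<Delta>(2) [OF assms(3,1)] ij by (simp add: X'_def)
  then have "\<exists>T\<in>set [U, V]. x \<in> T \<and> y \<in> T"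
    using assms(1,4) X' by (intro edge_in_block [OF part, of "X' @ Y"] pm) auto
  then show ?thesis by (auto simp: U_def V_def)
qed

end

section \<open>Sectors\<close>

lemma prod_list_commute:
  fixes g :: "'a::monoid_mult"
  assumes "\<And>x. x \<in> set xs \<Longrightarrow> g * x = x * g"
  shows "g * prod_list xs = prod_list xs * g"
  using assms
proof (induction xs)
  case (Cons x xs)
  have "g * x = x * g" "g * prod_list xs = prod_list xs * g"
    using Cons by (metis list.set_intros(1)) (metis Cons list.set_intros(2))
  then show ?case by (metis mult.assoc prod_list.Cons)
qed simp

lemma prod_list_commute_both:
  fixes xs ys :: "'a::monoid_mult list"
  assumes "\<And>x y. x \<in> set xs \<Longrightarrow> y \<in> set ys \<Longrightarrow> x * y = y * x"
  shows "prod_list xs * prod_list ys = prod_list ys * prod_list xs"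
proof (rule prod_list_commute)
  fix y assume "y \<in> set ys"
  then have "y * prod_list xs = prod_list xs * y"
    using assms by (intro prod_list_commute) metis
  then show "prod_list xs * y = y * prod_list xs" by (rule HOL.sym)
qed

lemma prod_list_conjugate:
  fixes g :: "'a::monoid_mult"
  assumes "\<And>k. k \<in> set ks \<Longrightarrow> f k * g = g * h k"
  shows "prod_list (map f ks) * g = g * prod_list (map h ks)"
  using assms
proof (induction ks)
  case (Cons k ks)
  have "f k * g = g * h k" "prod_list (map f ks) * g = g * prod_list (map h ks)"
    using Cons by (metis list.set_intros(1)) (metis Cons list.set_intros(2))
  then show ?case by (metis (no_types, lifting) list.simps(9) mult.assoc prod_list.Cons)
qed simp

context braid_bands
begin

lemma bw_concat: "bw (concat ess) = prod_list (map bw ess)"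
  by (induction ess) simp_all

lemma bw_filter_disj:
  assumes "\<And>e f. e \<in> set es \<Longrightarrow> f \<in> set es \<Longrightarrow> P e \<Longrightarrow> Q f \<Longrightarrow>
      A (fst e) (snd e) * A (fst f) (snd f) = A (fst f) (snd f) * A (fst e) (snd e)"
    and "\<And>e. e \<in> set es \<Longrightarrow> P e \<Longrightarrow> \<not> Q e"
  shows "bw (filter (\<lambda>e. P e \<or> Q e) es) = bw (filter P es) * bw (filter Q es)"
  using assms
proof (induction es)
  case (Cons e es)
  have IH: "bw (filter (\<lambda>e. P e \<or> Q e) es) = bw (filter P es) * bw (filter Q es)"
    by (rule Cons.IH) (use Cons.prems in \<open>meson list.set_intros(2)\<close>)+
  show ?case
  proof (cases "Q e")
    case True
    have comm: "A (fst e) (snd e) * bw (filter P es) = bw (filter P es) * A (fst e) (snd e)"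
    proof (rule commute_bw)
      fix i j assume "(i, j) \<in> set (filter P es)"
      then show "A (fst e) (snd e) * A i j = A i j * A (fst e) (snd e)"
        using Cons.prems(1) [of "(i, j)" e] True by simp
    qed
    have "\<not> P e" using Cons.prems(2) [of e] True by auto
    with True have "bw (filter (\<lambda>e. P e \<or> Q e) (e # es)) = A (fst e) (snd e) * bw (filter P es) * bw (filter Q es)"
      by (simp add: IH mult.assoc)
    also have "\<dots> = bw (filter P es) * (A (fst e) (snd e) * bw (filter Q es))"
      by (simp only: comm mult.assoc)
    also have "\<dots> = bw (filter P (e # es)) * bw (filter Q (e # es))"
      using True \<open>\<not> P e\<close> by simp
    finally show ?thesis .
  qed (simp add: IH mult.assoc)
qed simp

text \<open>A stable sort: letters of different classes commute, so each class can be collected in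
  turn with its internal order unchanged.\<close>

lemma bw_sort_classes:
  fixes \<kappa> :: "edge \<Rightarrow> nat"
  assumes "\<And>e f. e \<in> set es \<Longrightarrow> f \<in> set es \<Longrightarrow> \<kappa> e \<noteq> \<kappa> f \<Longrightarrow>
      A (fst e) (snd e) * A (fst f) (snd f) = A (fst f) (snd f) * A (fst e) (snd e)"
    and "\<And>e. e \<in> set es \<Longrightarrow> \<kappa> e < r"
  shows "bw es = prod_list (map (\<lambda>k. bw (filter (\<lambda>e. \<kappa> e = k) es)) [0..<r])"
proof -
  have "bw (filter (\<lambda>e. \<kappa> e < m) es) = prod_list (map (\<lambda>k. bw (filter (\<lambda>e. \<kappa> e = k) es)) [0..<m])" for m
  proof (induction m)
    case (Suc m)
    have "bw (filter (\<lambda>e. \<kappa> e < Suc m) es) = bw (filter (\<lambda>e. \<kappa> e < m \<or> \<kappa> e = m) es)"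
      by (simp only: less_Suc_eq)
    also have "\<dots> = bw (filter (\<lambda>e. \<kappa> e < m) es) * bw (filter (\<lambda>e. \<kappa> e = m) es)"
      by (rule bw_filter_disj) (use assms(1) in auto)
    finally show ?case by (simp add: Suc)
  qed simp
  moreover have "filter (\<lambda>e. \<kappa> e < r) es = es"
    using assms(2) by (simp add: filter_id_conv)
  ultimately show ?thesis by metis
qed

end

locale staircase = braid_bands +
  fixes r d :: nat
  assumes n_eq: "n = r * d + 1" and r: "2 \<le> r" and d: "1 \<le> d"
begin

text \<open>The interval of condition (1), in the form that makes it literally the translate of
  \<open>{2..Suc d}\<close> produced by \<open>edges_in_shift\<close>.\<close>

definition S :: "nat \<Rightarrow> nat set" where "S k = {2 + k * d..Suc d + k * d}"

lemma S_bound: "k < r \<Longrightarrow> Suc d + k * d \<le> n"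
  using n_eq mult_le_mono1 [of "Suc k" r d] by simp

lemma S_subset: "k < r \<Longrightarrow> S k \<subseteq> {1..n}"
  using S_bound [of k] by (auto simp: S_def)

lemma S_less: "j < k \<Longrightarrow> x \<in> S j \<Longrightarrow> y \<in> S k \<Longrightarrow> x < y"
  using mult_le_mono1 [of "Suc j" k d] by (auto simp: S_def)

lemma noncrossing_S: "j \<noteq> k \<Longrightarrow> noncrossing (S j) (S k)"
  using noncrossing_less [of "S j" "S k"] noncrossing_less [of "S k" "S j"] noncrossing_sym S_less
  by (metis nat_neq_iff)

lemma S_cover: "2 \<le> x \<Longrightarrow> x \<le> n \<Longrightarrow> (x - 2) div d < r \<and> x \<in> S ((x - 2) div d)"
proof
  assume x: "2 \<le> x" "x \<le> n"
  then have "x - 2 < r * d" using n_eq d by simp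
  then show "(x - 2) div d < r" by (simp add: less_mult_imp_div_less)
  have "(x - 2) div d * d + (x - 2) mod d = x - 2" "(x - 2) mod d < d"
    by (rule div_mult_mod_eq) (use d in simp)
  then show "x \<in> S ((x - 2) div d)"
    using x unfolding S_def atLeastAtMost_iff by linarith
qed

lemma S_index: "x \<in> S k \<Longrightarrow> (x - 2) div d = k"
proof -
  assume "x \<in> S k"
  then have "k * d \<le> x - 2" "x - 2 < Suc k * d" using d by (auto simp: S_def)
  then show "(x - 2) div d = k" by (metis div_nat_eqI mult.commute)
qed

lemma edges_in_S_shift: "edges_in {2..Suc d} es \<Longrightarrow> edges_in (S k) (shift (k * d) es)"
  unfolding S_def by (rule edges_in_shift)

lemma edges_in_n: "k < r \<Longrightarrow> edges_in (S k) es \<Longrightarrow> edges_in {1..n} es"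
  using edges_in_mono S_subset by blast

lemma bw_shift_S:
  assumes "edges_in {2..Suc d} es" "k < r"
  shows "bw es * \<Delta> ^ (k * d) = \<Delta> ^ (k * d) * bw (shift (k * d) es)"
  using S_bound [OF assms(2)] edges_in_mono [OF assms(1)]
  by (intro bw_shift [where b = "Suc d"]) auto

text \<open>The \<open>r\<close>-th power carries \<open>\<Delta> ^ (r * d)\<close> in front, and
  \<open>n = r * d + 1\<close> leaves exactly one \<open>\<Delta>\<close> for the rotated
  factors.\<close>

lemma root_factorization:
  assumes "edges_in {1..n} es" "(\<Delta> ^ d * bw es) ^ r = \<Delta> ^ n"
  shows "bw (concat (map (\<lambda>k. rots (k * d) es) (rev [0..<r]))) = \<Delta>"
proof -
  have "\<Delta> ^ (r * d) * bw (concat (map (\<lambda>k. rots (k * d) es) (rev [0..<r]))) = \<Delta> ^ (r * d) * \<Delta>"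
    using twisted_power [OF assms(1), of d r] assms(2) by (simp add: n_eq power_Suc2 del: power_Suc)
  then show ?thesis by (simp only: group_left_cancel)
qed

text \<open>The permutation of \<open>es\<close> preserves each block of its partition, so
  \<open>1\<close>, the image of \<open>Suc d\<close>, lies in the block of \<open>Suc d\<close>;
  the band joining the two splits off on the left.\<close>

lemma strip_long_band:
  assumes es: "edges_in {1..n} es" "edges_in {1..n} fs" "bw (es @ fs) = \<Delta>" and pm: "pm es (Suc d) = 1"
  shows "\<exists>bs. edges_in {1..n} bs \<and> bw es = A (Suc d) 1 * bw bs"
proof -
  have n: "1 \<le> n" "Suc d \<in> {1..n}" using S_bound [of 0] r by auto
  have edges: "edges_in {1..n} (es @ fs)" using es by simp
  note \<Delta> = bw_eq_\<Delta> [OF es(3) edges]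
  obtain P where P: "noncrossing_partition n P" and bw: "bw es = bw (blocks_edges P)"
    using prefix_eq_blocks [OF \<Delta>_partition [OF n(1)] edges] \<Delta> n by auto
  note nc = nc_partitionD [OF P]
  have pmP: "pm es = pm (blocks_edges P)" using bw_eq_imp [OF es(1) nc(8) bw] by simp
  obtain T where T: "T \<in> set P" "Suc d \<in> T" using nc(5) n(2) by blast
  have "(\<lambda>x. x \<in> T) \<circ> pm (blocks_edges P) = (\<lambda>x. x \<in> T)"
  proof (rule comp_pm_invariant)
    fix i j assume "(i, j) \<in> set (blocks_edges P)"
    then obtain U where U: "U \<in> set P" "(i, j) \<in> set (block_edges U)"
      by (auto simp: blocks_edges_def)
    then have "i \<in> U" "j \<in> U" using edges_in_block_edges [OF nc(4) [OF U(1)]] by (auto simp: edges_in_def)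
    moreover have "T = U \<or> T \<inter> U = {}" using nc(6) [OF T(1) U(1)] by (auto simp: noncrossing_def)
    ultimately show "(i \<in> T) = (j \<in> T)" by blast
  qed
  then have "1 \<in> T" using T(2) pm pmP by (metis comp_apply)
  then show ?thesis using refine_left [OF P T(1) _ T(2), of 1] d bw by auto
qed

text \<open>In the factorization of \<open>\<Delta>\<close> the unrotated \<open>bs\<close> stands
  last, to the right of every rotated long band from \<open>kd+1\<close> to \<open>kd+d+1\<close>.
  Each of these bands forces an edge of \<open>bs\<close> to lie entirely inside or entirely outside
  \<open>S k\<close>.\<close>

lemma edges_in_sectors:
  assumes bs: "edges_in {1..n} bs" and pow: "(\<Delta> ^ d * (A (Suc d) 1 * bw bs)) ^ r = \<Delta> ^ n"
    and f: "(x, y) \<in> set bs"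
  shows "\<exists>k<r. x \<in> S k \<and> y \<in> S k"
proof -
  \<comment> \<open>The smaller endpoint comes first, as \<open>later_edge\<close> requires.\<close>
  let ?x = "(1, Suc d) # bs"
  define W where "W ks = concat (map (\<lambda>k. rots (k * d) ?x) ks)" for ks
  have x: "edges_in {1..n} ?x" using bs S_bound [of 0] r d by simp
  have "bw ?x = A (Suc d) 1 * bw bs" by (simp add: A_sym)
  then have W: "bw (W (rev [0..<r])) = \<Delta>"
    using root_factorization [OF x] pow unfolding W_def by simp
  have WE: "edges_in {1..n} (W ks)" for ks
    using edges_in_rots [OF x] by (auto simp: W_def edges_in_concat)
  have iff: "x \<in> S k \<longleftrightarrow> y \<in> S k" if k: "k < r" for k
  proof -
    define X Y where "X = W (rev [Suc k..<r])" and "Y = rots (k * d) bs @ W (rev [0..<k])"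
    have "(rot ^^ (k * d)) 1 = 1 + k * d" "(rot ^^ (k * d)) (Suc d) = Suc d + k * d"
      using S_bound [OF k] by (intro rot_pow_small; simp)+
    moreover have "[0..<r] = [0..<k] @ k # [Suc k..<r]"
      using k upt_add_eq_append [of 0 k "r - k"] by (simp add: upt_conv_Cons)
    ultimately have eq: "W (rev [0..<r]) = X @ (1 + k * d, Suc d + k * d) # Y"
      by (simp add: W_def X_def Y_def)
    have "(x, y) \<in> set Y"
    proof (cases k)
      case 0
      then show ?thesis using f by (simp add: Y_def)
    next
      case (Suc k')
      then have "0 \<in> set (rev [0..<k])" by (simp only: set_rev set_upt atLeastLessThan_iff) simp
      then show ?thesis using f by (force simp: Y_def W_def)
    qed
    moreover have "{1 + k * d<..Suc d + k * d} = S k" by (auto simp: S_def)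
    ultimately show ?thesis
      using later_edge [of X "1 + k * d" "Suc d + k * d" Y x y] W WE [of "rev [0..<r]"] d unfolding eq by simp
  qed
  have xy: "x \<in> {1..n}" "y \<in> {1..n}" "x \<noteq> y" using bs f by (auto simp: edges_in_def)
  show ?thesis
  \<comment> \<open>The sectors cover only \<open>{2..n}\<close>. The index is taken from an
    endpoint different from \<open>1\<close>, and \<open>iff\<close> carries it to the other
    endpoint.\<close>
  proof (cases "x = 1")
    case True
    then have "2 \<le> y" using xy by auto
    then show ?thesis using S_cover [of y] iff xy by auto
  next
    case False
    then have "2 \<le> x" using xy by auto
    then show ?thesis using S_cover [of x] iff xy by auto
  qed
qed

lemma sector_decomposition:
  assumes "edges_in {1..n} bs" "(\<Delta> ^ d * (A (Suc d) 1 * bw bs)) ^ r = \<Delta> ^ n"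
  shows "\<exists>B. (\<forall>k<r. edges_in {2..Suc d} (B k)) \<and>
    bw bs = prod_list (map (\<lambda>k. bw (shift (k * d) (B k))) [0..<r])"
proof -
  \<comment> \<open>\<open>(x - 2) div d\<close> is the index of the sector of \<open>x\<close>;
    both endpoints of an edge of \<open>bs\<close> give the same value.\<close>
  define \<kappa> where "\<kappa> e = (fst e - 2) div d" for e :: edge
  define F where "F k = filter (\<lambda>e. \<kappa> e = k) bs" for k
  define B where "B k = map (\<lambda>(x, y). (x - k * d, y - k * d)) (F k)" for k
  have \<kappa>: "\<kappa> e < r \<and> fst e \<in> S (\<kappa> e) \<and> snd e \<in> S (\<kappa> e) \<and> fst e \<noteq> snd e" if "e \<in> set bs" for e
  proof -
    obtain k where k: "k < r" "fst e \<in> S k" "snd e \<in> S k"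
      using edges_in_sectors [OF assms, of "fst e" "snd e"] \<open>e \<in> set bs\<close> by auto
    then have "\<kappa> e = k" using S_index by (simp add: \<kappa>_def)
    moreover have "fst e \<noteq> snd e" using assms(1) that by (auto simp: edges_in_def)
    ultimately show ?thesis using k by simp
  qed
  have "bw bs = prod_list (map (\<lambda>k. bw (F k)) [0..<r])"
    unfolding F_def
  proof (rule bw_sort_classes)
    fix e f assume ef: "e \<in> set bs" "f \<in> set bs" "\<kappa> e \<noteq> \<kappa> f"
    show "A (fst e) (snd e) * A (fst f) (snd f) = A (fst f) (snd f) * A (fst e) (snd e)"
      using \<kappa> [OF ef(1)] \<kappa> [OF ef(2)] S_subset
      by (intro A_commute_noncrossing [OF noncrossing_S [OF ef(3)]]) blast+
  qed (use \<kappa> in blast)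
  moreover have "shift (k * d) (B k) = F k" for k
  proof -
    have "(fst e - k * d + k * d, snd e - k * d + k * d) = e" if "e \<in> set (F k)" for e
      using \<kappa> [of e] that by (cases e) (auto simp: F_def S_def)
    then show ?thesis
      unfolding B_def shift_def by (simp add: case_prod_beta map_idI)
  qed
  moreover have "edges_in {2..Suc d} (B k)" for k
    unfolding edges_in_def
  proof clarify
    fix i j assume "(i, j) \<in> set (B k)"
    then obtain x y where xy: "(x, y) \<in> set (F k)" "i = x - k * d" "j = y - k * d"
      by (auto simp: B_def)
    then have "(x, y) \<in> set bs" "\<kappa> (x, y) = k" by (auto simp: F_def)
    then have "x \<in> S k" "y \<in> S k" "x \<noteq> y" using \<kappa> [of "(x, y)"] by auto
    then show "i \<in> {2..Suc d} \<and> j \<in> {2..Suc d} \<and> i \<noteq> j"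
      using xy(2,3) by (auto simp: S_def)
  qed
  ultimately show ?thesis by (intro exI [of _ B]) auto
qed

end

lemma prod_list_upt_conj:
  fixes g :: "'a::monoid_mult"
  assumes "\<And>k. m \<le> k \<Longrightarrow> k < r \<Longrightarrow> f k * g = g * h k"
  shows "prod_list (map f [m..<r]) * g = g * prod_list (map h [m..<r])"
  by (rule prod_list_conjugate) (use assms in auto)

section \<open>The conjugation by \<open>c\<close>, for an arbitrary family of words in the
  sectors\<close>

locale sectors = staircase +
  fixes B :: "nat \<Rightarrow> edge list"
  assumes B: "k < r \<Longrightarrow> edges_in {2..Suc d} (B k)"
begin

text \<open>In terms of \<open>B k = \<tau>^(-kd)(b_k)\<close>, the element \<open>Y k k\<close> is \<open>b_k\<close> and \<open>Y j k\<close> is its translate into the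
  \<open>j\<close>-th sector.  The conjugator is \<open>c = C 1 \<cdots> C (r-1)\<close>, and \<open>E m = \<tau>^d(C m)\<close>.\<close>

definition Y :: "nat \<Rightarrow> nat \<Rightarrow> 'a" where "Y j k = bw (shift (j * d) (B k))"

definition C :: "nat \<Rightarrow> 'a" where "C m = prod_list (map (\<lambda>k. Y (k - m) k) [m..<r])"

definition E :: "nat \<Rightarrow> 'a" where "E m = prod_list (map (\<lambda>k. Y (Suc k - m) k) [m..<r])"

definition long :: 'a where "long = A (Suc d) 1"

lemma edges_in_S: "k < r \<Longrightarrow> edges_in (S j) (shift (j * d) (B k))"
  using B edges_in_S_shift by blast

lemma Y_commute:
  assumes "j \<noteq> j'" "j < r" "j' < r" "k < r" "k' < r"
  shows "Y j k * Y j' k' = Y j' k' * Y j k"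
  unfolding Y_def
  by (rule bw_commute_noncrossing [OF noncrossing_S [OF assms(1)] edges_in_S [OF assms(4)]
        edges_in_S [OF assms(5)] S_subset [OF assms(2)] S_subset [OF assms(3)]])

lemma Y_conj:
  assumes "Suc j < r" "k < r"
  shows "Y j k * \<Delta> ^ d = \<Delta> ^ d * Y (Suc j) k"
proof -
  have "edges_in {1..Suc d + j * d} (shift (j * d) (B k))"
    using edges_in_S [OF assms(2)] by (rule edges_in_mono) (auto simp: S_def)
  moreover have "Suc d + j * d + d \<le> n" using S_bound [OF assms(1)] by simp
  ultimately show ?thesis
    unfolding Y_def using bw_shift [of "Suc d + j * d" "shift (j * d) (B k)" d]
    by (simp add: shift_shift add.commute)
qed

lemma Y_conj_pow:
  assumes "j < r" "k < r"
  shows "Y 0 k * \<Delta> ^ (j * d) = \<Delta> ^ (j * d) * Y j k"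
  unfolding Y_def using bw_shift_S [OF B [OF assms(2)] assms(1)] by simp

lemma long_commute:
  assumes "0 < j" "j < r" "k < r"
  shows "long * Y j k = Y j k * long"
  unfolding Y_def long_def
proof (rule A_commute_bw_noncrossing [OF _ _ _ _ edges_in_S [OF assms(3)]])
  have "d \<le> j * d" using assms(1) by simp
  then have "x < y" if "x \<in> {1..Suc d}" "y \<in> S j" for x y
    using that unfolding S_def atLeastAtMost_iff by linarith
  then show "noncrossing {1..Suc d} (S j)" by (rule noncrossing_less)
  show "{1..Suc d} \<subseteq> {1..n}" using S_bound [of 0] r by auto
qed (use d S_subset assms in auto)

lemma C_conj: "0 < m \<Longrightarrow> C m * \<Delta> ^ d = \<Delta> ^ d * E m"
  unfolding C_def E_def
proof (rule prod_list_upt_conj)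
  fix k assume "0 < m" "m \<le> k" "k < r"
  then show "Y (k - m) k * \<Delta> ^ d = \<Delta> ^ d * Y (Suc k - m) k"
    using Y_conj [of "k - m" k] by (simp add: Suc_diff_le)
qed

lemma Y_conj_diag:
  assumes "m \<le> k" "k < r"
  shows "Y (k - m) k * \<Delta> ^ (m * d) = \<Delta> ^ (m * d) * Y k k"
proof -
  have "edges_in {1..Suc d + (k - m) * d} (shift ((k - m) * d) (B k))"
    using edges_in_S [OF assms(2)] by (rule edges_in_mono) (auto simp: S_def)
  moreover have km: "(k - m) * d + m * d = k * d"
    using assms(1) by (simp flip: add_mult_distrib)
  then have "Suc d + (k - m) * d + m * d \<le> n" using S_bound [OF assms(2)] by simp
  ultimately show ?thesis
    unfolding Y_def using bw_shift km by (metis shift_shift)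
qed

text \<open>This identifies \<open>C m\<close> with the factor \<tau>^(-md)(b_m \<cdots> b_(r-1)) of
  the conjugator, in a form free of inverses.\<close>

lemma C_conj_diag: "C m * \<Delta> ^ (m * d) = \<Delta> ^ (m * d) * prod_list (map (\<lambda>k. Y k k) [m..<r])"
  unfolding C_def by (rule prod_list_upt_conj) (rule Y_conj_diag)

lemma C_rec: "m < r \<Longrightarrow> C m = Y 0 m * E (Suc m)"
  by (simp add: C_def E_def upt_conv_Cons)

lemma E_commute:
  assumes "\<And>j k. 0 < j \<Longrightarrow> j < r \<Longrightarrow> k < r \<Longrightarrow> g * Y j k = Y j k * g"
  shows "g * prod_list (map E [Suc m..<r]) = prod_list (map E [Suc m..<r]) * g"
proof (rule prod_list_commute)
  fix x assume "x \<in> set (map E [Suc m..<r])"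
  then obtain i where i: "x = E i" "Suc m \<le> i" "i < r" by auto
  show "g * x = x * g"
    unfolding i E_def by (rule prod_list_commute) (use assms i(2,3) in auto)
qed

text \<open>By \<open>C_rec\<close>, each \<open>C m\<close> starts in sector 0 and continues with
  \<open>E (Suc m)\<close>, which lies in later sectors. The latter commutes with everything in
  sector 0, so the sector 0 parts collect on the left.\<close>

lemma prod_C:
  assumes "m \<le> r"
  shows "prod_list (map C [m..<r]) = prod_list (map (Y 0) [m..<r]) * prod_list (map E [Suc m..<r])"
  using assms
proof (induction rule: inc_induct)
  case (step m)
  let ?y = "prod_list (map (Y 0) [Suc m..<r])" and ?e = "prod_list (map E [Suc (Suc m)..<r])"
  have comm: "E (Suc m) * ?y = ?y * E (Suc m)"
    unfolding E_def
  proof (rule prod_list_commute_both)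
    fix x y assume "x \<in> set (map (\<lambda>k. Y (Suc k - Suc m) k) [Suc m..<r])" "y \<in> set (map (Y 0) [Suc m..<r])"
    then show "x * y = y * x" by (auto intro!: Y_commute)
  qed
  have e: "E (Suc m) * ?e = prod_list (map E [Suc m..<r])"
    by (cases "Suc m < r") (simp_all add: upt_conv_Cons E_def)
  have "prod_list (map C [m..<r]) = Y 0 m * E (Suc m) * (?y * ?e)"
    using step by (simp add: upt_conv_Cons C_rec)
  also have "\<dots> = Y 0 m * (E (Suc m) * ?y) * ?e" by (simp only: mult.assoc)
  also have "\<dots> = Y 0 m * ?y * (E (Suc m) * ?e)" by (simp only: comm mult.assoc)
  also have "\<dots> = prod_list (map (Y 0) [m..<r]) * (E (Suc m) * ?e)"
    using step(2) by (simp add: upt_conv_Cons)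
  finally show ?case unfolding e .
qed simp

text \<open>On the right-hand side, moving \<open>\<Delta> ^ d\<close> to the front turns
  \<open>c\<close> into the product of all \<open>E m\<close>, which lies in the sectors after 0 and
  so commutes with \<open>long\<close> and with the row of sector 0. On the left-hand side the
  diagonal is \<open>Y 0 0 * E 1\<close>, and \<open>E 1\<close> completes the part of
  \<open>c\<close> outside sector 0 to that same product.\<close>

lemma conjugation:
  "\<Delta> ^ d * (long * prod_list (map (\<lambda>k. Y k k) [0..<r])) * prod_list (map C [1..<r])
    = prod_list (map C [1..<r]) * (\<Delta> ^ d * (long * prod_list (map (Y 0) [0..<r])))"
proof -
  let ?y = "prod_list (map (Y 0) [1..<r])" and ?e = "prod_list (map E [Suc 1..<r])"
    and ?E = "prod_list (map E [Suc 0..<r])"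
  have r0: "0 < r" "1 < r" using r by auto
  have E: "?E = E 1 * ?e" using r0 by (simp add: upt_conv_Cons)
  have diag: "prod_list (map (\<lambda>k. Y k k) [0..<r]) = Y 0 0 * E 1"
    using r0 by (simp add: upt_conv_Cons E_def)
  have row: "prod_list (map (Y 0) [0..<r]) = Y 0 0 * ?y" using r0 by (simp add: upt_conv_Cons)
  have com_long: "long * ?E = ?E * long" by (rule E_commute) (use long_commute in auto)
  have com_Y: "Y 0 k * ?E = ?E * Y 0 k" if "k < r" for k
    by (rule E_commute) (use Y_commute [of 0] that in auto)
  have com_e: "?e * ?y = ?y * ?e"
  proof (rule prod_list_commute [THEN HOL.sym, symmetric])
    fix x assume "x \<in> set (map (Y 0) [1..<r])"
    then obtain k where k: "x = Y 0 k" "k < r" by auto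
    have "Y 0 k * ?e = ?e * Y 0 k" by (rule E_commute) (use Y_commute [of 0] k in auto)
    then show "?e * x = x * ?e" unfolding k by (rule HOL.sym)
  qed
  have com_y: "?E * ?y = ?y * ?E"
  proof (rule prod_list_commute)
    fix x assume "x \<in> set (map (Y 0) [1..<r])"
    then obtain k where k: "x = Y 0 k" "k < r" by auto
    show "?E * x = x * ?E" unfolding k using com_Y [OF k(2)] by (rule HOL.sym)
  qed
  have c: "prod_list (map C [1..<r]) = ?y * ?e" using prod_C [of 1] r0 by simp
  have shiftc: "prod_list (map C [1..<r]) * \<Delta> ^ d = \<Delta> ^ d * ?E"
    using prod_list_upt_conj [of 1 r C "\<Delta> ^ d" E] C_conj by simp
  have "long * (Y 0 0 * E 1) * (?y * ?e) = long * Y 0 0 * (E 1 * ?e) * ?y"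
    by (simp only: mult.assoc com_e)
  also have "\<dots> = long * (Y 0 0 * ?E) * ?y" by (simp only: E mult.assoc)
  also have "\<dots> = (long * ?E) * Y 0 0 * ?y" by (simp only: com_Y [OF r0(1)] mult.assoc)
  also have "\<dots> = ?E * (long * (Y 0 0 * ?y))" by (simp only: com_long mult.assoc)
  finally have "\<Delta> ^ d * (long * (Y 0 0 * E 1)) * (?y * ?e) = \<Delta> ^ d * ?E * (long * (Y 0 0 * ?y))"
    by (simp only: mult.assoc)
  then show ?thesis
    unfolding diag row c shiftc [symmetric, unfolded c] by (simp only: mult.assoc)
qed

text \<open>An explicit band word for the conjugator, from which its positivity and its commuting
  with \<open>\<Delta> ^ n\<close> can be read off.\<close>

definition cs :: "edge list" where
  "cs = concat (map (\<lambda>m. concat (map (\<lambda>k. shift ((k - m) * d) (B k)) [m..<r])) [1..<r])"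

lemma bw_cs: "bw cs = prod_list (map C [1..<r])"
  by (simp add: cs_def bw_concat comp_def C_def [abs_def] Y_def)

lemma edges_in_cs: "edges_in {1..n} cs"
  unfolding cs_def
proof (clarsimp simp: edges_in_concat)
  fix m k assume "m \<le> k" "k < r"
  then have "edges_in {1..n} (shift ((k - m) * d) (B k))"
    by (intro edges_in_n [OF _ edges_in_S]) auto
  then show "edges_in {Suc 0..n} (shift ((k - m) * d) (B k))" by simp
qed

section \<open>Condition (2)\<close>

lemma pm_first_sector:
  assumes "bw (concat (map (\<lambda>k. rots (k * d) es) (rev [0..<r]))) = \<Delta>"
    and es: "edges_in {1..Suc d} es" and z: "1 \<le> z" "z \<le> d"
  shows "pm es z = Suc z"
proof -
  let ?V = "concat (map (\<lambda>k. rots (k * d) es) (rev [1..<r]))"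
  have sub: "edges_in {1..n} es" using es S_bound [of 0] r by (intro edges_in_mono [OF es]) auto
  have W: "concat (map (\<lambda>k. rots (k * d) es) (rev [0..<r])) = ?V @ es"
    using r by (simp add: upt_conv_Cons)
  \<comment> \<open>The translates with \<open>k \<ge> 1\<close> live in \<open>{Suc d..n}\<close>
    and fix \<open>z\<close>, so \<open>es\<close> alone must act on \<open>z\<close> as
    \<open>\<Delta>\<close> does.\<close>
  have V: "edges_in {Suc d..n} ?V"
    unfolding edges_in_concat
  proof clarsimp
    fix k assume k: "Suc 0 \<le> k" "k < r"
    then have "edges_in {1 + k * d..Suc d + k * d} (rots (k * d) es)"
      using rots_eq_shift [OF es S_bound [OF k(2)]] edges_in_shift [OF es] by metis
    then show "edges_in {Suc d..n} (rots (k * d) es)"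
      by (rule edges_in_mono) (use k S_bound [OF k(2)] in auto)
  qed
  have "edges_in {1..n} (?V @ es)"
    using V sub edges_in_mono [of "{Suc d..n}" ?V "{1..n}"] by auto
  then have "pm (?V @ es) = pm (block_edges {1..n})"
    using assms(1) unfolding W by (intro bw_eq_\<Delta>(1))
  then have "pm es (pm ?V z) = pm (block_edges {1..n}) z" by (metis comp_apply pm_append)
  moreover have "pm ?V z = z" using V z by (intro pm_outside) auto
  moreover have "pm (block_edges {1..n}) z = Suc z"
    using z S_bound [of 0] r by (intro pm_block_edges_Icc) auto
  ultimately show ?thesis by simp
qed

text \<open>\<open>bw_eq_blocks\<close> speaks of partitions of all of \<open>{1..n}\<close>; the
  added singletons contribute no edges.\<close>

lemma block_prefix_partition:
  assumes "1 \<le> b" "b \<le> n"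
  shows "noncrossing_partition n ({1..b} # map (\<lambda>i. {i}) [Suc b..<Suc n])"
proof (rule noncrossing_partitionI)
  show "distinct ({1..b} # map (\<lambda>i. {i}) [Suc b..<Suc n])"
    using assms by (auto simp: distinct_map inj_on_def simp del: upt_Suc)
  show "\<Union> (set ({1..b} # map (\<lambda>i. {i}) [Suc b..<Suc n])) = {1..n}"
    using assms by (auto simp del: upt_Suc)
  show "noncrossing T U" if "T \<in> set ({1..b} # map (\<lambda>i. {i}) [Suc b..<Suc n])"
    "U \<in> set ({1..b} # map (\<lambda>i. {i}) [Suc b..<Suc n])" "T \<noteq> U" for T U
    using that by (auto simp: noncrossing_def simp del: upt_Suc)
qed (use assms in auto)

lemma blocks_edges_singletons: "blocks_edges (map (\<lambda>i. {i}) L) = []"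
  by (induction L) (simp_all add: block_edges_def)

text \<open>Each \<open>z \<le> d\<close> goes to \<open>Suc z\<close>, and injectivity leaves only
  \<open>1\<close> as the image of \<open>Suc d\<close>: this is the permutation of the subsimple
  element on \<open>{1..Suc d}\<close>. The length \<open>d\<close> and the \<open>n - d\<close>
  blocks add up to \<open>n\<close>, so the elements agree.\<close>

lemma bw_eq_first_block:
  assumes "bw (concat (map (\<lambda>k. rots (k * d) es) (rev [0..<r]))) = \<Delta>"
    and es: "edges_in {1..Suc d} es" and len: "length es = d"
  shows "bw es = bw (block_edges {1..Suc d})"
proof -
  let ?P = "{1..Suc d} # map (\<lambda>i. {i}) [Suc (Suc d)..<Suc n]"
  have dn: "Suc d \<le> n" using S_bound [of 0] r by simp
  have P: "noncrossing_partition n ?P" using block_prefix_partition [of "Suc d"] dn by simp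
  have blk: "edges_in {1..Suc d} (block_edges {1..Suc d})" by (simp add: edges_in_block_edges)
  have "pm es z = pm (block_edges {1..Suc d}) z" for z
  proof -
    have small: "pm es z = pm (block_edges {1..Suc d}) z" if "1 \<le> z" "z \<le> d" for z
      using pm_first_sector [OF assms(1,2)] pm_block_edges_Icc [of 1 z "Suc d"] that by simp
    have last: "pm fs (Suc d) = 1"
      if fs: "edges_in {1..Suc d} fs" "\<And>z. 1 \<le> z \<Longrightarrow> z \<le> d \<Longrightarrow> pm fs z = Suc z" for fs
    proof (rule ccontr)
      assume ne: "pm fs (Suc d) \<noteq> 1"
      have "pm fs (Suc d) \<in> {1..Suc d}" using fs(1) by (rule pm_inside) simp
      with ne obtain z where z: "pm fs (Suc d) = Suc z" "1 \<le> z" "z \<le> d"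
        by (cases "pm fs (Suc d)") auto
      then have "pm fs (Suc d) = pm fs z" using fs(2) by simp
      then have "Suc d = z" using bij_pm by (metis bij_def injD)
      with z show False by simp
    qed
    have first: "pm fs z = Suc z" if "1 \<le> z" "z \<le> d" "fs = es \<or> fs = block_edges {1..Suc d}" for z fs
      using that small pm_block_edges_Icc [of 1 z "Suc d"] by auto
    consider "1 \<le> z" "z \<le> d" | "z = Suc d" | "z \<notin> {1..Suc d}" by force
    then show ?thesis
    proof cases
      case 1
      then show ?thesis by (rule small)
    next
      case 2
      then show ?thesis using last [OF es] last [OF blk] first by metis
    next
      case 3
      then show ?thesis using pm_outside [OF es] pm_outside [OF blk] by simp
    qed
  qed
  then have "pm es = pm (blocks_edges ?P)"
    by (simp add: fun_eq_iff blocks_edges_singletons del: upt_Suc)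
  moreover have "length es + length ?P = n" using len dn by (simp del: upt_Suc)
  moreover have "edges_in {1..n} es" using dn by (intro edges_in_mono [OF es]) auto
  ultimately have "bw es = bw (blocks_edges ?P)" by (intro bw_eq_blocks [OF P])
  then show ?thesis by (simp add: blocks_edges_singletons del: upt_Suc)
qed

lemma first_block: "bw (block_edges {1..Suc d}) = long * bw (block_edges {2..Suc d})"
proof -
  have "{x \<in> {1..Suc d}. \<not> (1 < x \<and> x \<le> Suc d)} = {1}" "{x \<in> {1..Suc d}. 1 < x \<and> x \<le> Suc d} = {2..Suc d}"
    by auto
  moreover have "{1..Suc d} \<subseteq> {1..n}" using S_bound [of 0] r by auto
  ultimately show ?thesis
    using block_split_left [of "{1..Suc d}" 1 "Suc d"] d by (simp add: long_def block_edges_def [of "{Suc 0}"])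
qed

lemma product_of_sectors:
  assumes pow: "(\<Delta> ^ d * (long * prod_list (map (\<lambda>k. Y k k) [0..<r]))) ^ r = \<Delta> ^ n"
  shows "prod_list (map (Y 0) [0..<r]) = bw (block_edges {2..Suc d})"
proof -
  let ?c = "prod_list (map C [1..<r])" and ?x = "(Suc d, 1) # concat (map B [0..<r])"
  let ?\<alpha> = "\<Delta> ^ d * (long * prod_list (map (\<lambda>k. Y k k) [0..<r]))"
  let ?\<beta> = "\<Delta> ^ d * (long * prod_list (map (Y 0) [0..<r]))"
  have x: "edges_in {1..Suc d} ?x"
    using d B edges_in_mono [of "{2..Suc d}" _ "{1..Suc d}"] by (auto simp: edges_in_concat)
  have xn: "edges_in {1..n} ?x" using S_bound [of 0] r by (intro edges_in_mono [OF x]) auto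
  have bwx: "bw ?x = long * prod_list (map (Y 0) [0..<r])"
    by (simp add: bw_concat comp_def long_def Y_def [abs_def])
  have "?\<alpha> ^ k * ?c = ?c * ?\<beta> ^ k" for k
  proof (induction k)
    case (Suc k)
    have "?\<alpha> ^ Suc k * ?c = ?\<alpha> ^ k * (?\<alpha> * ?c)" by (simp only: power_Suc2 mult.assoc)
    also have "\<dots> = ?\<alpha> ^ k * ?c * ?\<beta>" by (subst conjugation) (simp only: mult.assoc)
    also have "\<dots> = ?c * ?\<beta> ^ Suc k" by (simp only: Suc power_Suc2 mult.assoc)
    finally show ?case .
  qed simp
  \<comment> \<open>\<open>\<alpha> ^ r\<close> is central, hence unchanged by the conjugation. So
    \<open>\<beta>\<close> is another \<open>r\<close>-th root of \<open>\<Delta> ^ n\<close>, but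
    now its factor \<open>?x\<close> lies in \<open>{1..Suc d}\<close>.\<close>
  from this [of r] have "\<Delta> ^ n * ?c = ?c * ?\<beta> ^ r" by (simp only: pow)
  then have "?c * ?\<beta> ^ r = ?c * \<Delta> ^ n"
    by (simp only: \<Delta>_pow_n_central [OF edges_in_cs, unfolded bw_cs])
  then have "(\<Delta> ^ d * bw ?x) ^ r = \<Delta> ^ n" by (simp only: group_left_cancel bwx)
  then have W: "bw (concat (map (\<lambda>k. rots (k * d) ?x) (rev [0..<r]))) = \<Delta>"
    by (rule root_factorization [OF xn])
  have "edges_in {1..n} (concat (map (\<lambda>k. rots (k * d) ?x) (rev [0..<r])))"
    using edges_in_rots [OF xn] by (auto simp: edges_in_concat)
  then have "length (concat (map (\<lambda>k. rots (k * d) ?x) (rev [0..<r]))) = r * d"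
    using bw_eq_\<Delta>(2) [OF W] n_eq by simp
  moreover have "length (rots k es) = length es" for k es by (simp add: rots_def)
  then have "length (concat (map (\<lambda>k. rots (k * d) ?x) (rev [0..<r]))) = r * length ?x"
    by (simp add: length_concat comp_def sum_list_triv del: rots_simps)
  \<comment> \<open>The \<open>n - 1 = r * d\<close> edges of a factorization of
    \<open>\<Delta>\<close> are shared equally by the \<open>r\<close> rotated copies of
    \<open>?x\<close>.\<close>
  ultimately have "r * length ?x = r * d" by simp
  then have "length ?x = d \<or> r = 0" by (simp only: mult_cancel1)
  then have "length ?x = d" using r by auto
  then have "bw ?x = long * bw (block_edges {2..Suc d})"
    using bw_eq_first_block [OF W x] first_block by simp
  then show ?thesis unfolding bwx by (simp only: group_left_cancel)
qed

end

section \<open>Simplicity of the sector factors and of the conjugator\<close>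

context braid_bands
begin

text \<open>Since X\<Delta> = \<Delta>\<tau>(X), what stands before \<open>c\<close> can reappear,
  rotated, at the end. So every middle factor of \<open>\<Delta>\<close> is a left factor.\<close>

lemma middle_factor:
  assumes "edges_in {1..n} X" "edges_in {1..n} Z" "bw X * c * bw Z = \<Delta>"
  shows "\<exists>fs. edges_in {1..n} fs \<and> c * bw fs = \<Delta>"
proof (intro exI conjI)
  show "edges_in {1..n} (Z @ rots 1 X)" using assms edges_in_rots by simp
  have "bw X * (c * bw (Z @ rots 1 X)) = bw X * c * bw Z * bw (rots 1 X)"
    by (simp add: mult.assoc)
  also have "\<dots> = bw X * \<Delta>"
    using bw_rots [OF assms(1), of 1] by (simp only: assms(3) power_one_right)
  finally show "c * bw (Z @ rots 1 X) = \<Delta>" by (simp only: group_left_cancel)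
qed

text \<open>A point outside \<open>T\<close> is touched by no edge and hence fixed by the
  permutation, which is transitive on each block; so the block of such a point is a
  singleton.\<close>

lemma supported_blocks:
  assumes es: "edges_in T es" "T \<subseteq> {1..n}" and fs: "edges_in {1..n} fs" "bw es * bw fs = \<Delta>"
    and n: "1 \<le> n"
  shows "\<exists>P. noncrossing_partition n P \<and> bw es = bw (blocks_edges P) \<and> (\<forall>U\<in>set P. 2 \<le> card U \<longrightarrow> U \<subseteq> T)"
proof -
  have esn: "edges_in {1..n} es" using edges_in_mono es by blast
  have edges: "edges_in {1..n} (es @ fs)" using esn fs(1) by simp
  have bw: "bw (es @ fs) = \<Delta>" using fs(2) by simp
  obtain P where P: "noncrossing_partition n P" "bw es = bw (blocks_edges P)"
    using prefix_eq_blocks [OF \<Delta>_partition [OF n] edges] bw_eq_\<Delta> [OF bw edges] n by auto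
  note nc = nc_partitionD [OF P(1)]
  have pm: "pm es = pm (blocks_edges P)" using bw_eq_imp [OF esn nc(8) P(2)] by simp
  have "U \<subseteq> T" if U: "U \<in> set P" "2 \<le> card U" for U
  proof
    fix x assume x: "x \<in> U"
    show "x \<in> T"
    proof (rule ccontr)
      assume "x \<notin> T"
      then have "(\<lambda>z. z = x) \<circ> pm es = (\<lambda>z. z = x)"
        using es(1) by (intro comp_pm_invariant) (auto simp: edges_in_def)
      then have "(z = x) = (x = x)" if "z \<in> U" for z
        using blocks_edges_transitive [OF _ nc(7) nc(4) U(1) that x, of "\<lambda>z. z = x"] pm by simp
      then have "U \<subseteq> {x}" by auto
      then have "card U \<le> card {x}" by (intro card_mono) auto
      with U(2) show False by simp
    qed
  qed
  with P show ?thesis by blast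
qed

end

context staircase
begin

abbreviation sector :: "nat \<Rightarrow> 'a" where "sector k \<equiv> bw (block_edges (S k))"

text \<open>A right factor of \<open>\<Delta>\<close> large enough to contain the conjugator:
  \<open>\<Delta>\<close> ends in \<open>G r\<close>, and \<open>G (r - 1)\<close> ends in
  \<open>c\<close>.\<close>

definition G :: "nat \<Rightarrow> 'a" where "G k = prod_list (map sector [0..<k])"

lemma edges_in_sector: "edges_in (S k) (block_edges (S k))"
  by (rule edges_in_block_edges) (simp add: S_def)

lemma sector_commute_G: "k < r \<Longrightarrow> sector k * G k = G k * sector k"
  unfolding G_def
proof (rule prod_list_commute)
  fix x assume "k < r" "x \<in> set (map sector [0..<k])"
  then obtain j where "x = sector j" "j < k" by auto
  then show "sector k * x = x * sector k"
    using \<open>k < r\<close> by (auto intro!: bw_commute_noncrossing [OF noncrossing_S edges_in_sector edges_in_sector] S_subset)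
qed

lemma block_edges_sector:
  assumes "k < r"
  shows "bw (block_edges {1..Suc (Suc k * d)})
    = A (Suc (Suc k * d)) (Suc (k * d)) * sector k * bw (block_edges {1..Suc (k * d)})"
proof -
  let ?a = "Suc (k * d)" and ?b = "Suc (Suc k * d)"
  have ab: "1 \<le> ?a" "?a < ?b" "?b \<le> n" using d S_bound [OF assms] by auto
  have "[1..<Suc ?b] = [1..<?a] @ [?a..<Suc ?b]"
  proof -
    have "?a + (Suc ?b - ?a) = Suc ?b" using ab(2) by arith
    then show ?thesis using upt_add_eq_append [OF ab(1), of "Suc ?b - ?a"] by (simp only:)
  qed
  moreover have "[?a..<Suc ?b] = ?a # [Suc ?a..<Suc ?b]" using ab by (intro upt_conv_Cons) simp
  moreover have "[1..<Suc ?a] = [1..<?a] @ [?a]" by simp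
  ultimately have "bw (block_edges {1..?b}) = bw (block_edges {?a..?b}) * bw (block_edges {1..?a})"
    unfolding block_edges_def sorted_list_of_set_Icc by (metis sub_append)
  moreover have "{x \<in> {?a..?b}. \<not> (?a < x \<and> x \<le> ?b)} = {?a}" "{x \<in> {?a..?b}. ?a < x \<and> x \<le> ?b} = S k"
    using ab by (auto simp: S_def)
  then have "bw (block_edges {?a..?b}) = A ?b ?a * sector k"
    using block_split_left [of "{?a..?b}" ?a ?b] ab by (simp add: block_edges_def [of "{?a}"])
  ultimately show ?thesis by simp
qed

text \<open>Each sector contributes its long band and its subsimple element. The latter does not
  cross the earlier part and moves to the end, so that \<open>ps\<close> consists of the long
  bands.\<close>

lemma \<Delta>_prefix:
  assumes "k \<le> r"
  shows "\<exists>ps. edges_in {1..Suc (k * d)} ps \<and> bw (block_edges {1..Suc (k * d)}) = bw ps * G k"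
  using assms
proof (induction k)
  case 0
  show ?case by (rule exI [of _ "[]"]) (simp add: G_def block_edges_def)
next
  case (Suc k)
  then obtain ps where ps: "edges_in {1..Suc (k * d)} ps" "bw (block_edges {1..Suc (k * d)}) = bw ps * G k"
    by auto
  let ?a = "Suc (k * d)" and ?b = "Suc (Suc k * d)"
  have k: "k < r" and ab: "1 \<le> ?a" "?a < ?b" "?b \<le> n" using Suc d S_bound [of k] by auto
  have "noncrossing {1..?a} (S k)" by (rule noncrossing_less) (auto simp: S_def)
  then have comm: "bw ps * sector k = sector k * bw ps"
    by (rule bw_commute_noncrossing [OF _ ps(1) edges_in_sector _ S_subset [OF k]]) (use ab in auto)
  have "bw (block_edges {1..?b}) = A ?b ?a * (sector k * bw ps) * G k"
    by (simp only: block_edges_sector [OF k] ps(2) mult.assoc)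
  also have "\<dots> = A ?b ?a * bw ps * (sector k * G k)" by (simp only: comm [symmetric] mult.assoc)
  also have "\<dots> = bw ((?b, ?a) # ps) * G (Suc k)"
    by (simp only: sector_commute_G [OF k]) (simp add: G_def mult.assoc)
  finally have "bw (block_edges {1..?b}) = bw ((?b, ?a) # ps) * G (Suc k)" .
  moreover have "edges_in {1..?b} ((?b, ?a) # ps)"
    using ab edges_in_mono [OF ps(1), of "{1..?b}"] by simp
  ultimately show ?case by blast
qed

lemma sector_conj:
  assumes "Suc j < r"
  shows "sector j * \<Delta> ^ d = \<Delta> ^ d * sector (Suc j)"
proof -
  have "edges_in {1..Suc d + j * d} (block_edges (S j))"
    by (rule edges_in_mono [OF edges_in_sector]) (auto simp: S_def)
  moreover have "Suc d + j * d + d \<le> n" using S_bound [OF assms] by simp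
  moreover have "shift d (block_edges (S j)) = block_edges (S (Suc j))"
    by (simp add: S_def shift_block_edges add.commute add.left_commute)
  ultimately show ?thesis using bw_shift by metis
qed

lemma G_conj:
  assumes "k < r"
  shows "\<exists>g. G k * \<Delta> ^ d = \<Delta> ^ d * g \<and> sector 0 * g = G (Suc k)"
proof (intro exI conjI)
  show "G k * \<Delta> ^ d = \<Delta> ^ d * prod_list (map (\<lambda>j. sector (Suc j)) [0..<k])"
    unfolding G_def by (rule prod_list_upt_conj) (use assms sector_conj in auto)
  have "[0..<Suc k] = 0 # map Suc [0..<k]"
    by (simp add: map_Suc_upt upt_conv_Cons del: upt_Suc)
  then show "sector 0 * prod_list (map (\<lambda>j. sector (Suc j)) [0..<k]) = G (Suc k)"
    by (simp add: G_def comp_def del: upt_Suc)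
qed

end

text \<open>Condition (2) as an assumption: with it, an incomplete row of factors can be filled up
  to the subsimple element of a whole sector.\<close>

locale full_sectors = sectors +
  assumes full: "prod_list (map (Y 0) [0..<r]) = bw (block_edges {2..Suc d})"
begin

lemma sector_0: "sector 0 = bw (block_edges {2..Suc d})"
  by (simp add: S_def)

text \<open>The product from \<open>C m\<close> on is a row in sector 0 followed by the
  \<tau>^d-image of the product from \<open>C (Suc m)\<close> on. The translated complement of the
  latter commutes with sector 0, and by (2) the missing \<open>B 0, ..., B (m-1)\<close> complete
  the row to \<open>sector 0\<close>.\<close>

lemma conjugator_left_complement:
  assumes "m \<le> r"
  shows "\<exists>es. edges_in {2..Suc ((r - m) * d)} es \<and> bw es * prod_list (map C [m..<r]) = G (r - m)"
  using assms
proof (induction rule: inc_induct)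
  case base
  show ?case by (rule exI [of _ "[]"]) (simp add: G_def)
next
  case (step m)
  let ?P = "prod_list (map C [Suc m..<r])" and ?E = "prod_list (map E [Suc m..<r])"
    and ?y = "prod_list (map (Y 0) [m..<r])"
  obtain es where es: "edges_in {2..Suc ((r - Suc m) * d)} es" "bw es * ?P = G (r - Suc m)"
    using step.IH by blast
  obtain g where g: "G (r - Suc m) * \<Delta> ^ d = \<Delta> ^ d * g" "sector 0 * g = G (Suc (r - Suc m))"
    using G_conj [of "r - Suc m"] r by auto
  have rm: "(r - m) * d = (r - Suc m) * d + d"
    using step(2) by (metis Suc_diff_Suc add.commute mult_Suc)
  have le: "(r - m) * d \<le> r * d" by simp
  have P: "?P * \<Delta> ^ d = \<Delta> ^ d * ?E"
    by (rule prod_list_upt_conj) (use C_conj in auto)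
  have "edges_in {1..Suc ((r - Suc m) * d)} es" by (rule edges_in_mono [OF es(1)]) auto
  moreover have "Suc ((r - Suc m) * d) + d \<le> n" using le rm n_eq by simp
  ultimately have s: "bw es * \<Delta> ^ d = \<Delta> ^ d * bw (shift d es)" by (rule bw_shift)
  have "\<Delta> ^ d * (bw (shift d es) * ?E) = bw es * (\<Delta> ^ d * ?E)" by (simp only: s flip: mult.assoc)
  also have "\<dots> = bw es * ?P * \<Delta> ^ d" by (simp only: P mult.assoc)
  also have "\<dots> = \<Delta> ^ d * g" by (simp only: es(2) g(1))
  finally have E: "bw (shift d es) * ?E = g" by (simp only: group_left_cancel)
  have sh: "edges_in {2 + d..Suc ((r - m) * d)} (shift d es)"
    using edges_in_shift [OF es(1), of d] rm by simp
  have "bw (shift d es) * Y 0 k = Y 0 k * bw (shift d es)" if "k < r" for k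
  proof -
    have "noncrossing {2..Suc d} {2 + d..Suc ((r - m) * d)}" by (rule noncrossing_less) auto
    then have "noncrossing {2 + d..Suc ((r - m) * d)} {2..Suc d}" by (rule noncrossing_sym)
    then show ?thesis
      unfolding Y_def using sh B [OF that] S_bound [of 0] r le n_eq
      by (intro bw_commute_noncrossing [of "{2 + d..Suc ((r - m) * d)}" "{2..Suc d}"]) auto
  qed
  then have comm: "bw (shift d es) * ?y = ?y * bw (shift d es)"
    by (intro prod_list_commute) auto
  let ?es = "concat (map B [0..<m]) @ shift d es"
  have x: "bw (concat (map B [0..<m])) = prod_list (map (Y 0) [0..<m])"
    by (simp add: bw_concat comp_def Y_def [abs_def])
  have "[0..<r] = [0..<m] @ [m..<r]" using step(2) upt_add_eq_append [of 0 m "r - m"] by simp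
  then have xy: "prod_list (map (Y 0) [0..<m]) * ?y = sector 0" using full by (simp add: sector_0)
  have "bw ?es * prod_list (map C [m..<r]) = prod_list (map (Y 0) [0..<m]) * (bw (shift d es) * ?y) * ?E"
    using prod_C [of m] step(2) by (simp add: x mult.assoc)
  also have "\<dots> = prod_list (map (Y 0) [0..<m]) * ?y * (bw (shift d es) * ?E)"
    by (simp only: comm mult.assoc)
  also have "\<dots> = G (r - m)"
    using step(2) by (simp only: xy E g(2)) (simp add: Suc_diff_Suc)
  finally have "bw ?es * prod_list (map C [m..<r]) = G (r - m)" .
  moreover have "edges_in {2..Suc ((r - m) * d)} ?es"
  proof -
    have "edges_in {2..Suc ((r - m) * d)} (B k)" if "k < r" for k
      by (rule edges_in_mono [OF B [OF that]]) (use rm in auto)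
    moreover have "edges_in {2..Suc ((r - m) * d)} (shift d es)"
      by (rule edges_in_mono [OF sh]) auto
    ultimately show ?thesis using step(2) by (auto simp: edges_in_concat)
  qed
  ultimately show ?case by blast
qed

lemma \<Delta>_sectors: "\<exists>ps. edges_in {1..n} ps \<and> \<Delta> = bw ps * G r"
  using \<Delta>_prefix [of r] n_eq by simp

lemma conjugator_simple: "\<exists>fs. edges_in {1..n} fs \<and> prod_list (map C [1..<r]) * bw fs = \<Delta>"
proof -
  obtain es where es: "edges_in {2..Suc ((r - 1) * d)} es" "bw es * prod_list (map C [1..<r]) = G (r - 1)"
    using conjugator_left_complement [of 1] r by auto
  obtain ps where ps: "edges_in {1..n} ps" "\<Delta> = bw ps * G r"
    using \<Delta>_sectors by blast
  have "[0..<r] = [0..<r - 1] @ [r - 1]" using r by (metis Suc_diff_1 Suc_1 Suc_le_lessD less_trans zero_less_one upt_Suc_append le0)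
  then have "G r = G (r - 1) * sector (r - 1)" by (simp add: G_def)
  then have "\<Delta> = bw (ps @ es) * prod_list (map C [1..<r]) * sector (r - 1)"
    by (simp only: ps(2) es(2) [symmetric] bw_simps mult.assoc)
  moreover have "(r - 1) * d \<le> r * d" by simp
  then have "edges_in {1..n} (ps @ es)"
    using ps(1) edges_in_mono [OF es(1), of "{1..n}"] n_eq by auto
  moreover have "edges_in {1..n} (block_edges (S (r - 1)))"
    by (rule edges_in_n [OF _ edges_in_sector]) (use r in auto)
  ultimately show ?thesis using middle_factor by metis
qed

text \<open>Translating (2) by \<open>k * d\<close> exhibits \<open>Y k k\<close>, which is
  \<open>b_k\<close>, as one factor of \<open>sector k\<close>, and hence of \<open>G r\<close> and
  of \<open>\<Delta>\<close>.\<close>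

lemma sector_factor_simple:
  assumes k: "k < r"
  shows "\<exists>fs. edges_in {1..n} fs \<and> Y k k * bw fs = \<Delta>"
proof -
  have "prod_list (map (Y 0) [0..<r]) * \<Delta> ^ (k * d) = \<Delta> ^ (k * d) * prod_list (map (Y k) [0..<r])"
    by (rule prod_list_upt_conj) (use Y_conj_pow k in auto)
  moreover have "bw (block_edges {2..Suc d}) * \<Delta> ^ (k * d) = \<Delta> ^ (k * d) * sector k"
    using bw_shift_S [OF _ k, of "block_edges {2..Suc d}"] edges_in_block_edges [of "{2..Suc d}"]
    by (simp add: shift_block_edges S_def)
  ultimately have row: "prod_list (map (Y k) [0..<r]) = sector k"
    unfolding full by (metis group_left_cancel)
  have split: "[0..<r] = [0..<k] @ k # [Suc k..<r]"
    using k upt_add_eq_append [of 0 k "r - k"] by (simp add: upt_conv_Cons)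
  obtain ps where ps: "edges_in {1..n} ps" "\<Delta> = bw ps * G r"
    using \<Delta>_sectors by blast
  let ?b = "\<lambda>ks. concat (map (\<lambda>i. shift (k * d) (B i)) ks)" and ?s = "\<lambda>ks. concat (map (\<lambda>j. block_edges (S j)) ks)"
  have b: "bw (?b ks) = prod_list (map (Y k) ks)" for ks
    by (simp add: bw_concat comp_def Y_def [abs_def])
  have s: "bw (?s ks) = prod_list (map sector ks)" for ks
    by (simp add: bw_concat comp_def)
  have "\<Delta> = bw ps * (bw (?s [0..<k]) * (prod_list (map (Y k) [0..<r]) * bw (?s [Suc k..<r])))"
    unfolding ps(2) G_def row s by (subst split) simp
  also have "prod_list (map (Y k) [0..<r]) = bw (?b [0..<k]) * (Y k k * bw (?b [Suc k..<r]))"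
    unfolding b by (subst split) simp
  finally have "bw (ps @ ?s [0..<k] @ ?b [0..<k]) * Y k k * bw (?b [Suc k..<r] @ ?s [Suc k..<r]) = \<Delta>"
    by (simp only: bw_simps mult.assoc)
  moreover have "edges_in {1..n} (?b ks)" "edges_in {1..n} (?s ks)" if "set ks \<subseteq> {..<r}" for ks
    using that edges_in_n [OF k edges_in_S] edges_in_n [OF _ edges_in_sector]
    by (auto simp: edges_in_concat)
  then have "edges_in {1..n} (ps @ ?s [0..<k] @ ?b [0..<k])" "edges_in {1..n} (?b [Suc k..<r] @ ?s [Suc k..<r])"
    using ps(1) k by (auto simp: subset_iff)
  ultimately show ?thesis using middle_factor by blast
qed

end

section \<open>The braid groups as groups of a type\<close>

lemma braid_word_simps [simp]:
  "braid_word n []" "braid_word n (x # w) \<longleftrightarrow> x \<noteq> 0 \<and> \<bar>x\<bar> < int n \<and> braid_word n w"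
  "braid_word n (u @ v) \<longleftrightarrow> braid_word n u \<and> braid_word n v"
  by (auto simp: braid_word_def)

lemma braid_word_concat: "braid_word n (concat ws) \<longleftrightarrow> (\<forall>w\<in>set ws. braid_word n w)"
  by (induction ws) auto

lemma winv_simps [simp]:
  "winv [] = []" "winv (x # w) = winv w @ [- x]" "winv (u @ v) = winv v @ winv u"
  by (simp_all add: winv_def)

lemma braid_word_winv [simp]: "braid_word n (winv w) \<longleftrightarrow> braid_word n w"
  by (induction w) auto

lemma braid_word_wpow: "braid_word n w \<Longrightarrow> braid_word n (wpow w m)"
  by (auto simp: wpow_def braid_word_concat)

lemma beq_braid_word: "beq n u v \<Longrightarrow> braid_word n u \<and> braid_word n v"
  by (induction rule: beq.induct) auto

lemma beq_winv_left: "braid_word n w \<Longrightarrow> beq n (winv w @ w) []"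
proof (induction w)
  case (Cons x w)
  have "beq n [- x, x] []"
  proof (cases "x > 0")
    case True
    then show ?thesis using Cons beq.cancel2 [of x n] by simp
  next
    case False
    then show ?thesis using Cons beq.cancel1 [of "- x" n] by simp
  qed
  then have "beq n ([- x, x] @ w) ([] @ w)" using Cons by (intro beq.cong beq.refl) simp_all
  then have "beq n (winv w @ [- x, x] @ w) (winv w @ [] @ w)"
    using Cons by (intro beq.cong [OF beq.refl]) simp_all
  then show ?case using Cons beq.trans by auto
qed (simp add: beq.refl)

lemma winv_winv [simp]: "winv (winv w) = w"
  by (induction w) auto

lemma beq_winv:
  assumes "beq n u v"
  shows "beq n (winv u) (winv v)"
proof -
  have w: "braid_word n u" "braid_word n v" using beq_braid_word [OF assms] by auto
  have "beq n (v @ winv v) []" using beq_winv_left [of n "winv v"] w by simp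
  then have "beq n (winv u @ (v @ winv v)) (winv u @ [])"
    using w by (intro beq.cong beq.refl) simp_all
  moreover have "beq n (winv u @ (v @ winv v)) (winv u @ (u @ winv v))"
    using w assms by (intro beq.cong beq.refl beq.sym [OF assms]) simp_all
  moreover have "beq n ((winv u @ u) @ winv v) ([] @ winv v)"
    using w beq_winv_left by (intro beq.cong beq.refl) simp_all
  ultimately show ?thesis by simp (meson beq.sym beq.trans)
qed

text \<open>\<open>beq n\<close> is reflexive on braid words only. Deleting illegal letters gives
  every list a meaning for every \<open>n\<close>, which makes the relation on families
  reflexive.\<close>

definition letters :: "nat \<Rightarrow> int list \<Rightarrow> int list" where
  "letters n w = filter (\<lambda>x. x \<noteq> 0 \<and> \<bar>x\<bar> < int n) w"

lemma braid_word_letters [simp]: "braid_word n (letters n w)"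
  by (simp add: letters_def braid_word_def)

lemma letters_id: "braid_word n w \<Longrightarrow> letters n w = w"
  by (simp add: letters_def braid_word_def filter_id_conv)

lemma letters_append [simp]: "letters n (u @ v) = letters n u @ letters n v"
  by (simp add: letters_def)

lemma letters_Nil [simp]: "letters n [] = []"
  by (simp add: letters_def)

lemma letters_winv: "letters n (winv w) = winv (letters n w)"
  by (induction w) (auto simp: letters_def)

definition beq_family :: "(nat \<Rightarrow> int list) \<Rightarrow> (nat \<Rightarrow> int list) \<Rightarrow> bool" where
  "beq_family f g \<longleftrightarrow> (\<forall>n. beq n (letters n (f n)) (letters n (g n)))"

text \<open>The direct product of all the groups \<open>B\<^sub>n\<close>.  This makes every \<open>B\<^sub>n\<close> a subgroup of a group given by
  a type, although \<open>n\<close> is a term.\<close>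

quotient_type braids = "nat \<Rightarrow> int list" / beq_family
proof (rule equivpI)
  show "reflp beq_family" by (simp add: reflp_def beq_family_def beq.refl)
  show "symp beq_family" by (auto simp: symp_def beq_family_def intro: beq.sym)
  show "transp beq_family" unfolding transp_def beq_family_def by (blast intro: beq.trans)
qed

instantiation braids :: mult_group
begin

lift_definition one_braids :: braids is "\<lambda>_. []" .

lift_definition times_braids :: "braids \<Rightarrow> braids \<Rightarrow> braids" is "\<lambda>f g n. f n @ g n"
  by (simp add: beq_family_def beq.cong)

lift_definition inverse_braids :: "braids \<Rightarrow> braids" is "\<lambda>f n. winv (f n)"
  by (simp add: beq_family_def letters_winv beq_winv)

definition divide_braids :: "braids \<Rightarrow> braids \<Rightarrow> braids" where
  "divide_braids a b = a * inverse b"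

instance
proof
  fix a b c :: braids
  show "a * b * c = a * (b * c)" "1 * a = a" "a * 1 = a"
    by (transfer; simp add: beq_family_def beq.refl)+
  show "inverse a * a = 1"
    by transfer (simp add: beq_family_def letters_winv beq_winv_left)
  show "divide a b = a * inverse b" by (rule divide_braids_def)
qed

end

text \<open>The embedding of the \<open>n\<close>-th factor of the product; the other coordinates
  are trivial, so equality of images is \<open>beq n\<close>.\<close>

lift_definition br :: "nat \<Rightarrow> int list \<Rightarrow> braids" is "\<lambda>n w m. if m = n then w else []" .

lemma br_eq_iff: "braid_word n u \<Longrightarrow> braid_word n v \<Longrightarrow> br n u = br n v \<longleftrightarrow> beq n u v"
  by transfer (auto simp: beq_family_def letters_id beq.refl split: if_splits)

lemma br_append [simp]: "br n (u @ v) = br n u * br n v"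
  by transfer (simp add: beq_family_def beq.refl)

lemma br_Nil [simp]: "br n [] = 1"
  by transfer (simp add: beq_family_def beq.refl)

lemma br_winv [simp]: "br n (winv w) = inverse (br n w)"
  by transfer (auto simp: beq_family_def beq.refl)

lemma br_concat: "br n (concat ws) = prod_list (map (br n) ws)"
  by (induction ws) simp_all

lemma br_wpow: "br n (wpow w m) = br n w powi m"
proof -
  have "br n (concat (replicate k w)) = br n w ^ k" for k w by (induction k) simp_all
  then show ?thesis by (simp add: wpow_def power_int_def)
qed

lemma br_neg: "br n [- x] = inverse (br n [x])"
  using br_winv [of n "[x]"] by (simp del: br_winv)

section \<open>The band generators\<close>

context
  fixes n :: nat
begin

definition \<sigma> :: "nat \<Rightarrow> braids" where "\<sigma> i = br n [int i]"

definition bnd :: "nat \<Rightarrow> nat \<Rightarrow> braids" where "bnd i j = br n (band i j)"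

lemma \<sigma>_commute:
  assumes "1 \<le> i" "i + 2 \<le> j" "j < n"
  shows "\<sigma> i * \<sigma> j = \<sigma> j * \<sigma> i"
proof -
  have "beq n [int i, int j] [int j, int i]" using assms by (intro beq.commute) auto
  then have "br n ([int i] @ [int j]) = br n ([int j] @ [int i])" using assms by (subst br_eq_iff) auto
  then show ?thesis by (simp only: br_append \<sigma>_def)
qed

lemma \<sigma>_braid:
  assumes "1 \<le> i" "Suc i < n"
  shows "\<sigma> i * \<sigma> (Suc i) * \<sigma> i = \<sigma> (Suc i) * \<sigma> i * \<sigma> (Suc i)"
proof -
  have "beq n [int i, int i + 1, int i] [int i + 1, int i, int i + 1]" using assms by (intro beq.braid) auto
  then have "br n ([int i] @ [int i + 1] @ [int i]) = br n ([int i + 1] @ [int i] @ [int i + 1])"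
    using assms by (subst br_eq_iff) auto
  moreover have "\<sigma> (Suc i) = br n [int i + 1]" by (simp add: \<sigma>_def add.commute)
  ultimately show ?thesis by (simp only: br_append \<sigma>_def mult.assoc)
qed

lemma bnd_Suc: "bnd (Suc j) j = \<sigma> j"
  by (simp add: bnd_def \<sigma>_def band_def band0_def)

lemma bnd_step:
  assumes "j < i"
  shows "bnd (Suc i) j = \<sigma> i * bnd i j * inverse (\<sigma> i)"
proof -
  have "band (Suc i) j = [int i] @ band i j @ [- int i]"
    using assms by (simp add: band_def band0_def)
  then show ?thesis by (simp only: bnd_def \<sigma>_def br_append br_neg mult.assoc)
qed

lemma commute_bnd:
  assumes "k < l" "\<And>m. k \<le> m \<Longrightarrow> m < l \<Longrightarrow> g * \<sigma> m = \<sigma> m * g"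
  shows "g * bnd l k = bnd l k * g"
  using assms
proof (induction l)
  case (Suc l)
  show ?case
  proof (cases "k < l")
    case True
    have s: "g * \<sigma> l = \<sigma> l * g" using Suc True by simp
    have IH: "g * bnd l k = bnd l k * g" using Suc True by simp
    have inv: "g * inverse (\<sigma> l) = inverse (\<sigma> l) * g" by (rule group_commute_inverse [OF s])
    have "g * bnd (Suc l) k = \<sigma> l * (g * bnd l k) * inverse (\<sigma> l)"
      by (simp only: bnd_step [OF True] s flip: mult.assoc)
    also have "\<dots> = \<sigma> l * bnd l k * (g * inverse (\<sigma> l))" by (simp only: IH mult.assoc)
    finally show ?thesis by (simp only: inv bnd_step [OF True] mult.assoc)
  next
    case False
    then have "k = l" using Suc by simp
    then show ?thesis using Suc by (simp add: bnd_Suc)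
  qed
qed simp

lemma \<sigma>_commute_far:
  assumes "1 \<le> j" "j < i" "i < k" "k < n"
  shows "\<sigma> k * bnd i j = bnd i j * \<sigma> k"
  by (rule commute_bnd [OF assms(2)], rule \<sigma>_commute [symmetric]) (use assms in auto)

text \<open>By the braid relation, \<open>x\<close> and \<open>u\<close> are the conjugates of the
  commuting elements \<open>y\<close> and \<open>b\<close> by \<open>y * x\<close>. This serves the
  shortest band reaching over \<sigma>_k, where \<open>u\<close> is a_(k+2,j).\<close>

lemma group_braid_conj:
  fixes x y b :: "'g::mult_group"
  assumes "x * y * x = y * x * y" "y * b = b * y"
  defines "u \<equiv> y * (x * b * inverse x) * inverse y"
  shows "x * u = u * x"
proof -
  have "x * u * (y * x) = x * y * x * b" by (simp add: u_def mult.assoc)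
  also have "\<dots> = y * x * (y * b)" by (simp only: assms(1)) (simp only: mult.assoc)
  also have "\<dots> = u * (y * x * y)" by (simp add: u_def assms(2) mult.assoc)
  also have "\<dots> = u * x * (y * x)" by (simp only: assms(1) [symmetric]) (simp only: mult.assoc)
  finally show ?thesis by (simp only: group_right_cancel)
qed

lemma \<sigma>_commute_inside:
  assumes "1 \<le> j" "j < k" "Suc k < i" "i \<le> n"
  shows "\<sigma> k * bnd i j = bnd i j * \<sigma> k"
proof -
  have "Suc (Suc k) \<le> i" using assms by simp
  then show ?thesis
    using assms(4)
  proof (induction i rule: dec_induct)
    case base
    have "\<sigma> k * \<sigma> (Suc k) * \<sigma> k = \<sigma> (Suc k) * \<sigma> k * \<sigma> (Suc k)" using assms base by (intro \<sigma>_braid) auto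
    moreover have "\<sigma> (Suc k) * bnd k j = bnd k j * \<sigma> (Suc k)" using assms base by (intro \<sigma>_commute_far) auto
    ultimately have "\<sigma> k * (\<sigma> (Suc k) * (\<sigma> k * bnd k j * inverse (\<sigma> k)) * inverse (\<sigma> (Suc k))) =
      (\<sigma> (Suc k) * (\<sigma> k * bnd k j * inverse (\<sigma> k)) * inverse (\<sigma> (Suc k))) * \<sigma> k"
      by (rule group_braid_conj)
    then show ?case using assms by (simp only: bnd_step less_SucI)
  next
    case (step i)
    have s: "\<sigma> k * \<sigma> i = \<sigma> i * \<sigma> k" using assms step by (intro \<sigma>_commute) auto
    have inv: "\<sigma> k * inverse (\<sigma> i) = inverse (\<sigma> i) * \<sigma> k" by (rule group_commute_inverse [OF s])
    have ji: "j < i" using assms step by simp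
    have IH: "\<sigma> k * bnd i j = bnd i j * \<sigma> k" using step by simp
    have "\<sigma> k * bnd (Suc i) j = \<sigma> i * (\<sigma> k * bnd i j) * inverse (\<sigma> i)"
      by (simp only: bnd_step [OF ji] s flip: mult.assoc)
    also have "\<dots> = \<sigma> i * bnd i j * (\<sigma> k * inverse (\<sigma> i))" by (simp only: IH mult.assoc)
    finally show ?case by (simp only: inv bnd_step [OF ji] mult.assoc)
  qed
qed

text \<open>The braid relation of \<open>p\<close> and \<open>q\<close> rewrites \<open>u\<close> as
  \<open>inverse p * q * p\<close>. As \<open>p\<close> commutes with \<open>t\<close>, conjugating
  the braid relation of \<open>q\<close> and \<open>t\<close> by \<open>p\<close> gives that of
  \<open>u\<close> and \<open>t\<close>.\<close>

lemma group_braid_transfer: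
  fixes p q t :: "'g::mult_group"
  assumes pq: "p * q * p = q * p * q" and qt: "q * t * q = t * q * t" and pt: "p * t = t * p"
  defines "u \<equiv> q * p * inverse q"
  shows "u * t * u = t * u * t"
proof -
  have "p * u * q = p * (q * p) " by (simp add: u_def mult.assoc)
  also have "\<dots> = q * p * q"  by (simp only: pq mult.assoc [symmetric])
  finally have "p * u = q * p" by (simp only: group_right_cancel)
  then have u: "u = inverse p * q * p" by (metis group_cancel_simps(1) mult.assoc)
  have pt': "t * inverse p = inverse p * t" using group_commute_inverse [OF pt [symmetric]] .
  have "u * t * u = inverse p * q * (p * t) * inverse p * q * p" by (simp only: u mult.assoc)
  also have "\<dots> = inverse p * (q * t * q) * p" by (simp add: pt mult.assoc)
  also have "\<dots> = (inverse p * t) * q * (t * p)" by (simp only: qt) (simp only: mult.assoc)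
  also have "\<dots> = t * u * t" by (simp only: pt [symmetric] pt' [symmetric] u mult.assoc)
  finally show ?thesis .
qed

lemma bnd_\<sigma>_braid:
  assumes "1 \<le> k" "k < j" "j < n"
  shows "bnd j k * \<sigma> j * bnd j k = \<sigma> j * bnd j k * \<sigma> j"
proof -
  have "Suc k \<le> j" using assms by simp
  then show ?thesis
    using assms(3)
  proof (induction j rule: dec_induct)
    case base
    then show ?case using assms(1) by (simp add: bnd_Suc \<sigma>_braid)
  next
    case (step j)
    have "k < j" using step by simp
    show ?case
      unfolding bnd_step [OF \<open>k < j\<close>]
    proof (rule group_braid_transfer)
      show "bnd j k * \<sigma> j * bnd j k = \<sigma> j * bnd j k * \<sigma> j" using step by simp
      show "\<sigma> j * \<sigma> (Suc j) * \<sigma> j = \<sigma> (Suc j) * \<sigma> j * \<sigma> (Suc j)" using assms step by (intro \<sigma>_braid) auto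
      have "\<sigma> (Suc j) * bnd j k = bnd j k * \<sigma> (Suc j)" using assms step by (intro \<sigma>_commute_far) auto
      then show "bnd j k * \<sigma> (Suc j) = \<sigma> (Suc j) * bnd j k" by (rule HOL.sym)
    qed
  qed
qed

text \<open>For \<open>i = Suc j\<close> this comes from the braid relation of
  \<open>bnd j k\<close> and \<open>\<sigma> j\<close>. The step from \<open>i\<close> to
  \<open>Suc i\<close> is conjugation by \<open>\<sigma> i\<close>, which commutes with
  \<open>bnd j k\<close>.\<close>

lemma bnd_triangle:
  assumes "1 \<le> k" "k < j" "j < i" "i \<le> n"
  shows "bnd i j * bnd j k = bnd j k * bnd i k \<and> bnd j k * bnd i k = bnd i k * bnd i j"
proof -
  have "Suc j \<le> i" using assms by simp
  then show ?thesis
    using assms(4)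
  proof (induction i rule: dec_induct)
    case base
    have br: "bnd j k * \<sigma> j * bnd j k = \<sigma> j * bnd j k * \<sigma> j" using assms base by (intro bnd_\<sigma>_braid) auto
    have step: "bnd (Suc j) k = \<sigma> j * bnd j k * inverse (\<sigma> j)" using assms by (intro bnd_step) simp
    have "bnd j k * bnd (Suc j) k = (bnd j k * \<sigma> j * bnd j k) * inverse (\<sigma> j)" by (simp only: step mult.assoc)
    also have "\<dots> = \<sigma> j * bnd j k" by (simp only: br) (simp add: mult.assoc)
    finally have 1: "bnd j k * bnd (Suc j) k = \<sigma> j * bnd j k" .
    have 2: "bnd (Suc j) k * \<sigma> j = \<sigma> j * bnd j k" by (simp add: step mult.assoc)
    show ?case by (simp only: bnd_Suc 1 2 simp_thms)
  next
    case (step i)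
    have ji: "j < i" "k < i" using step assms by auto
    have "\<sigma> i * bnd j k = bnd j k * \<sigma> i" using assms step by (intro \<sigma>_commute_far) auto
    then have comm: "inverse (\<sigma> i) * bnd j k = bnd j k * inverse (\<sigma> i)"
      using group_commute_inverse [of "bnd j k" "\<sigma> i"] by metis
    have comm': "\<sigma> i * bnd j k = bnd j k * \<sigma> i" by fact
    have IH: "bnd i j * bnd j k = bnd j k * bnd i k" "bnd j k * bnd i k = bnd i k * bnd i j" using step by auto
    have "bnd (Suc i) j * bnd j k = \<sigma> i * (bnd i j * bnd j k) * inverse (\<sigma> i)"
      by (simp only: bnd_step [OF ji(1)] comm mult.assoc)
    moreover have "bnd j k * bnd (Suc i) k = \<sigma> i * (bnd j k * bnd i k) * inverse (\<sigma> i)"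
      by (simp only: bnd_step [OF ji(2)] comm' flip: mult.assoc)
    moreover have "bnd (Suc i) k * bnd (Suc i) j = \<sigma> i * (bnd i k * bnd i j) * inverse (\<sigma> i)"
      by (simp add: bnd_step [OF ji(1)] bnd_step [OF ji(2)] mult.assoc)
    ultimately show ?case by (simp only: IH simp_thms)
  qed
qed

end

section \<open>Permutation and exponent sum of a braid\<close>

definition expo :: "int list \<Rightarrow> int" where "expo w = sum_list (map sgn w)"

lemma expo_simps [simp]:
  "expo [] = 0" "expo (x # w) = sgn x + expo w" "expo (u @ v) = expo u + expo v"
  by (simp_all add: expo_def)

lemma expo_winv [simp]: "expo (winv w) = - expo w"
  by (induction w) auto

lemma beq_expo: "beq n u v \<Longrightarrow> expo u = expo v"
  by (induction rule: beq.induct) auto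

lemma braid_perm_Cons: "braid_perm (x # w) = braid_perm w \<circ> transpose (nat \<bar>x\<bar>) (Suc (nat \<bar>x\<bar>))"
  by (simp add: braid_perm_def fun_eq_iff transp_at_def transpose_def)

lemma braid_perm_Nil: "braid_perm [] = id"
  by (simp add: braid_perm_def)

lemma braid_perm_append: "braid_perm (u @ v) = braid_perm v \<circ> braid_perm u"
  by (induction u) (simp_all add: braid_perm_Cons braid_perm_Nil comp_assoc)

lemma beq_braid_perm: "beq n u v \<Longrightarrow> braid_perm u = braid_perm v"
proof (induction rule: beq.induct)
  case (commute i j)
  then show ?case
    by (auto simp: braid_perm_Cons braid_perm_Nil fun_eq_iff transpose_def nat_eq_iff)
next
  case (braid i)
  then obtain k where "i = int k" "1 \<le> k" by (metis nat_0_le nat_le_eq_zle order.trans zero_le_one nat_one_as_int)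
  then show ?case
    by (auto simp: braid_perm_Cons braid_perm_Nil fun_eq_iff transpose_def nat_add_distrib)
qed (simp_all add: braid_perm_Cons braid_perm_Nil braid_perm_append comp_assoc)

lemma band_step: "j < i \<Longrightarrow> band (Suc i) j = [int i] @ band i j @ [- int i]"
  by (simp add: band_def band0_def)

lemma band_sym: "band i j = band j i"
  by (auto simp: band_def)

lemma band_induct_facts:
  assumes "1 \<le> j" "j < i"
  shows "braid_perm (band i j) = transpose i j \<and> expo (band i j) = 1 \<and> (i \<le> n \<longrightarrow> braid_word n (band i j))"
proof -
  have "Suc j \<le> i" using assms by simp
  then show ?thesis
  proof (induction i rule: dec_induct)
    case base
    then show ?case
      using assms by (auto simp: band_def band0_def braid_perm_Cons braid_perm_Nil transpose_commute)
  next
    case (step i)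
    have "transpose i (Suc i) \<circ> (transpose i j \<circ> transpose i (Suc i)) = transpose (Suc i) j"
      using step by (auto simp: fun_eq_iff transpose_def)
    then show ?case
      using step assms by (simp add: band_step braid_perm_append braid_perm_Cons braid_perm_Nil comp_assoc)
  qed
qed

definition bword :: "edge list \<Rightarrow> int list" where
  "bword es = concat (map (\<lambda>(i, j). band i j) es)"

lemma bword_simps [simp]:
  "bword [] = []" "bword (e # es) = band (fst e) (snd e) @ bword es" "bword (es @ fs) = bword es @ bword fs"
  by (simp_all add: bword_def case_prod_beta)

lemma band_facts:
  assumes "i \<in> {1..n}" "j \<in> {1..n}" "i \<noteq> j"
  shows "braid_perm (band i j) = transpose i j" "expo (band i j) = 1" "braid_word n (band i j)"
  using assms band_induct_facts [of j i n] band_induct_facts [of i j n] band_sym [of i j]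
  by (cases "i < j"; simp add: transpose_commute)+

lemma bword_facts:
  assumes "edges_in {1..n} es"
  shows "braid_perm (bword es) = pm es" "expo (bword es) = int (length es)" "braid_word n (bword es)"
  using assms by (induction es) (auto simp: braid_perm_append braid_perm_Nil band_facts simp del: atLeastAtMost_iff)

interpretation band: band_generators n "\<lambda>i j. br n (band i j)" for n :: nat
proof
  show "br n (band i j) = br n (band j i)" for i j by (simp only: band_sym)
  show "br n (band i j) * br n (band k l) = br n (band k l) * br n (band i j)"
    if "1 \<le> j" "j < i" "i < l" "l < k" "k \<le> n" for i j k l
    using that by (intro commute_bnd [unfolded bnd_def] \<sigma>_commute_far [unfolded bnd_def, symmetric]) auto
  show "br n (band i j) * br n (band k l) = br n (band k l) * br n (band i j)"
    if "1 \<le> j" "j < l" "l < k" "k < i" "i \<le> n" for i j k l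
    using that by (intro commute_bnd [unfolded bnd_def] \<sigma>_commute_inside [unfolded bnd_def, symmetric]) auto
qed (use bnd_triangle [unfolded bnd_def] in auto)

abbreviation bw :: "nat \<Rightarrow> edge list \<Rightarrow> braids" where
  "bw n \<equiv> band_generators.bw (\<lambda>i j. br n (band i j))"

lemma bw_eq_br: "bw n es = br n (bword es)"
  by (induction es) simp_all

interpretation braid: braid_bands n "\<lambda>i j. br n (band i j)" for n :: nat
proof
  fix es fs assume e: "edges_in {1..n} es" "edges_in {1..n} fs" and "bw n es = bw n fs"
  then have beq: "beq n (bword es) (bword fs)"
    by (simp add: bw_eq_br br_eq_iff bword_facts)
  show "pm es = pm fs \<and> length es = length fs"
    using beq_expo [OF beq] beq_braid_perm [OF beq] bword_facts [OF e(1)] bword_facts [OF e(2)] by simp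
qed

section \<open>Positive elements, infimum and supremum\<close>

lemma subsimple_list_eq: "subsimple_list L = bword (path_edges L)"
  by (induction L rule: path_edges.induct) simp_all

lemma subsimple_eq: "subsimple T = bword (block_edges T)"
  by (simp add: subsimple_def block_edges_def subsimple_list_eq)

lemma concat_subsimple_eq: "concat (map subsimple P) = bword (blocks_edges P)"
  by (induction P) (simp_all add: subsimple_eq)

lemma delta_eq: "delta n = bword (block_edges {1..n})"
proof (induction n)
  case (Suc n)
  show ?case
  proof (cases "n = 0")
    case False
    then have "[1..<Suc (Suc n)] = [1..<n] @ [n, Suc n]" "[1..<Suc n] = [1..<n] @ [n]" by auto
    then have "block_edges {1..Suc n} = (Suc n, n) # block_edges {1..n}"
      unfolding block_edges_def sorted_list_of_set_Icc by (metis path_edges_snoc)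
    moreover have "delta (Suc n) = int n # delta n" using False by (simp add: delta_def)
    ultimately show ?thesis using Suc by (simp add: band_def band0_def)
  qed (simp add: delta_def block_edges_def)
qed (simp add: delta_def block_edges_def)

abbreviation \<Delta> :: "nat \<Rightarrow> braids" where "\<Delta> n \<equiv> bw n (block_edges {1..n})"

lemma br_delta: "br n (delta n) = \<Delta> n"
  by (simp add: delta_eq bw_eq_br)

lemma edges_in_\<Delta>: "edges_in {1..n} (block_edges {1..n})"
  by (rule edges_in_block_edges) simp

lemma braid_word_delta [simp]: "braid_word n (delta n)"
  unfolding delta_eq by (rule bword_facts(3) [OF edges_in_\<Delta>])

lemma expo_delta: "expo (delta n) = int n - 1" if "1 \<le> n"
  using bword_facts(2) [OF edges_in_\<Delta>, of n] that
  by (simp add: delta_eq block_edges_def length_path_edges)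

lemma expo_wpow: "expo (wpow w m) = m * expo w"
proof -
  have "expo (concat (replicate k w)) = int k * expo w" for k w
    by (induction k) (simp_all add: algebra_simps)
  then show ?thesis by (simp add: wpow_def)
qed

lemma br_dpow: "br n (dpow n m) = \<Delta> n powi m"
  by (simp add: dpow_def br_wpow br_delta)

lemma braid_word_dpow [simp]: "braid_word n (dpow n m)"
  by (simp add: dpow_def braid_word_wpow)

lemma expo_dpow: "1 \<le> n \<Longrightarrow> expo (dpow n m) = m * (int n - 1)"
  by (simp add: dpow_def expo_wpow expo_delta)

definition pos :: "nat \<Rightarrow> braids \<Rightarrow> bool" where
  "pos n g \<longleftrightarrow> (\<exists>es. edges_in {1..n} es \<and> g = bw n es)"

lemma posI: "g = bw n es \<Longrightarrow> edges_in {1..n} es \<Longrightarrow> pos n g"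
  unfolding pos_def by blast

lemma positive_iff: "positive n w \<longleftrightarrow> braid_word n w \<and> pos n (br n w)"
proof
  assume "positive n w"
  then obtain ps where ps: "\<forall>(i, j)\<in>set ps. 1 \<le> j \<and> j < i \<and> i \<le> n" "beq n w (bword ps)"
    unfolding positive_def bword_def by auto
  have "edges_in {1..n} ps" using ps(1) by (force simp: edges_in_def)
  then show "braid_word n w \<and> pos n (br n w)"
    using ps(2) beq_braid_word [OF ps(2)] br_eq_iff unfolding pos_def bw_eq_br by blast
next
  assume w: "braid_word n w \<and> pos n (br n w)"
  then obtain es where es: "edges_in {1..n} es" "br n w = br n (bword es)"
    unfolding pos_def bw_eq_br by auto
  \<comment> \<open>\<open>positive\<close> wants the larger endpoint first, whereas edges carry no
    orientation.\<close>
  let ?ps = "map (\<lambda>(i, j). if j < i then (i, j) else (j, i)) es"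
  have "bword ?ps = bword es"
    by (induction es) (auto simp: band_sym)
  moreover have "\<forall>(i, j)\<in>set ?ps. 1 \<le> j \<and> j < i \<and> i \<le> n"
  proof clarify
    fix i j assume "(i, j) \<in> set ?ps"
    then obtain x y where xy: "(x, y) \<in> set es" "(i, j) = (if y < x then (x, y) else (y, x))" by auto
    then have "x \<in> {1..n}" "y \<in> {1..n}" "x \<noteq> y" using es(1) by (auto simp: edges_in_def)
    then show "1 \<le> j \<and> j < i \<and> i \<le> n" using xy(2) by (auto split: if_splits)
  qed
  moreover have "beq n w (bword es)" using w es bword_facts(3) br_eq_iff by blast
  ultimately show "positive n w"
    unfolding positive_def bword_def [symmetric] by (intro exI [of _ ?ps] conjI) (simp_all only:)
qed

lemma preceq_iff:
  assumes "braid_word n x" "braid_word n y"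
  shows "preceq n x y \<longleftrightarrow> pos n (inverse (br n x) * br n y)"
  using assms by (simp add: preceq_def positive_iff)

lemma simpleI:
  assumes "braid_word n w" "br n w = bw n es" "edges_in {1..n} es"
    and "edges_in {1..n} fs" "br n w * bw n fs = \<Delta> n"
  shows "simple n w"
proof -
  have "inverse (br n w) * \<Delta> n = bw n fs" unfolding assms(5) [symmetric] by simp
  then show ?thesis
    unfolding simple_def using assms by (auto simp: preceq_iff br_delta pos_def)
qed

lemma pos_one: "pos n 1"
  unfolding pos_def by (rule exI [of _ "[]"]) simp

lemma pos_mult: "pos n g \<Longrightarrow> pos n h \<Longrightarrow> pos n (g * h)"
  unfolding pos_def by (metis band.bw_simps(3) edges_in_simps(3))

lemma pos_conj: "pos n g \<Longrightarrow> \<exists>h. pos n h \<and> g * \<Delta> n ^ k = \<Delta> n ^ k * h"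
  unfolding pos_def using braid.bw_rots braid.edges_in_rots by metis

text \<open>Braid words may contain inverse letters, so centrality is passed from the bands
  \<sigma>_k = a_(k+1,k) to their inverses, letter by letter.\<close>

lemma \<Delta>_central: "braid_word n w \<Longrightarrow> br n w * \<Delta> n ^ n = \<Delta> n ^ n * br n w"
proof (induction w)
  case (Cons x w)
  let ?k = "nat \<bar>x\<bar>"
  have k: "?k < n" "1 \<le> ?k" using Cons by auto
  have e: "edges_in {1..n} [(Suc ?k, ?k)]" using k by auto
  have "band (Suc ?k) ?k = [int ?k]" by (simp add: band_def band0_def)
  then have s: "br n [int ?k] * \<Delta> n ^ n = \<Delta> n ^ n * br n [int ?k]"
    using braid.\<Delta>_pow_n_central [OF e] by simp
  have "br n [x] * \<Delta> n ^ n = \<Delta> n ^ n * br n [x]"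
  proof (cases "x > 0")
    case True
    then show ?thesis using s by simp
  next
    case False
    then have "br n [x] = inverse (br n [int ?k])" by (simp flip: br_neg)
    then show ?thesis using group_commute_inverse [OF s [symmetric]] by metis
  qed
  moreover have "br n w * \<Delta> n ^ n = \<Delta> n ^ n * br n w" using Cons by simp
  moreover have "br n (x # w) = br n [x] * br n w" using br_append [of n "[x]" w] by simp
  ultimately show ?case by (metis mult.assoc)
qed simp

text \<open>Rotation by \<open>n\<close> steps is the identity, so the inverse of a rotation by one
  step is the rotation by \<open>n - 1\<close> steps.\<close>

lemma pos_conj_left:
  assumes "pos n g"
  shows "\<exists>h. pos n h \<and> \<Delta> n * g = h * \<Delta> n"
proof (cases "n = 0")
  case True
  then show ?thesis using assms by (auto simp: pos_def block_edges_def)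
next
  case False
  obtain es where es: "edges_in {1..n} es" "g = bw n es" using assms by (auto simp: pos_def)
  have h: "edges_in {1..n} (braid_bands.rots n (n - 1) es)" using es(1) by (rule braid.edges_in_rots)
  have "bw n (braid_bands.rots n (n - 1) es) * \<Delta> n ^ 1 = \<Delta> n ^ 1 * bw n (braid_bands.rots n 1 (braid_bands.rots n (n - 1) es))"
    by (rule braid.bw_rots [OF h])
  moreover have "braid_bands.rots n 1 (braid_bands.rots n (n - 1) es) = braid_bands.rots n n es"
    using False by (simp add: braid.rots_rots)
  moreover have "bw n (braid_bands.rots n n es) = g"
  proof -
    have "\<Delta> n ^ n * bw n (braid_bands.rots n n es) = \<Delta> n ^ n * g"
      using braid.bw_rots [OF es(1), of n] braid.\<Delta>_pow_n_central [OF es(1)] es(2) by metis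
    then show ?thesis by (simp only: group_left_cancel)
  qed
  ultimately show ?thesis using h by (auto simp: pos_def)
qed

text \<open>Every \<sigma>_k is a right factor of \<open>\<Delta>\<close>, so one more
  \<open>\<Delta>\<close>, moved through the positive part already obtained, absorbs an inverse
  letter.\<close>

lemma ex_pos_\<Delta>_power: "braid_word n w \<Longrightarrow> \<exists>N. pos n (\<Delta> n ^ N * br n w)"
proof (induction w rule: rev_induct)
  case Nil
  show ?case by (rule exI [of _ 0]) (simp add: pos_one)
next
  case (snoc x w)
  then obtain N where N: "pos n (\<Delta> n ^ N * br n w)" by auto
  let ?k = "nat \<bar>x\<bar>"
  have k: "?k < n" "1 \<le> ?k" using snoc by auto
  have e: "edges_in {1..n} [(Suc ?k, ?k)]" using k by auto
  have band: "band (Suc ?k) ?k = [int ?k]" by (simp add: band_def band0_def)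
  show ?case
  proof (cases "x > 0")
    case True
    then have "x = int ?k" by simp
    then have "br n [x] = bw n [(Suc ?k, ?k)]"
      by (simp only: bw_eq_br bword_simps fst_conv snd_conv band append_Nil2)
    then have "pos n (br n [x])" using e unfolding pos_def by blast
    then show ?thesis using pos_mult [OF N] by (auto simp: mult.assoc)
  next
    case False
    then have x: "br n [x] = inverse (br n [int ?k])" by (simp flip: br_neg)
    obtain h where h: "pos n h" "\<Delta> n * (\<Delta> n ^ N * br n w) = h * \<Delta> n"
      using pos_conj_left [OF N] by blast
    let ?U = "{y\<in>{1..n}. \<not> (?k \<le> y \<and> y < Suc ?k)}" and ?V = "{y\<in>{1..n}. ?k \<le> y \<and> y < Suc ?k}"
    have "\<Delta> n = bw n (block_edges ?U) * bw n (block_edges ?V) * br n (band (Suc ?k) ?k)"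
      using k by (intro band.block_split_right) auto
    then have "\<Delta> n * br n [x] = bw n (block_edges ?U @ block_edges ?V)" by (simp add: x band mult.assoc)
    moreover have "edges_in {1..n} (block_edges ?U @ block_edges ?V)"
      using edges_in_block_edges [of ?U] edges_in_block_edges [of ?V] by (auto intro: edges_in_mono)
    ultimately have "pos n (\<Delta> n * br n [x])" by (rule posI)
    then have "pos n (h * (\<Delta> n * br n [x]))" by (rule pos_mult [OF h(1)])
    also have "h * (\<Delta> n * br n [x]) = \<Delta> n ^ Suc N * br n (w @ [x])"
      by (simp only: h(2) [symmetric] br_append power_Suc flip: mult.assoc)
    finally show ?thesis by blast
  qed
qed

text \<open>\<open>binf\<close> and \<open>bsup\<close> are a \<open>GREATEST\<close> and a
  \<open>LEAST\<close> over the integers; such a value is attained once the predicate is known to be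
  satisfiable and bounded.\<close>

lemma Greatest_int:
  fixes P :: "int \<Rightarrow> bool"
  assumes "P m" "\<And>k. P k \<Longrightarrow> k \<le> b"
  shows "P (GREATEST k. P k)" "P k \<Longrightarrow> k \<le> (GREATEST k. P k)"
proof -
  let ?A = "{k \<in> {m..b}. P k}"
  have "?A \<subseteq> {m..b}" by auto
  then have A: "finite ?A" "?A \<noteq> {}"
    using assms finite_subset [OF _ finite_atLeastAtMost_int] by (blast, auto)
  then have "Max ?A \<in> ?A" by (rule Max_in)
  moreover have "k \<le> Max ?A" if "P k" for k
  proof (cases "m \<le> k")
    case True
    then show ?thesis using A that assms(2) by (intro Max_ge) auto
  next
    case False
    then show ?thesis using \<open>Max ?A \<in> ?A\<close> by auto
  qed
  ultimately have "(GREATEST k. P k) = Max ?A" by (intro Greatest_equality) auto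
  then show "P (GREATEST k. P k)" "P k \<Longrightarrow> k \<le> (GREATEST k. P k)"
    using \<open>Max ?A \<in> ?A\<close> \<open>\<And>k. P k \<Longrightarrow> k \<le> Max ?A\<close> by auto
qed

lemma Least_int:
  fixes P :: "int \<Rightarrow> bool"
  assumes "P m" "\<And>k. P k \<Longrightarrow> b \<le> k"
  shows "P (LEAST k. P k)" "P k \<Longrightarrow> (LEAST k. P k) \<le> k"
proof -
  let ?A = "{k \<in> {b..m}. P k}"
  have "?A \<subseteq> {b..m}" by auto
  then have A: "finite ?A" "?A \<noteq> {}"
    using assms finite_subset [OF _ finite_atLeastAtMost_int] by (blast, auto)
  then have "Min ?A \<in> ?A" by (rule Min_in)
  moreover have "Min ?A \<le> k" if "P k" for k
  proof (cases "k \<le> m")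
    case True
    then show ?thesis using A that assms(2) by (intro Min_le) auto
  next
    case False
    then show ?thesis using \<open>Min ?A \<in> ?A\<close> by auto
  qed
  ultimately have "(LEAST k. P k) = Min ?A" by (intro Least_equality) auto
  then show "P (LEAST k. P k)" "P k \<Longrightarrow> (LEAST k. P k) \<le> k"
    using \<open>Min ?A \<in> ?A\<close> \<open>\<And>k. P k \<Longrightarrow> Min ?A \<le> k\<close> by auto
qed

lemma pos_br_expo:
  assumes "braid_word n w" "edges_in {1..n} es" "br n w = bw n es"
  shows "expo w = int (length es)"
proof -
  have "beq n w (bword es)" using assms br_eq_iff bword_facts(3) unfolding bw_eq_br by blast
  then show ?thesis using beq_expo bword_facts(2) [OF assms(2)] by metis
qed

lemma preceq_expo: "preceq n x y \<Longrightarrow> braid_word n y \<Longrightarrow> expo x \<le> expo y"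
  using pos_br_expo [of n "winv x @ y"] unfolding preceq_def positive_iff pos_def by fastforce

section \<open>Existence of infimum and supremum, with bounds from exponent sums\<close>

context
  fixes n :: nat and w :: "int list"
  assumes n: "2 \<le> n" and w: "braid_word n w"
begin

lemma binf_bounded: "preceq n (dpow n k) w \<Longrightarrow> k \<le> \<bar>expo w\<bar>"
proof -
  assume "preceq n (dpow n k) w"
  then have "k * (int n - 1) \<le> expo w" using preceq_expo w n by (simp flip: expo_dpow)
  moreover have "k \<le> k * (int n - 1)" if "0 \<le> k" using n that mult_left_mono [of 1 "int n - 1" k] by simp
  ultimately show ?thesis by linarith
qed

lemma bsup_bounded: "preceq n w (dpow n k) \<Longrightarrow> - \<bar>expo w\<bar> \<le> k"
proof -
  assume "preceq n w (dpow n k)"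
  then have "expo w \<le> k * (int n - 1)" using preceq_expo n by (simp flip: expo_dpow)
  moreover have "k * (int n - 1) \<le> k" if "k \<le> 0" using n that mult_left_mono_neg [of 1 "int n - 1" k] by simp
  ultimately show ?thesis by linarith
qed

lemma ex_binf: "\<exists>k. preceq n (dpow n k) w"
proof -
  obtain N where "pos n (\<Delta> n ^ N * br n w)" using ex_pos_\<Delta>_power [OF w] by blast
  then have "preceq n (dpow n (- int N)) w"
    using w by (simp add: preceq_iff br_dpow group_powi_minus)
  then show ?thesis by blast
qed

lemma ex_bsup: "\<exists>k. preceq n w (dpow n k)"
proof -
  obtain N where "pos n (\<Delta> n ^ N * br n (winv w))" using ex_pos_\<Delta>_power [of n "winv w"] w by auto
  then obtain h where h: "pos n h" "\<Delta> n ^ N * inverse (br n w) * \<Delta> n ^ N = \<Delta> n ^ N * h"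
    using pos_conj by fastforce
  from h(2) have "inverse (br n w) * \<Delta> n ^ N = h" by (simp only: mult.assoc group_left_cancel)
  then have "preceq n w (dpow n (int N))" using h(1) w by (simp add: preceq_iff br_dpow)
  then show ?thesis by blast
qed

lemma binf:
  "preceq n (dpow n (binf n w)) w" "preceq n (dpow n k) w \<Longrightarrow> k \<le> binf n w"
proof -
  obtain m where m: "preceq n (dpow n m) w" using ex_binf by blast
  note G = Greatest_int [of "\<lambda>k. preceq n (dpow n k) w", OF m binf_bounded, folded binf_def]
  show "preceq n (dpow n (binf n w)) w" by (rule G(1))
  show "preceq n (dpow n k) w \<Longrightarrow> k \<le> binf n w" by (rule G(2))
qed

lemma bsup:
  "preceq n w (dpow n (bsup n w))" "preceq n w (dpow n k) \<Longrightarrow> bsup n w \<le> k"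
proof -
  obtain m where m: "preceq n w (dpow n m)" using ex_bsup by blast
  note L = Least_int [of "\<lambda>k. preceq n w (dpow n k)", OF m bsup_bounded, folded bsup_def]
  show "preceq n w (dpow n (bsup n w))" by (rule L(1))
  show "preceq n w (dpow n k) \<Longrightarrow> bsup n w \<le> k" by (rule L(2))
qed

end

section \<open>The super summit set\<close>

lemma block_edges_1_Suc: "1 \<le> k \<Longrightarrow> block_edges {1..Suc k} = block_edges {2..Suc k} @ [(2, 1)]"
proof -
  assume "1 \<le> k"
  then have "[1..<Suc (Suc k)] = 1 # 2 # [3..<Suc (Suc k)]" "[2..<Suc (Suc k)] = 2 # [3..<Suc (Suc k)]"
    by (simp_all add: upt_conv_Cons numeral_2_eq_2 numeral_3_eq_3 del: upt_Suc)
  then show ?thesis unfolding block_edges_def sorted_list_of_set_Icc by (metis path_edges.simps(3))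
qed

text \<open>Moving [k+1,...,1] through \<open>\<Delta>\<close> shifts it to [k+2,...,2], and the new
  a_21 extends it to [k+2,...,1].\<close>

lemma epsilon_power:
  "k < n \<Longrightarrow> br n (delta n @ band 2 1) ^ k = \<Delta> n ^ k * bw n (block_edges {1..Suc k})"
proof (induction k)
  case 0
  show ?case by (simp add: block_edges_def)
next
  case (Suc k)
  let ?b = "block_edges {1..Suc k}"
  have "edges_in {1..Suc k} ?b" by (simp add: edges_in_block_edges)
  then have s: "bw n ?b * \<Delta> n ^ 1 = \<Delta> n ^ 1 * bw n (shift 1 ?b)"
    using Suc(2) by (intro braid.bw_shift) auto
  have "br n (delta n @ band 2 1) ^ Suc k = \<Delta> n ^ k * (bw n ?b * \<Delta> n ^ 1) * br n (band 2 1)"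
    using Suc by (simp add: power_Suc2 br_delta mult.assoc del: power_Suc)
  also have "\<dots> = \<Delta> n ^ Suc k * (bw n (shift 1 ?b) * br n (band 2 1))"
    by (simp only: s) (simp only: power_Suc2 power_one_right mult.assoc)
  also have "shift 1 ?b = block_edges {2..Suc (Suc k)}" by (simp add: shift_block_edges numeral_2_eq_2)
  also have "bw n (block_edges {2..Suc (Suc k)}) * br n (band 2 1) = bw n (block_edges {1..Suc (Suc k)})"
    by (subst block_edges_1_Suc) simp_all
  finally show ?case .
qed

lemma braid_word_epsilon: "2 \<le> n \<Longrightarrow> braid_word n (delta n @ band 2 1)"
  using band_facts(3) [of 2 n 1] by simp

lemma expo_epsilon: "2 \<le> n \<Longrightarrow> expo (delta n @ band 2 1) = int n"
  using band_facts(2) [of 2 n 1] by (simp add: expo_delta)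

lemma conjugate_br:
  assumes "conjugate n x y" "braid_word n x"
  shows "\<exists>c. braid_word n c \<and> braid_word n y \<and> br n y = inverse (br n c) * br n x * br n c \<and> expo y = expo x"
proof -
  obtain c where c: "braid_word n c" "beq n y (winv c @ x @ c)"
    using assms(1) by (auto simp: conjugate_def)
  have y: "braid_word n y" using beq_braid_word [OF c(2)] by simp
  then have "br n y = br n (winv c @ x @ c)" using c assms(2) by (subst br_eq_iff) auto
  moreover have "expo y = expo x" using beq_expo [OF c(2)] by simp
  ultimately show ?thesis using c(1) y by (auto simp: mult.assoc)
qed

lemma group_conj_power:
  fixes c :: "'g::mult_group"
  shows "(inverse c * x * c) ^ k = inverse c * x ^ k * c"
  by (induction k) (simp_all add: mult.assoc)

context
  fixes n r d :: nat
  assumes n_eq: "n = r * d + 1" and r: "2 \<le> r" and d: "1 \<le> d"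
begin

lemma d_bounds: "3 \<le> n" "Suc d < n"
proof -
  have "2 * d \<le> r * d" using r by (intro mult_right_mono) auto
  then show "3 \<le> n" "Suc d < n" using n_eq d by linarith+
qed

lemma epsilon_power_factor:
  "\<exists>fs. edges_in {1..n} fs \<and> bw n (block_edges {1..Suc d}) * bw n fs = \<Delta> n"
proof -
  have "[1..<Suc n] = [1..<Suc d] @ Suc d # [Suc (Suc d)..<Suc n]"
    using d_bounds upt_add_eq_append [of 1 "Suc d" "n - d"] by (simp add: upt_conv_Cons del: upt_Suc)
  moreover have "[Suc d..<Suc n] = Suc d # [Suc (Suc d)..<Suc n]"
    using d_bounds by (intro upt_conv_Cons) simp
  moreover have "[1..<Suc (Suc d)] = [1..<Suc d] @ [Suc d]" by simp
  ultimately have "block_edges {1..n} = block_edges {Suc d..n} @ block_edges {1..Suc d}"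
    unfolding block_edges_def sorted_list_of_set_Icc by (metis path_edges_append)
  then have "bw n (block_edges {Suc d..n}) * bw n (block_edges {1..Suc d}) * bw n [] = \<Delta> n" by simp
  moreover have "edges_in {1..n} (block_edges {Suc d..n})"
    using edges_in_mono [OF edges_in_block_edges [of "{Suc d..n}"], of "{1..n}"] by auto
  ultimately show ?thesis using braid.middle_factor [of n _ "[]"] edges_in_simps(1) by blast
qed

text \<open>Minimality in the super summit set enters through this bound: together with the exponent
  sum it fixes the infimum and the supremum of every member.\<close>

lemma blen_epsilon_power: "blen n (wpow (delta n @ band 2 1) (int d)) \<le> 1"
proof -
  let ?e = "wpow (delta n @ band 2 1) (int d)"
  have n: "2 \<le> n" using d_bounds by simp
  have w: "braid_word n ?e" using n by (intro braid_word_wpow braid_word_epsilon)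
  have br: "br n ?e = \<Delta> n ^ d * bw n (block_edges {1..Suc d})"
    using epsilon_power [of d n] d_bounds by (simp only: br_wpow power_int_of_nat)
  have "edges_in {1..n} (block_edges {1..Suc d})"
    using d_bounds edges_in_mono [OF edges_in_block_edges [of "{1..Suc d}"], of "{1..n}"] by auto
  moreover have "inverse (br n (dpow n (int d))) * br n ?e = bw n (block_edges {1..Suc d})"
    by (simp only: br br_dpow power_int_of_nat group_cancel_simps)
  ultimately have "preceq n (dpow n (int d)) ?e"
    using w posI preceq_iff braid_word_dpow by blast
  then have "int d \<le> binf n ?e" by (rule binf(2) [OF n w])
  moreover have "preceq n ?e (dpow n (int (Suc d)))"
  proof -
    obtain fs where fs: "edges_in {1..n} fs" "bw n (block_edges {1..Suc d}) * bw n fs = \<Delta> n"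
      using epsilon_power_factor by blast
    have "inverse (br n ?e) * \<Delta> n ^ Suc d = bw n fs"
      unfolding br by (simp only: power_Suc2 fs(2) [symmetric] group_inverse_mult mult.assoc) simp
    then have "inverse (br n ?e) * br n (dpow n (int (Suc d))) = bw n fs"
      by (simp only: br_dpow power_int_of_nat)
    then show ?thesis using w fs(1) by (subst preceq_iff) (auto intro: posI)
  qed
  then have "bsup n ?e \<le> int (Suc d)" by (rule bsup(2) [OF n w])
  ultimately show ?thesis by (simp add: blen_def)
qed

lemma super_summit_form:
  assumes "\<alpha> \<in> super_summit_set n (wpow (delta n @ band 2 1) (int d))"
  shows "\<exists>es fs. edges_in {1..n} es \<and> edges_in {1..n} fs \<and> length es = d \<and>
    br n \<alpha> = \<Delta> n ^ d * bw n es \<and> bw n es * bw n fs = \<Delta> n"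
    and "br n \<alpha> ^ r = \<Delta> n ^ n"
proof -
  let ?e = "wpow (delta n @ band 2 1) (int d)"
  have n: "2 \<le> n" using d_bounds by simp
  have e: "braid_word n ?e" using n by (intro braid_word_wpow braid_word_epsilon)
  have "conjugate n ?e ?e"
    unfolding conjugate_def by (rule exI [of _ "[]"]) (use beq.refl [OF e] in simp)
  then have le: "blen n \<alpha> \<le> 1" and conj: "conjugate n ?e \<alpha>"
    using assms blen_epsilon_power unfolding super_summit_set_def by fastforce+
  obtain c where c: "braid_word n c" "braid_word n \<alpha>" "br n \<alpha> = inverse (br n c) * br n ?e * br n c"
    "expo \<alpha> = expo ?e"
    using conjugate_br [OF conj e] by blast
  have ex: "expo \<alpha> = int d * int n" using c(4) by (simp only: expo_wpow expo_epsilon [OF n])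
  define m s where "m = binf n \<alpha>" and "s = bsup n \<alpha>"
  have m: "preceq n (dpow n m) \<alpha>" and s: "preceq n \<alpha> (dpow n s)"
    unfolding m_def s_def using binf(1) [OF n c(2)] bsup(1) [OF n c(2)] by auto
  have sm: "s \<le> m + 1" using le by (simp add: blen_def m_def s_def)
  have "m * (int n - 1) \<le> int d * int n" "int d * int n \<le> s * (int n - 1)"
    using preceq_expo [OF m c(2)] preceq_expo [OF s] ex n by (simp_all add: expo_dpow)
  \<comment> \<open>The exponent sum \<open>d * n\<close> lies strictly between
    \<open>d * (n - 1)\<close> and \<open>(d + 1) * (n - 1)\<close>, because
    \<open>0 < d < n - 1\<close>. With \<open>s \<le> m + 1\<close> this leaves \<open>m = d\<close>
    and \<open>s = d + 1\<close>.\<close>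
  moreover have "int d * int n = int d * (int n - 1) + int d" by (simp add: algebra_simps)
  moreover have "(int d + 1) * (int n - 1) = int d * (int n - 1) + (int n - 1)"
    by (simp only: distrib_right mult_1_left)
  moreover have "0 < int d" "int d < int n - 1" using d d_bounds(2) by linarith+
  ultimately have "m * (int n - 1) < (int d + 1) * (int n - 1)" "int d * (int n - 1) < s * (int n - 1)"
    by linarith+
  then have "m < int d + 1" "int d < s"
    using n by (simp_all only: mult_less_cancel_right)
  then have md: "m = int d" "s = int (Suc d)" using sm by auto
  obtain es where es: "edges_in {1..n} es" "inverse (\<Delta> n ^ d) * br n \<alpha> = bw n es"
    using m c(2) unfolding md by (auto simp: preceq_iff br_dpow pos_def)
  obtain fs where fs: "edges_in {1..n} fs" "inverse (br n \<alpha>) * \<Delta> n ^ Suc d = bw n fs"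
    using s c(2) unfolding md by (subst (asm) preceq_iff) (auto simp: br_dpow pos_def simp del: of_nat_Suc)
  have \<alpha>: "br n \<alpha> = \<Delta> n ^ d * bw n es" by (simp flip: es(2))
  have "bw n es * bw n fs = inverse (\<Delta> n ^ d) * \<Delta> n ^ Suc d"
    by (simp add: mult.assoc flip: es(2) fs(2) del: power_Suc)
  then have "bw n es * bw n fs = \<Delta> n" by (simp add: power_Suc2 del: power_Suc)
  moreover have "length es = d"
  proof -
    have "br n (winv (dpow n (int d)) @ \<alpha>) = bw n es"
      by (simp only: br_append br_winv br_dpow power_int_of_nat es(2))
    moreover have "braid_word n (winv (dpow n (int d)) @ \<alpha>)" using c(2) by simp
    ultimately have "expo (winv (dpow n (int d)) @ \<alpha>) = int (length es)"
      using es(1) by (intro pos_br_expo)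
    then show ?thesis using ex n by (simp add: expo_dpow algebra_simps)
  qed
  ultimately show "\<exists>es fs. edges_in {1..n} es \<and> edges_in {1..n} fs \<and> length es = d \<and>
    br n \<alpha> = \<Delta> n ^ d * bw n es \<and> bw n es * bw n fs = \<Delta> n"
    using es(1) fs(1) \<alpha> by blast
  \<comment> \<open>Here \<open>d * r = n - 1\<close>, the last exponent that
    \<open>epsilon_power\<close> admits; the subsimple element is then a whole further
    \<open>\<Delta>\<close>.\<close>
  have "br n ?e ^ r = br n (delta n @ band 2 1) ^ (n - 1)"
    using n_eq by (simp only: br_wpow power_int_of_nat power_mult [symmetric]) (simp add: mult.commute)
  also have "\<dots> = \<Delta> n ^ (n - 1) * \<Delta> n" using epsilon_power [of "n - 1" n] n by simp
  also have "\<dots> = \<Delta> n ^ n" using n by (metis Suc_diff_1 power_Suc2 less_le_trans zero_less_numeral)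
  finally have e_pow: "br n ?e ^ r = \<Delta> n ^ n" .
  have "br n \<alpha> ^ r = inverse (br n c) * (\<Delta> n ^ n * br n c)"
    by (simp only: c(3) group_conj_power e_pow) (simp only: mult.assoc)
  then show "br n \<alpha> ^ r = \<Delta> n ^ n" by (simp only: \<Delta>_central [OF c(1), symmetric] group_cancel_simps)
qed

text \<open>\<open>\<Delta> ^ d\<close> sends \<open>1\<close> to \<open>Suc d\<close>, so in a
  1-pure braid \<open>es\<close> must send \<open>Suc d\<close> back to \<open>1\<close>.\<close>

lemma one_pure_form:
  assumes "one_pure \<alpha>" "braid_word n \<alpha>" "edges_in {1..n} es" "br n \<alpha> = \<Delta> n ^ d * bw n es"
  shows "pm es (Suc d) = 1"
proof -
  let ?D = "concat (replicate d (block_edges {1..n}))"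
  have D: "edges_in {1..n} (?D @ es)"
    using edges_in_\<Delta> assms(3) by (auto simp: edges_in_concat)
  have "bw n (concat (replicate k (block_edges {1..n}))) = \<Delta> n ^ k" for k by (induction k) simp_all
  then have "br n \<alpha> = br n (bword (?D @ es))" using assms(4) by (simp only: bw_eq_br [symmetric] band.bw_simps)
  then have "beq n \<alpha> (bword (?D @ es))" using assms(2) bword_facts(3) [OF D] br_eq_iff by blast
  then have perm: "pm (?D @ es) 1 = 1"
    using beq_braid_perm bword_facts(1) [OF D] assms(1) by (simp add: one_pure_def)
  have "pm (concat (replicate k (block_edges {1..n}))) x = x + k" if "1 \<le> x" "x + k \<le> n" for k x
    using that
  proof (induction k arbitrary: x)
    case (Suc k)
    have "pm (block_edges {1..n}) x = Suc x" using Suc.prems by (intro pm_block_edges_Icc) auto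
    then show ?case using Suc.IH [of "Suc x"] Suc.prems by (simp add: pm_append)
  qed simp
  then have "pm ?D 1 = Suc d" using d_bounds by simp
  then show ?thesis using perm by (simp add: pm_append)
qed

end

lemma braid_word_tau_pow: "braid_word n w \<Longrightarrow> braid_word n (tau_pow n m w)"
  by (simp add: tau_pow_def)

lemma br_tau_pow_minus:
  "br n (tau_pow n (- int k) w) = \<Delta> n ^ k * br n w * inverse (\<Delta> n ^ k)"
  by (simp add: tau_pow_def br_dpow group_powi_minus mult.assoc)

lemma group_conjugate_eq:
  fixes g :: "'g::mult_group"
  assumes "y * g = g * x"
  shows "g * x * inverse g = y"
  by (simp add: mult.assoc flip: assms)

theorem theorem3p2:
  fixes n r d :: nat and \<alpha> :: "int list"
  assumes "n = r * d + 1" and "2 \<le> r" and "1 \<le> d"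
    and "braid_word n \<alpha>"
    and "one_pure \<alpha>"
    and "\<alpha> \<in> super_summit_set n (wpow (delta n @ band 2 1) (int d))"
  shows "(d = 1 \<longrightarrow> beq n \<alpha> (delta n @ band 2 1))
       \<and> (2 \<le> d \<longrightarrow>
          (\<exists>a b. simple n a
             \<and> beq n \<alpha> (dpow n (int d) @ a)
             \<and> beq n a (band (d + 1) 1 @ concat (map b [0..<r]))
             \<and> (\<forall>k<r. simple n (b k) \<and> supported_on n {k * d + 2 .. k * d + d + 1} (b k))
             \<and> beq n (concat (map (\<lambda>k. tau_pow n (- int (k * d)) (b k)) [0..<r]))
                     (subsimple {2 .. d + 1})
             \<and> (let c = concat (map (\<lambda>m. tau_pow n (- int (m * d)) (concat (map b [m..<r]))) [1..<r])
                in simple n c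
                   \<and> beq n (winv c @ \<alpha> @ c) (wpow (delta n @ band 2 1) (int d)))))"
proof -
  let ?A = "\<lambda>i j. br n (band i j)"
  note params = assms(1-3)
  note bounds = d_bounds [OF params]
  obtain es fs where es: "edges_in {1..n} es" "length es = d" "br n \<alpha> = \<Delta> n ^ d * bw n es"
    and fs: "edges_in {1..n} fs" "bw n es * bw n fs = \<Delta> n"
    using super_summit_form(1) [OF params assms(6)] by blast
  have pm: "pm es (Suc d) = 1"
    by (rule one_pure_form [OF params assms(5,4) es(1,3)])
  interpret st: staircase n ?A r d by unfold_locales (use params in auto)
  obtain bs where bs: "edges_in {1..n} bs" "bw n es = ?A (Suc d) 1 * bw n bs"
    using st.strip_long_band [OF es(1) fs(1) _ pm] fs(2) by auto
  have long_edges: "edges_in {1..n} ((Suc d, 1) # bs)" using bs(1) bounds assms(3) by auto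
  have bw_long: "bw n es = bw n ((Suc d, 1) # bs)" using bs(2) by simp
  \<comment> \<open>The long band is one of the \<open>d\<close> edges; for \<open>d = 1\<close>
    nothing else is left and \<open>a\<close> is a_21.\<close>
  have len: "length bs = d - 1"
    using braid.bw_eq_imp [OF es(1) long_edges bw_long] es(2) by simp
  have pow: "(\<Delta> n ^ d * (?A (Suc d) 1 * bw n bs)) ^ r = \<Delta> n ^ n"
    using super_summit_form(2) [OF params assms(6)] by (simp only: es(3) bs(2))
  obtain B where B: "\<And>k. k < r \<Longrightarrow> edges_in {2..Suc d} (B k)"
    "bw n bs = prod_list (map (\<lambda>k. bw n (shift (k * d) (B k))) [0..<r])"
    using st.sector_decomposition [OF bs(1) pow] by blast
  interpret se: sectors n ?A r d B by unfold_locales (rule B(1))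
  have diag: "bw n bs = prod_list (map (\<lambda>k. se.Y k k) [0..<r])" by (simp only: B(2) se.Y_def)
  \<comment> \<open>The assumption to be discharged is (2); it follows from \<open>pow\<close>, with
    \<open>bs\<close> written as the product over the sectors.\<close>
  interpret full: full_sectors n ?A r d B
    by unfold_locales (rule se.product_of_sectors, use pow in \<open>simp only: diag se.long_def\<close>)
  \<comment> \<open>The words \<open>B k\<close> were all normalized to the first sector;
    \<open>shift\<close> puts them back where they occur in \<open>bs\<close>.\<close>
  define b where "b k = bword (shift (k * d) (B k))" for k
  let ?a = "bword es" and ?\<epsilon> = "wpow (delta n @ band 2 1) (int d)"
  define c where "c = concat (map (\<lambda>m. tau_pow n (- int (m * d)) (concat (map b [m..<r]))) [1..<r])"
  have b_edges: "edges_in {1..n} (shift (k * d) (B k))" if "k < r" for k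
    using st.edges_in_n [OF that se.edges_in_S [OF that]] .
  have b_word: "braid_word n (b k)" if "k < r" for k
    unfolding b_def by (rule bword_facts(3) [OF b_edges [OF that]])
  have b_br: "br n (b k) = se.Y k k" for k by (simp add: b_def se.Y_def bw_eq_br)
  have a_word: "braid_word n ?a" by (rule bword_facts(3) [OF es(1)])
  have \<epsilon>_word: "braid_word n ?\<epsilon>" using bounds by (intro braid_word_wpow braid_word_epsilon) simp
  have \<epsilon>_br: "br n ?\<epsilon> = \<Delta> n ^ d * (se.long * prod_list (map (se.Y 0) [0..<r]))"
    using epsilon_power [of d n] bounds by (simp only: br_wpow power_int_of_nat full.full se.first_block)
  have \<alpha>_br: "br n \<alpha> = \<Delta> n ^ d * (se.long * prod_list (map (\<lambda>k. se.Y k k) [0..<r]))"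
    by (simp only: es(3) bs(2) diag se.long_def)
  have c_word: "braid_word n c"
    unfolding c_def braid_word_concat using b_word
    by (auto intro!: braid_word_tau_pow simp: braid_word_concat)
  have c_br: "br n c = prod_list (map se.C [1..<r])"
  proof -
    have "br n (tau_pow n (- int (m * d)) (concat (map b [m..<r]))) = se.C m" for m
      unfolding br_tau_pow_minus br_concat map_map comp_def b_br
      by (rule group_conjugate_eq) (rule se.C_conj_diag)
    then show ?thesis by (simp add: c_def br_concat comp_def)
  qed
  show ?thesis
  proof (intro conjI impI)
    assume "d = 1"
    then have "br n \<alpha> = br n (delta n @ band 2 1)"
      using es(3) bs(2) len by (simp add: br_delta numeral_2_eq_2)
    then show "beq n \<alpha> (delta n @ band 2 1)"
      using assms(4) braid_word_epsilon bounds by (subst (asm) br_eq_iff) auto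
  next
    have "simple n ?a"
      by (rule simpleI [OF a_word bw_eq_br [symmetric] es(1) fs(1)]) (simp only: fs(2) flip: bw_eq_br)
    moreover have "beq n \<alpha> (dpow n (int d) @ ?a)"
      using assms(4) a_word es(3) by (subst br_eq_iff [symmetric]) (auto simp: br_dpow bw_eq_br)
    moreover have "beq n ?a (band (d + 1) 1 @ concat (map b [0..<r]))"
    proof -
      have "braid_word n (band (d + 1) 1)" using band_facts(3) bounds assms(3) by simp
      moreover have "br n ?a = br n (band (d + 1) 1 @ concat (map b [0..<r]))"
        using bs(2) by (simp add: br_concat comp_def b_br diag flip: bw_eq_br)
      ultimately show ?thesis
        using a_word b_word by (subst br_eq_iff [symmetric]) (auto simp: braid_word_concat)
    qed
    moreover have "simple n (b k) \<and> supported_on n {k * d + 2..k * d + d + 1} (b k)" if k: "k < r" for k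
    proof
      obtain gs where gs: "edges_in {1..n} gs" "se.Y k k * bw n gs = \<Delta> n"
        using full.sector_factor_simple [OF k] by blast
      have eq: "br n (b k) = bw n (shift (k * d) (B k))" by (simp only: b_def bw_eq_br)
      show "simple n (b k)"
        by (rule simpleI [OF b_word [OF k] eq b_edges [OF k] gs(1)]) (simp only: b_br gs(2))
      obtain P where P: "noncrossing_partition n P"
        "bw n (shift (k * d) (B k)) = bw n (blocks_edges P)" "\<forall>U\<in>set P. 2 \<le> card U \<longrightarrow> U \<subseteq> st.S k"
        using braid.supported_blocks [OF se.edges_in_S [OF k] st.S_subset [OF k] gs(1)] gs(2) bounds
        by (auto simp: se.Y_def)
      have "br n (b k) = br n (concat (map subsimple P))"
        unfolding concat_subsimple_eq eq P(2) by (rule bw_eq_br)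
      then have "beq n (b k) (concat (map subsimple P))"
        using b_word [OF k] bword_facts(3) [OF nc_partitionD(8) [OF P(1)]]
        by (simp add: br_eq_iff concat_subsimple_eq)
      moreover have "st.S k = {k * d + 2..k * d + d + 1}" by (auto simp: st.S_def)
      ultimately show "supported_on n {k * d + 2..k * d + d + 1} (b k)"
        unfolding supported_on_def using P(1,3) by metis
    qed
    moreover have "beq n (concat (map (\<lambda>k. tau_pow n (- int (k * d)) (b k)) [0..<r])) (subsimple {2..d + 1})"
    proof -
      have "br n (tau_pow n (- int (k * d)) (b k)) = se.Y 0 k" if "k < r" for k
        unfolding br_tau_pow_minus b_br
        by (rule group_conjugate_eq) (rule se.Y_conj_pow [OF that that])
      then have rows: "map (\<lambda>k. br n (tau_pow n (- int (k * d)) (b k))) [0..<r] = map (se.Y 0) [0..<r]"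
        by (intro map_cong) auto
      have "br n (concat (map (\<lambda>k. tau_pow n (- int (k * d)) (b k)) [0..<r])) = br n (subsimple {2..d + 1})"
        by (simp only: br_concat map_map comp_def rows full.full subsimple_eq bw_eq_br Suc_eq_plus1)
      moreover have "braid_word n (subsimple {2..d + 1})"
        unfolding subsimple_eq
        using edges_in_mono [OF edges_in_block_edges [of "{2..d + 1}"], of "{1..n}"] bounds
        by (intro bword_facts(3)) auto
      ultimately show ?thesis
        using b_word by (subst br_eq_iff [symmetric])
          (auto simp: braid_word_concat intro!: braid_word_tau_pow)
    qed
    moreover have "simple n c"
    proof -
      obtain gs where gs: "edges_in {1..n} gs" "br n c * bw n gs = \<Delta> n"
        using full.conjugator_simple unfolding c_br by blast
      show ?thesis
        by (rule simpleI [OF c_word _ se.edges_in_cs gs]) (simp only: c_br se.bw_cs)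
    qed
    moreover have "beq n (winv c @ \<alpha> @ c) ?\<epsilon>"
    proof -
      have "br n \<alpha> * br n c = br n c * br n ?\<epsilon>"
        by (simp only: \<alpha>_br c_br \<epsilon>_br se.conjugation)
      then have "br n (winv c @ \<alpha> @ c) = br n ?\<epsilon>" by simp
      then show ?thesis using c_word assms(4) \<epsilon>_word by (subst (asm) br_eq_iff) auto
    qed
    ultimately show "\<exists>a b. simple n a
             \<and> beq n \<alpha> (dpow n (int d) @ a)
             \<and> beq n a (band (d + 1) 1 @ concat (map b [0..<r]))
             \<and> (\<forall>k<r. simple n (b k) \<and> supported_on n {k * d + 2 .. k * d + d + 1} (b k))
             \<and> beq n (concat (map (\<lambda>k. tau_pow n (- int (k * d)) (b k)) [0..<r]))
                     (subsimple {2 .. d + 1})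
             \<and> (let c = concat (map (\<lambda>m. tau_pow n (- int (m * d)) (concat (map b [m..<r]))) [1..<r])
                in simple n c \<and> beq n (winv c @ \<alpha> @ c) ?\<epsilon>)"
      unfolding Let_def c_def by blast
  qed
qed

end
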